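(* Assume the discrete inf-sup condition with constant $\gamma>0$ (see context). If the threshold $\eta\in(0,1)$ is chosen such that $\gamma_1:=\gamma-2\eta>0$, then the global sesquilinear form $b_{P_1}(\cdot,\cdot)$ satisfies $$\inf_{u_0\in V_0\setminus\{0\}}\ \sup_{v_0\in V_0\setminus\{0\}}\frac{|b_{P_1}(u_0,v_0)|}{|||u_0|||\,|||v_0|||}\ \ge\ \gamma_1 .$$
   Context: Setting. $\Omega\subset\mathbb{R}^d$, $d\in\{2,3\}$, is a bounded convex polygonal/polyhedral domain, $k\ge k_0>0$, and $$b(u,v)=\int_\Omega\nabla u\cdot\nabla\overline v\,dx-k^2\int_\Omega u\overline v\,dx+ik\int_{\partial\Omega}u\overline v\,ds .$$ $\overline\Omega=\bigcup_{i=1}^N\overline\Omega_i$ is a decomposition into pairwise disjoint polygonal/polyhedral subdomains; each subdomain is a union of elements of a shape-regular mesh $\mathcal T_h$ of size $h$, and $V_h\subset H^1(\Omega)$ is the corresponding (complex) conforming finite element space with a real nodal basis. Functions in $V_h$ are identified with their nodal vectors. $\Gamma_i=\partial\Omega_i$, $\Gamma=\bigcup_i\Gamma_i$ (so $\partial\Omega\subset\Gamma$), $I_i=\Omega_i$ (interior), $I=\bigcup_i I_i$; the same symbols index the nodes in these sets, and $u_h=(u_\Gamma,u_I)$. $V_h(\Gamma)$, $V_h(\Gamma_i)$, $V_h(I_i)$ are the spaces of nodal vectors on these sets. $R_{\Gamma_i\Gamma}$ and $R_{I_iI}$ are the restriction matrices from nodal vectors on $\Gamma$ to $\Gamma_i$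 and from $I$ to $I_i$; their transposes are the zero extensions. Superscripts $T$, $H$ are transpose and conjugate transpose; $\Re$, $\Im$ of a matrix are entrywise. Norm: $\|v\|_{\mathcal H}^2=|v|_{H^1(\Omega)}^2+k^2\|v\|_{L^2(\Omega)}^2$; $\|\cdot\|_{\mathcal H,\Omega_i}$ is its analogue on $\Omega_i$. Local matrices, in block form with respect to the nodes of $\Gamma_i$ and $I_i$: $$B^{(i)}=\begin{bmatrix}B^{(i)}_{\Gamma\Gamma}&B^{(i)}_{\Gamma I}\\ B^{(i)}_{I\Gamma}&B^{(i)}_{II}\end{bmatrix},\qquad H^{(i)}=\begin{bmatrix}H^{(i)}_{\Gamma\Gamma}&H^{(i)}_{\Gamma I}\\ H^{(i)}_{I\Gamma}&H^{(i)}_{II}\end{bmatrix}$$ are the matrices of $b^{(i)}(u,v)=\int_{\Omega_i}(\nabla u\cdot\nabla\overline v-k^2u\overline v)dx+ik\int_{\partial\Omega_i\cap\partial\Omega}u\overline v\,ds$ and of the inner product of $\|\cdot\|_{\mathcal H,\Omega_i}$ on $V_h(\overline\Omega_i)$. $B^{(i)}_{\Gamma I},B^{(i)}_{I\Gamma},B^{(i)}_{II}$ are real. Discrete inf-sup condition (standing assumption): there is $\gamma>0$ with $$\inf_{u\in V_h\setminus\{0\}}\sup_{v\in V_h\setminus\{0\}}\frac{|b(u,v)|}{\|u\|_{\mathcal H}\|v\|_{\mathcal H}}\ge\gamma .$$ Spaces. For each $i$ solve $B^{(i)}_{II}\phi^{(i)}_j=\mu^{(i)}_jH^{(i)}_{II}\phi^{(i)}_j$,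 $j=1,\dots,n_i$, with real eigenvectors orthonormal with respect to $H^{(i)}_{II}$. Given a fixed $\beta>0$, the columns of $Q_S^{(i)}$ are the $k_i$ eigenvectors with $|\mu_j^{(i)}|<\beta$ and the columns of $Q_L^{(i)}$ are the remaining ones. Set $$B_L^{(i)}=Q_L^{(i)}\big(Q_L^{(i)T}B_{II}^{(i)}Q_L^{(i)}\big)^{-1}Q_L^{(i)T},\qquad H_L^{(i)}=Q_L^{(i)}\big(Q_L^{(i)T}H_{II}^{(i)}Q_L^{(i)}\big)^{-1}Q_L^{(i)T}.$$ $V_0$ is the space of vectors $u_0=(u_\Gamma,\alpha_S)$, $u_\Gamma\in V_h(\Gamma)$, $\alpha_S=(\alpha_S^{(1)},\dots,\alpha_S^{(N)})$, $\alpha_S^{(i)}\in\mathbb C^{k_i}$; $R_S^{(i)}\alpha_S=\alpha_S^{(i)}$; $V_0^{(i)}=V_h(\Gamma_i)\oplus\mathbb C^{k_i}$ and $R_{\Gamma,S}^{(i)}:V_0\to V_0^{(i)}$, $R_{\Gamma,S}^{(i)}(u_\Gamma,\alpha_S)=(R_{\Gamma_i\Gamma}u_\Gamma,\alpha_S^{(i)})$. The norm on $V_0$ is $|||u_0|||=\|\mathcal H_0^Tu_0\|_{\mathcal H}$, where $$\mathcal H_0^Tu_0=\begin{bmatrix}u_\Gamma\\ \sum_{i}R_{I_iI}^T\big(-H_L^{(i)}H_{I\Gamma}^{(i)}R_{\Gamma_i\Gamma}u_\Gamma+Q_S^{(i)}R_S^{(i)}\alpha_S\big)\end{bmatrix}.$$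 Local coarse matrices: $$B_0^{(i)}=\begin{bmatrix}B_{\Gamma\Gamma}^{(i)}-B_{\Gamma I}^{(i)}B_L^{(i)}B_{I\Gamma}^{(i)}&B_{\Gamma I}^{(i)}Q_S^{(i)}\\ Q_S^{(i)T}B_{I\Gamma}^{(i)}&Q_S^{(i)T}B_{II}^{(i)}Q_S^{(i)}\end{bmatrix},\quad H_0^{(i)}=\begin{bmatrix}\hat H_{\Gamma\Gamma}^{(i)}&H_{\Gamma I}^{(i)}Q_S^{(i)}\\ Q_S^{(i)T}H_{I\Gamma}^{(i)}&Q_S^{(i)T}H_{II}^{(i)}Q_S^{(i)}\end{bmatrix},$$ with $\hat H_{\Gamma\Gamma}^{(i)}=H_{\Gamma\Gamma}^{(i)}-H_{\Gamma I}^{(i)}H_L^{(i)}H_{I\Gamma}^{(i)}$, and $$C_0^{(i)}=\begin{bmatrix}\hat C_{\Gamma\Gamma}^{(i)}&0\\ 0&Q_S^{(i)T}H_{II}^{(i)}Q_S^{(i)}\end{bmatrix},$$ where $\hat C_{\Gamma\Gamma}^{(i)}$ is the block-diagonal part of $\hat H_{\Gamma\Gamma}^{(i)}$ obtained by setting to zero all entries coupling nodes of $\Gamma_i$ that belong to different subdomain vertices/edges (open edges; for $d=3$ also open faces). Both $H_0^{(i)}$ and $C_0^{(i)}$ are symmetric positive definite. Spectral selection with threshold $\eta\in(0,1)$. (1) Solve $\Re B_0^{(i)}\xi_j=\lambda_jH_0^{(i)}\xi_j$ with real eigenvectors orthonormal with respect to $H_0^{(i)}$; the columns of $Q_1^{(i)}$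 are the eigenvectors with $\lambda_j<1-\eta$ or $\lambda_j>1+\eta$, and the columns of $Q_1^{(i)\perp}$ are the remaining ones. (2) Solve $(Q_1^{(i)\perp})^TC_0^{(i)}Q_1^{(i)\perp}\phi_j=\lambda_j(Q_1^{(i)\perp})^TH_0^{(i)}Q_1^{(i)\perp}\phi_j$ with eigenvectors orthonormal with respect to $(Q_1^{(i)\perp})^TH_0^{(i)}Q_1^{(i)\perp}$; the columns of $Q_2^{(i)}$ are the vectors $Q_1^{(i)\perp}\phi_j$ with $\lambda_j<1-\eta$ or $\lambda_j>1+\eta$. Put $Q_{Re}^{(i)}=[Q_1^{(i)},Q_2^{(i)}]$ and $\Pi_{Re}^{(i)}=Q_{Re}^{(i)}Q_{Re}^{(i)T}H_0^{(i)}$. The form: for $u_0,v_0\in V_0$, $b_{P_1}(u_0,v_0)=\sum_{i=1}^N(R_{\Gamma,S}^{(i)}v_0)^H B_{P_1}^{(i)}R_{\Gamma,S}^{(i)}u_0$, where $$B_{P_1}^{(i)}=\Re B_0^{(i)}+\mathbf i\,\Im B_0^{(i)}-(I-\Pi_{Re}^{(i)})^T\,\Re B_0^{(i)}\,(I-\Pi_{Re}^{(i)})+(I-\Pi_{Re}^{(i)})^TC_0^{(i)}(I-\Pi_{Re}^{(i)}).$$ *)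

theory Defs
  imports "HOL-Analysis.Analysis" "HOL-Library.Extended_Real" "Jordan_Normal_Form.Matrix"
begin

no_notation inner (infix "\<bullet>" 70)
no_notation vec_nth (infixl "$" 90)

section \<open>Finite element spaces on a decomposed domain\<close>

text \<open>
  The geometric data: the domain, the subdomains (indices \<open>i < nsub\<close>), the mesh (closed elements),
  the local finite element space on each element, the nodes, the nodal basis (one function for each
  node), and the wave number \<open>k\<close>.  A node is a point of space and doubles as its own index.
\<close>

record ('d::finite) fe_decomposition =
  dom :: "(real^'d) set"
  nsub :: nat
  sub :: "nat \<Rightarrow> (real^'d) set"
  mesh :: "(real^'d) set set"
  local_space :: "(real^'d) set \<Rightarrow> (real^'d \<Rightarrow> real) set"
  nodes :: "(real^'d) set"
  nodal_fun :: "real^'d \<Rightarrow> real^'d \<Rightarrow> real"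
  wavenumber :: real

definition conforming_mesh :: "(real^'d::finite) set \<Rightarrow> (real^'d) set set \<Rightarrow> bool" where
  "conforming_mesh \<Omega> T \<longleftrightarrow>
     finite T \<and>
     (\<forall>K\<in>T. polytope K \<and> interior K \<noteq> {}) \<and>
     (\<forall>K\<in>T. \<forall>K'\<in>T. K \<inter> K' face_of K \<and> K \<inter> K' face_of K') \<and>
     \<Union>T = closure \<Omega>"

definition shape_regular :: "real \<Rightarrow> (real^'d::finite) set set \<Rightarrow> bool" where
  "shape_regular \<sigma> T \<longleftrightarrow> 0 < \<sigma> \<and> (\<forall>K\<in>T. \<exists>x. ball x (diameter K / \<sigma>) \<subseteq> K)"

definition mesh_size :: "(real^'d::finite) set set \<Rightarrow> real" where
  "mesh_size T = Max (diameter ` T)"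

definition C1_up_to_boundary :: "(real^'d::finite) set \<Rightarrow> (real^'d \<Rightarrow> real) \<Rightarrow> bool" where
  "C1_up_to_boundary K p \<longleftrightarrow>
     (\<exists>g. continuous_on K g \<and> (\<forall>x\<in>K. (p has_derivative (\<lambda>h. inner (g x) h)) (at x within K)))"

text \<open>
  The complex conforming space: continuous functions on the closed domain that belong to the
  complexified local space on every element.  Functions are extended by zero outside the closed
  domain, so that equality of elements of the space is equality of functions.
\<close>

definition Vh :: "('d::finite, 'z) fe_decomposition_scheme \<Rightarrow> (real^'d \<Rightarrow> complex) set" where
  "Vh S = {v. continuous_on (closure (dom S)) v \<and> (\<forall>x. x \<notin> closure (dom S) \<longrightarrow> v x = 0) \<and>
     (\<forall>K\<in>mesh S. \<exists>p\<in>local_space S K. \<exists>q\<in>local_space S K. \<forall>x\<in>K. v x = Complex (p x) (q x))}"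

text \<open>
  Nodal (Lagrange) finite elements in the sense of Ciarlet, with an arbitrary local space of
  functions that are \<open>C\<^sup>1\<close> up to the boundary (for instance polynomials).  The third clause says that the
  nodes on a face \<open>F\<close> of an element (\<open>F = K\<close> included) determine the trace on \<open>F\<close>; it is the usual condition
  behind conformity.  Continuity and elementwise smoothness give \<open>V\<^sub>h \<subseteq> H\<^sup>1\<close>.
\<close>

definition nodal_fe_space :: "('d::finite, 'z) fe_decomposition_scheme \<Rightarrow> bool" where
  "nodal_fe_space S \<longleftrightarrow>
     finite (nodes S) \<and> nodes S \<subseteq> closure (dom S) \<and>
     (\<forall>K\<in>mesh S. (\<lambda>x. 0) \<in> local_space S K \<and>
        (\<forall>p\<in>local_space S K. C1_up_to_boundary K p \<and>
           (\<forall>q\<in>local_space S K. \<forall>a c. (\<lambda>x. a * p x + c * q x) \<in> local_space S K))) \<and>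
     (\<forall>K\<in>mesh S. \<forall>F. F face_of K \<longrightarrow>
        (\<forall>p\<in>local_space S K. (\<forall>x\<in>nodes S \<inter> F. p x = 0) \<longrightarrow> (\<forall>x\<in>F. p x = 0))) \<and>
     (\<forall>y\<in>nodes S. (\<lambda>x. complex_of_real (nodal_fun S y x)) \<in> Vh S \<and>
        (\<forall>x\<in>nodes S. nodal_fun S y x = (if x = y then 1 else 0)))"

text \<open>
  The subdomains are polygonal/polyhedral because their closures are unions of elements;
  \<open>interior (closure D) = D\<close> excludes slits.
\<close>

definition subdomain_decomposition :: "('d::finite, 'z) fe_decomposition_scheme \<Rightarrow> bool" where
  "subdomain_decomposition S \<longleftrightarrow>
     (\<forall>i<nsub S. open (sub S i) \<and> connected (sub S i) \<and> sub S i \<noteq> {} \<and>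
        interior (closure (sub S i)) = sub S i \<and>
        (\<exists>T\<subseteq>mesh S. closure (sub S i) = \<Union>T)) \<and>
     (\<forall>i<nsub S. \<forall>j<nsub S. i \<noteq> j \<longrightarrow> sub S i \<inter> sub S j = {}) \<and>
     closure (dom S) = (\<Union>i<nsub S. closure (sub S i))"

definition fe_setting :: "real \<Rightarrow> real \<Rightarrow> ('d::finite, 'z) fe_decomposition_scheme \<Rightarrow> bool" where
  "fe_setting h \<sigma> S \<longleftrightarrow>
     open (dom S) \<and> bounded (dom S) \<and> convex (dom S) \<and> dom S \<noteq> {} \<and> polytope (closure (dom S)) \<and>
     conforming_mesh (dom S) (mesh S) \<and> mesh_size (mesh S) = h \<and> shape_regular \<sigma> (mesh S) \<and>
     nodal_fe_space S \<and> subdomain_decomposition S"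


section \<open>Sesquilinear forms and norms\<close>

text \<open>
  Pointwise derivatives.  A function in \<open>V\<^sub>h\<close> is differentiable off the mesh skeleton, a null set, and
  there the pointwise gradient is the weak one.
\<close>

definition partial_deriv :: "'d \<Rightarrow> (real^'d::finite \<Rightarrow> complex) \<Rightarrow> real^'d \<Rightarrow> complex" where
  "partial_deriv j u x = frechet_derivative u (at x) (axis j 1)"

definition grad_int :: "(real^'d::finite) set \<Rightarrow> (real^'d \<Rightarrow> complex) \<Rightarrow> (real^'d \<Rightarrow> complex) \<Rightarrow> complex" where
  "grad_int D u v =
     set_lebesgue_integral lebesgue D (\<lambda>x. \<Sum>j\<in>UNIV. partial_deriv j u x * cnj (partial_deriv j v x))"

definition mass_int :: "(real^'d::finite) set \<Rightarrow> (real^'d \<Rightarrow> complex) \<Rightarrow> (real^'d \<Rightarrow> complex) \<Rightarrow> complex" where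
  "mass_int D u v = set_lebesgue_integral lebesgue D (\<lambda>x. u x * cnj (v x))"

text \<open>
  Surface measure on a facet \<open>F\<close>: the \<open>(d-1)\<close>-dimensional measure of \<open>A \<subseteq> F\<close> is the
  \<open>d\<close>-dimensional volume of the right prism of height 1 over \<open>A\<close>, so the surface measure is the image of
  Lebesgue measure on the prism over \<open>F\<close> under the orthogonal projection onto the hyperplane of \<open>F\<close>.
  The two choices of unit normal give the same measure.
\<close>

definition unit_normal :: "(real^'d::finite) set \<Rightarrow> real^'d" where
  "unit_normal F = (SOME n. norm n = 1 \<and> (\<forall>x\<in>F. \<forall>y\<in>F. inner n (x - y) = 0))"

definition facet_measure :: "(real^'d::finite) set \<Rightarrow> (real^'d) measure" where
  "facet_measure F =
     distr (restrict_space lborel {x + t *\<^sub>R unit_normal F | x t. x \<in> F \<and> 0 \<le> t \<and> t \<le> 1})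
       borel (closest_point (affine hull F))"

text \<open>The integral over \<open>A \<inter> \<partial>\<Omega>\<close>, for a convex polytope \<open>\<Omega>\<close>.\<close>

definition boundary_int :: "(real^'d::finite) set \<Rightarrow> (real^'d) set \<Rightarrow> (real^'d \<Rightarrow> complex) \<Rightarrow> complex" where
  "boundary_int \<Omega> A f =
     (\<Sum>F | F facet_of closure \<Omega>. set_lebesgue_integral (facet_measure F) (A \<inter> F) f)"

text \<open>
  The form on a subset \<open>D\<close> of the domain, with boundary term on \<open>\<partial>D \<inter> \<partial>\<Omega>\<close>: \<open>D = \<Omega>\<close> gives \<open>b\<close>, and
  \<open>D = \<Omega>\<^sub>i\<close> gives the local form.
\<close>

definition b_form :: "('d::finite, 'z) fe_decomposition_scheme \<Rightarrow> (real^'d) set \<Rightarrow>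
    (real^'d \<Rightarrow> complex) \<Rightarrow> (real^'d \<Rightarrow> complex) \<Rightarrow> complex" where
  "b_form S D u v =
     grad_int D u v - (complex_of_real (wavenumber S))\<^sup>2 * mass_int D u v
       + \<i> * complex_of_real (wavenumber S) *
         boundary_int (dom S) (frontier D \<inter> frontier (dom S)) (\<lambda>x. u x * cnj (v x))"

definition H_form :: "('d::finite, 'z) fe_decomposition_scheme \<Rightarrow> (real^'d) set \<Rightarrow>
    (real^'d \<Rightarrow> complex) \<Rightarrow> (real^'d \<Rightarrow> complex) \<Rightarrow> complex" where
  "H_form S D u v = grad_int D u v + (complex_of_real (wavenumber S))\<^sup>2 * mass_int D u v"

definition H_norm :: "('d::finite, 'z) fe_decomposition_scheme \<Rightarrow> (real^'d \<Rightarrow> complex) \<Rightarrow> real" where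
  "H_norm S v = sqrt (Re (H_form S (dom S) v v))"

text \<open>Infimum and supremum are taken in the extended reals, so they need no side conditions.\<close>

definition inf_sup :: "'a set \<Rightarrow> 'a \<Rightarrow> ('a \<Rightarrow> 'a \<Rightarrow> complex) \<Rightarrow> ('a \<Rightarrow> real) \<Rightarrow> ereal" where
  "inf_sup V z f nrm =
     (INF u\<in>V - {z}. SUP v\<in>V - {z}. ereal (cmod (f u v) / (nrm u * nrm v)))"


section \<open>Matrices\<close>

definition \<Gamma>_nodes :: "('d::finite, 'z) fe_decomposition_scheme \<Rightarrow> nat \<Rightarrow> (real^'d) set" where
  "\<Gamma>_nodes S i = nodes S \<inter> frontier (sub S i)"

definition I_nodes :: "('d::finite, 'z) fe_decomposition_scheme \<Rightarrow> nat \<Rightarrow> (real^'d) set" where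
  "I_nodes S i = nodes S \<inter> sub S i"

definition all_\<Gamma>_nodes :: "('d::finite, 'z) fe_decomposition_scheme \<Rightarrow> (real^'d) set" where
  "all_\<Gamma>_nodes S = (\<Union>i<nsub S. \<Gamma>_nodes S i)"

definition all_I_nodes :: "('d::finite, 'z) fe_decomposition_scheme \<Rightarrow> (real^'d) set" where
  "all_I_nodes S = (\<Union>i<nsub S. I_nodes S i)"

text \<open>A fixed but arbitrary numbering of a finite set of nodes, for use as matrix indices.\<close>

definition numbering :: "'a set \<Rightarrow> 'a list" where
  "numbering A = (SOME xs. distinct xs \<and> set xs = A)"

definition nodal_cfun :: "('d::finite, 'z) fe_decomposition_scheme \<Rightarrow> real^'d \<Rightarrow> real^'d \<Rightarrow> complex" where
  "nodal_cfun S y x = complex_of_real (nodal_fun S y x)"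

text \<open>The block of the matrix of \<open>f\<close> with rows (test functions) in \<open>X\<close> and columns (trial functions) in \<open>Y\<close>.\<close>

definition form_matrix :: "('d::finite, 'z) fe_decomposition_scheme \<Rightarrow>
    ((real^'d \<Rightarrow> complex) \<Rightarrow> (real^'d \<Rightarrow> complex) \<Rightarrow> complex) \<Rightarrow> (real^'d) set \<Rightarrow> (real^'d) set \<Rightarrow> complex mat" where
  "form_matrix S f X Y = mat (card X) (card Y)
     (\<lambda>(r, c). f (nodal_cfun S (numbering Y ! c)) (nodal_cfun S (numbering X ! r)))"

definition restriction :: "'a set \<Rightarrow> 'a set \<Rightarrow> complex mat" where
  "restriction X Y = mat (card X) (card Y)
     (\<lambda>(r, c). if numbering X ! r = numbering Y ! c then 1 else 0)"

abbreviation "R\<^sub>\<Gamma> S i \<equiv> restriction (\<Gamma>_nodes S i) (all_\<Gamma>_nodes S)"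
abbreviation "R\<^sub>I S i \<equiv> restriction (I_nodes S i) (all_I_nodes S)"

abbreviation "B\<^sub>\<Gamma>\<^sub>\<Gamma> S i \<equiv> form_matrix S (b_form S (sub S i)) (\<Gamma>_nodes S i) (\<Gamma>_nodes S i)"
abbreviation "B\<^sub>\<Gamma>\<^sub>I S i \<equiv> form_matrix S (b_form S (sub S i)) (\<Gamma>_nodes S i) (I_nodes S i)"
abbreviation "B\<^sub>I\<^sub>\<Gamma> S i \<equiv> form_matrix S (b_form S (sub S i)) (I_nodes S i) (\<Gamma>_nodes S i)"
abbreviation "B\<^sub>I\<^sub>I S i \<equiv> form_matrix S (b_form S (sub S i)) (I_nodes S i) (I_nodes S i)"
abbreviation "H\<^sub>\<Gamma>\<^sub>\<Gamma> S i \<equiv> form_matrix S (H_form S (sub S i)) (\<Gamma>_nodes S i) (\<Gamma>_nodes S i)"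
abbreviation "H\<^sub>\<Gamma>\<^sub>I S i \<equiv> form_matrix S (H_form S (sub S i)) (\<Gamma>_nodes S i) (I_nodes S i)"
abbreviation "H\<^sub>I\<^sub>\<Gamma> S i \<equiv> form_matrix S (H_form S (sub S i)) (I_nodes S i) (\<Gamma>_nodes S i)"
abbreviation "H\<^sub>I\<^sub>I S i \<equiv> form_matrix S (H_form S (sub S i)) (I_nodes S i) (I_nodes S i)"

definition fe_function :: "('d::finite, 'z) fe_decomposition_scheme \<Rightarrow>
    complex Matrix.vec \<Rightarrow> complex Matrix.vec \<Rightarrow> real^'d \<Rightarrow> complex" where
  "fe_function S u\<^sub>\<Gamma> u\<^sub>I x =
     (\<Sum>r<dim_vec u\<^sub>\<Gamma>. u\<^sub>\<Gamma> $ r * nodal_cfun S (numbering (all_\<Gamma>_nodes S) ! r) x) +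
     (\<Sum>r<dim_vec u\<^sub>I. u\<^sub>I $ r * nodal_cfun S (numbering (all_I_nodes S) ! r) x)"

definition mat_inv :: "complex mat \<Rightarrow> complex mat" where
  "mat_inv A = (THE B. B \<in> carrier_mat (dim_row A) (dim_row A) \<and> inverts_mat A B \<and> inverts_mat B A)"

definition Re_mat :: "complex mat \<Rightarrow> complex mat" where
  "Re_mat A = map_mat (\<lambda>z. complex_of_real (Re z)) A"

definition Im_mat :: "complex mat \<Rightarrow> complex mat" where
  "Im_mat A = map_mat (\<lambda>z. complex_of_real (Im z)) A"

definition select_cols :: "(nat \<Rightarrow> bool) \<Rightarrow> complex mat \<Rightarrow> complex mat" where
  "select_cols P Q = mat_of_cols (dim_row Q) (map (col Q) (filter P [0..<dim_col Q]))"

definition append_cols :: "complex mat \<Rightarrow> complex mat \<Rightarrow> complex mat" where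
  "append_cols A B = mat_of_cols (dim_row A) (cols A @ cols B)"

text \<open>
  The columns of \<open>Q\<close> form a complete system of real eigenvectors of \<open>A \<phi> = \<mu> M \<phi>\<close>, orthonormal with
  respect to \<open>M\<close>.
\<close>

definition real_eigenbasis :: "complex mat \<Rightarrow> complex mat \<Rightarrow> complex mat \<Rightarrow> (nat \<Rightarrow> real) \<Rightarrow> bool" where
  "real_eigenbasis A M Q \<mu> \<longleftrightarrow>
     Q \<in> carrier_mat (dim_row A) (dim_row A) \<and> elements_mat Q \<subseteq> \<real> \<and>
     (\<forall>j<dim_row A. A *\<^sub>v col Q j = complex_of_real (\<mu> j) \<cdot>\<^sub>v (M *\<^sub>v col Q j)) \<and>
     (\<forall>j<dim_row A. \<forall>l<dim_row A. col Q j \<bullet> (M *\<^sub>v col Q l) = (if j = l then 1 else 0))"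


section \<open>The coarse space\<close>

text \<open>
  The chosen eigenvectors (columns of \<open>int_vecs i\<close>) and eigenvalues of the interior eigenproblem on
  the subdomain \<open>i\<close>, and the bound \<open>\<beta>\<close>.
\<close>

record ('d::finite) coarse_decomposition = "'d fe_decomposition" +
  int_vecs :: "nat \<Rightarrow> complex mat"
  int_vals :: "nat \<Rightarrow> nat \<Rightarrow> real"
  cutoff :: real

definition interior_eigenproblem :: "('d::finite, 'z) coarse_decomposition_scheme \<Rightarrow> bool" where
  "interior_eigenproblem S \<longleftrightarrow>
     (\<forall>i<nsub S. real_eigenbasis (B\<^sub>I\<^sub>I S i) (H\<^sub>I\<^sub>I S i) (int_vecs S i) (int_vals S i))"

definition Q\<^sub>S :: "('d::finite, 'z) coarse_decomposition_scheme \<Rightarrow> nat \<Rightarrow> complex mat" where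
  "Q\<^sub>S S i = select_cols (\<lambda>j. \<bar>int_vals S i j\<bar> < cutoff S) (int_vecs S i)"

definition Q\<^sub>L :: "('d::finite, 'z) coarse_decomposition_scheme \<Rightarrow> nat \<Rightarrow> complex mat" where
  "Q\<^sub>L S i = select_cols (\<lambda>j. \<not> \<bar>int_vals S i j\<bar> < cutoff S) (int_vecs S i)"

definition B\<^sub>L :: "('d::finite, 'z) coarse_decomposition_scheme \<Rightarrow> nat \<Rightarrow> complex mat" where
  "B\<^sub>L S i = Q\<^sub>L S i * mat_inv ((Q\<^sub>L S i)\<^sup>T * B\<^sub>I\<^sub>I S i * Q\<^sub>L S i) * (Q\<^sub>L S i)\<^sup>T"

definition H\<^sub>L :: "('d::finite, 'z) coarse_decomposition_scheme \<Rightarrow> nat \<Rightarrow> complex mat" where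
  "H\<^sub>L S i = Q\<^sub>L S i * mat_inv ((Q\<^sub>L S i)\<^sup>T * H\<^sub>I\<^sub>I S i * Q\<^sub>L S i) * (Q\<^sub>L S i)\<^sup>T"

text \<open>A coarse vector \<open>u\<^sub>0 = (u\<^sub>\<Gamma>, \<alpha>)\<close> consists of a nodal vector on \<open>\<Gamma>\<close> and a family of vectors \<open>\<alpha> i\<close>, \<open>i < N\<close>.\<close>

definition V\<^sub>0 :: "('d::finite, 'z) coarse_decomposition_scheme \<Rightarrow>
    (complex Matrix.vec \<times> (nat \<Rightarrow> complex Matrix.vec)) set" where
  "V\<^sub>0 S = carrier_vec (card (all_\<Gamma>_nodes S)) \<times> (\<Pi>\<^sub>E i\<in>{..<nsub S}. carrier_vec (dim_col (Q\<^sub>S S i)))"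

definition zero\<^sub>0 :: "('d::finite, 'z) coarse_decomposition_scheme \<Rightarrow>
    complex Matrix.vec \<times> (nat \<Rightarrow> complex Matrix.vec)" where
  "zero\<^sub>0 S = (0\<^sub>v (card (all_\<Gamma>_nodes S)), \<lambda>i\<in>{..<nsub S}. 0\<^sub>v (dim_col (Q\<^sub>S S i)))"

definition coarse_restriction :: "('d::finite, 'z) coarse_decomposition_scheme \<Rightarrow> nat \<Rightarrow>
    complex Matrix.vec \<times> (nat \<Rightarrow> complex Matrix.vec) \<Rightarrow> complex Matrix.vec" where
  "coarse_restriction S i u\<^sub>0 = (R\<^sub>\<Gamma> S i *\<^sub>v fst u\<^sub>0) @\<^sub>v snd u\<^sub>0 i"

text \<open>The interior part of \<open>\<H>\<^sub>0\<^sup>T u\<^sub>0\<close>.\<close>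

definition coarse_interior :: "('d::finite, 'z) coarse_decomposition_scheme \<Rightarrow>
    complex Matrix.vec \<times> (nat \<Rightarrow> complex Matrix.vec) \<Rightarrow> complex Matrix.vec" where
  "coarse_interior S u\<^sub>0 = Matrix.vec (card (all_I_nodes S)) (\<lambda>r. \<Sum>i<nsub S.
     ((R\<^sub>I S i)\<^sup>T *\<^sub>v
       (- (H\<^sub>L S i *\<^sub>v (H\<^sub>I\<^sub>\<Gamma> S i *\<^sub>v (R\<^sub>\<Gamma> S i *\<^sub>v fst u\<^sub>0))) + Q\<^sub>S S i *\<^sub>v snd u\<^sub>0 i)) $ r)"

definition coarse_norm :: "('d::finite, 'z) coarse_decomposition_scheme \<Rightarrow>
    complex Matrix.vec \<times> (nat \<Rightarrow> complex Matrix.vec) \<Rightarrow> real" where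
  "coarse_norm S u\<^sub>0 = H_norm S (fe_function S (fst u\<^sub>0) (coarse_interior S u\<^sub>0))"


section \<open>Local coarse matrices\<close>

definition B\<^sub>0 :: "('d::finite, 'z) coarse_decomposition_scheme \<Rightarrow> nat \<Rightarrow> complex mat" where
  "B\<^sub>0 S i = four_block_mat
     (B\<^sub>\<Gamma>\<^sub>\<Gamma> S i - B\<^sub>\<Gamma>\<^sub>I S i * B\<^sub>L S i * B\<^sub>I\<^sub>\<Gamma> S i)   (B\<^sub>\<Gamma>\<^sub>I S i * Q\<^sub>S S i)
     ((Q\<^sub>S S i)\<^sup>T * B\<^sub>I\<^sub>\<Gamma> S i)               ((Q\<^sub>S S i)\<^sup>T * B\<^sub>I\<^sub>I S i * Q\<^sub>S S i)"

definition H_hat :: "('d::finite, 'z) coarse_decomposition_scheme \<Rightarrow> nat \<Rightarrow> complex mat" where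
  "H_hat S i = H\<^sub>\<Gamma>\<^sub>\<Gamma> S i - H\<^sub>\<Gamma>\<^sub>I S i * H\<^sub>L S i * H\<^sub>I\<^sub>\<Gamma> S i"

definition H\<^sub>0 :: "('d::finite, 'z) coarse_decomposition_scheme \<Rightarrow> nat \<Rightarrow> complex mat" where
  "H\<^sub>0 S i = four_block_mat
     (H_hat S i)             (H\<^sub>\<Gamma>\<^sub>I S i * Q\<^sub>S S i)
     ((Q\<^sub>S S i)\<^sup>T * H\<^sub>I\<^sub>\<Gamma> S i)    ((Q\<^sub>S S i)\<^sup>T * H\<^sub>I\<^sub>I S i * Q\<^sub>S S i)"

text \<open>
  Vertices, open edges and open faces of a polygonal/polyhedral domain \<open>D\<close>, which need not be convex.
  Near a boundary point \<open>D\<close> is a cone, and \<open>flat_dirs D x\<close> is the linear space of directions along which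
  that cone is translation invariant: it has dimension 0 if \<open>x\<close> is a vertex, 1 on an open edge,
  and (for \<open>d = 3\<close>) 2 on an open face.  The individual edges and faces are the connected components.
\<close>

definition flat_dirs :: "(real^'d::finite) set \<Rightarrow> real^'d \<Rightarrow> (real^'d) set" where
  "flat_dirs D x = {v. \<exists>\<epsilon>>0. \<forall>y\<in>ball x \<epsilon>. \<forall>t. \<bar>t\<bar> < \<epsilon> \<longrightarrow> (y + t *\<^sub>R v \<in> D \<longleftrightarrow> y \<in> D)}"

definition boundary_stratum :: "(real^'d::finite) set \<Rightarrow> nat \<Rightarrow> (real^'d) set" where
  "boundary_stratum D m = {x \<in> frontier D. dim (flat_dirs D x) = m}"

definition same_boundary_entity :: "(real^'d::finite) set \<Rightarrow> real^'d \<Rightarrow> real^'d \<Rightarrow> bool" where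
  "same_boundary_entity D x y \<longleftrightarrow> (\<exists>m. connected_component (boundary_stratum D m) x y)"

definition C_hat :: "('d::finite, 'z) coarse_decomposition_scheme \<Rightarrow> nat \<Rightarrow> complex mat" where
  "C_hat S i = mat (card (\<Gamma>_nodes S i)) (card (\<Gamma>_nodes S i))
     (\<lambda>(r, c). if same_boundary_entity (sub S i) (numbering (\<Gamma>_nodes S i) ! r) (numbering (\<Gamma>_nodes S i) ! c)
               then H_hat S i $$ (r, c) else 0)"

definition C\<^sub>0 :: "('d::finite, 'z) coarse_decomposition_scheme \<Rightarrow> nat \<Rightarrow> complex mat" where
  "C\<^sub>0 S i = four_block_mat
     (C_hat S i)                                         (0\<^sub>m (card (\<Gamma>_nodes S i)) (dim_col (Q\<^sub>S S i)))
     (0\<^sub>m (dim_col (Q\<^sub>S S i)) (card (\<Gamma>_nodes S i)))        ((Q\<^sub>S S i)\<^sup>T * H\<^sub>I\<^sub>I S i * Q\<^sub>S S i)"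


section \<open>Spectral selection\<close>

text \<open>The chosen eigenvectors and eigenvalues of the two selection problems, and the threshold \<open>\<eta>\<close>.\<close>

record ('d::finite) spectral_decomposition = "'d coarse_decomposition" +
  vecs1 :: "nat \<Rightarrow> complex mat"
  vals1 :: "nat \<Rightarrow> nat \<Rightarrow> real"
  vecs2 :: "nat \<Rightarrow> complex mat"
  vals2 :: "nat \<Rightarrow> nat \<Rightarrow> real"
  threshold :: real

definition selected :: "real \<Rightarrow> real \<Rightarrow> bool" where
  "selected \<eta> x \<longleftrightarrow> x < 1 - \<eta> \<or> x > 1 + \<eta>"

definition Q\<^sub>1 :: "('d::finite, 'z) spectral_decomposition_scheme \<Rightarrow> nat \<Rightarrow> complex mat" where
  "Q\<^sub>1 S i = select_cols (\<lambda>j. selected (threshold S) (vals1 S i j)) (vecs1 S i)"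

definition Q\<^sub>1_perp :: "('d::finite, 'z) spectral_decomposition_scheme \<Rightarrow> nat \<Rightarrow> complex mat" where
  "Q\<^sub>1_perp S i = select_cols (\<lambda>j. \<not> selected (threshold S) (vals1 S i j)) (vecs1 S i)"

definition Q\<^sub>2 :: "('d::finite, 'z) spectral_decomposition_scheme \<Rightarrow> nat \<Rightarrow> complex mat" where
  "Q\<^sub>2 S i = Q\<^sub>1_perp S i * select_cols (\<lambda>j. selected (threshold S) (vals2 S i j)) (vecs2 S i)"

definition selection_eigenproblems :: "('d::finite, 'z) spectral_decomposition_scheme \<Rightarrow> bool" where
  "selection_eigenproblems S \<longleftrightarrow>
     (\<forall>i<nsub S. real_eigenbasis (Re_mat (B\<^sub>0 S i)) (H\<^sub>0 S i) (vecs1 S i) (vals1 S i)) \<and>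
     (\<forall>i<nsub S. real_eigenbasis
        ((Q\<^sub>1_perp S i)\<^sup>T * C\<^sub>0 S i * Q\<^sub>1_perp S i) ((Q\<^sub>1_perp S i)\<^sup>T * H\<^sub>0 S i * Q\<^sub>1_perp S i)
        (vecs2 S i) (vals2 S i))"

definition Q_Re :: "('d::finite, 'z) spectral_decomposition_scheme \<Rightarrow> nat \<Rightarrow> complex mat" where
  "Q_Re S i = append_cols (Q\<^sub>1 S i) (Q\<^sub>2 S i)"

definition \<Pi>_Re :: "('d::finite, 'z) spectral_decomposition_scheme \<Rightarrow> nat \<Rightarrow> complex mat" where
  "\<Pi>_Re S i = Q_Re S i * (Q_Re S i)\<^sup>T * H\<^sub>0 S i"

definition B_P1 :: "('d::finite, 'z) spectral_decomposition_scheme \<Rightarrow> nat \<Rightarrow> complex mat" where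
  "B_P1 S i = (let J = 1\<^sub>m (dim_row (H\<^sub>0 S i)) - \<Pi>_Re S i in
     Re_mat (B\<^sub>0 S i) + \<i> \<cdot>\<^sub>m Im_mat (B\<^sub>0 S i) - J\<^sup>T * Re_mat (B\<^sub>0 S i) * J + J\<^sup>T * C\<^sub>0 S i * J)"

text \<open>\<open>x \<bullet>c y\<close> conjugates \<open>y\<close>, so each summand is \<open>(R v\<^sub>0)\<^sup>H B_P1 (R u\<^sub>0)\<close>.\<close>

definition b_P1 :: "('d::finite, 'z) spectral_decomposition_scheme \<Rightarrow>
    complex Matrix.vec \<times> (nat \<Rightarrow> complex Matrix.vec) \<Rightarrow>
    complex Matrix.vec \<times> (nat \<Rightarrow> complex Matrix.vec) \<Rightarrow> complex" where
  "b_P1 S u\<^sub>0 v\<^sub>0 = (\<Sum>i<nsub S.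
     (B_P1 S i *\<^sub>v coarse_restriction S i u\<^sub>0) \<bullet>c coarse_restriction S i v\<^sub>0)"

end

theory Submission
  imports Defs "Jordan_Normal_Form.Determinant"
begin

text \<open>
  A finite element function is determined by its values on \<open>\<Gamma>\<close> and, in each subdomain, by its
  components along the low (\<open>Q\<^sub>S\<close>) and high (\<open>Q\<^sub>L\<close>) interior eigenmodes.  Extend a coarse vector
  \<open>u\<^sub>0\<close> to the function \<open>u\<^sub>h\<close> whose residual for \<open>b\<close> vanishes on all high modes.  Then \<open>b(u\<^sub>h, v)\<close>
  sees only the coarse components \<open>v\<^sub>0\<close> of \<open>v\<close>, and equals the form \<open>b\<^sub>0(u\<^sub>0, v\<^sub>0)\<close> assembled from the
  local Schur complements \<open>B\<^sub>0\<close>.  The same computation for the energy inner product shows that the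
  coarse norm is the smallest energy norm among all functions with given coarse components, so \<open>b\<^sub>0\<close>
  inherits the inf-sup constant \<open>\<gamma>\<close>.  Finally \<open>B_P1 - B\<^sub>0\<close> is the compression of \<open>C\<^sub>0 - Re B\<^sub>0\<close> to the
  \<open>H\<^sub>0\<close>-orthogonal complement of the selected eigenvectors; there both matrices differ from \<open>H\<^sub>0\<close> by at
  most \<open>\<eta>\<close>, so the constant drops by at most \<open>2\<eta>\<close>.

  The forms split over the subdomains because the mesh skeleton is a null set and because two elements
  cannot share a piece of a boundary facet of positive surface measure.
\<close>

text \<open>\<open>B\<^sub>I\<^sub>I\<close> may be singular, namely when k^2 is a discrete
  Dirichlet eigenvalue of a subdomain, so the interior unknowns cannot all be eliminated. The
  cut-off keeps the nearly singular modes as coarse unknowns. On the others the eigenvalues stay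
  away from 0, and since the same modes diagonalise \<open>H\<^sub>I\<^sub>I\<close>, low and high
  modes decouple in both forms; one elimination lemma serves both. Two different extensions of a
  coarse vector are at work: the one adapted to b evaluates b, the one adapted to the energy product
  defines the coarse norm. They are never compared directly. Minimality of the coarse norm bounds
  the trial and the test function alike, each time in the direction that enlarges the quotient. The
  two errors \<eta> live in different bases: on the complement, the second eigenbasis makes
  \<open>C\<^sub>0\<close> diagonal, whereas the real part of \<open>B\<^sub>0\<close> is there only
  a compression, by an isometry, of a matrix that the first eigenbasis makes diagonal. The isometry
  preserves the bound. Cauchy-Schwarz over the subdomains keeps the constant independent of their
  number.\<close>

subsection \<open>Complex matrices\<close>

declare assoc_mult_mat [simp del] assoc_mult_mat_vec [simp del]

text \<open>Sizes enter as equations between dimensions that can be computed from the matrices; no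
  intermediate size has to be guessed, as it would be with membership in
  \<open>carrier_mat\<close>.\<close>

lemma mat_mult_assoc_dim:
  "dim_col A = dim_row B \<Longrightarrow> dim_col B = dim_row C \<Longrightarrow> A * B * C = A * (B * C)"
  for A B C :: "'a::semiring_0 mat"
  by (rule assoc_mult_mat[of A "dim_row A" "dim_row B" B "dim_row C" C "dim_col C"]) auto

lemma mat_vec_assoc_dim:
  "dim_col A = dim_row B \<Longrightarrow> dim_col B = dim_vec x \<Longrightarrow> A * B *\<^sub>v x = A *\<^sub>v (B *\<^sub>v x)"
  for A B :: "'a::semiring_0 mat"
  by (rule assoc_mult_mat_vec[of A "dim_row A" "dim_row B" B "dim_vec x" x]) auto

lemma transpose_mult_dim: "dim_col A = dim_row B \<Longrightarrow> (A * B)\<^sup>T = B\<^sup>T * A\<^sup>T"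
  for A B :: "'a::comm_semiring_0 mat"
  by (rule transpose_mult[of A "dim_row A" "dim_row B" B "dim_col B"]) auto

lemma mat_right_inverse_unique:
  fixes A :: "'a::field mat"
  assumes "A \<in> carrier_mat n n" "X \<in> carrier_mat n n" "Y \<in> carrier_mat n n" "A * X = 1\<^sub>m n" "A * Y = 1\<^sub>m n"
  shows "X = Y"
proof -
  have "X * A = 1\<^sub>m n" using mat_mult_left_right_inverse[of A n X] assms by auto
  then have "X * A * Y = Y" using assms by simp
  moreover have "X * A * Y = X" using assms by (simp add: mat_mult_assoc_dim)
  ultimately show ?thesis by simp
qed

text \<open>\<open>mat_inv\<close> describes a two-sided inverse; for square matrices one of the two
  products determines the other.\<close>

lemma mat_inv_eq:
  assumes "A \<in> carrier_mat n n" "X \<in> carrier_mat n n" "A * X = 1\<^sub>m n"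
  shows "mat_inv A = X"
  unfolding mat_inv_def
proof (rule the_equality)
  show "X \<in> carrier_mat (dim_row A) (dim_row A) \<and> inverts_mat A X \<and> inverts_mat X A"
    using assms mat_mult_left_right_inverse[of A n X] by (auto simp: inverts_mat_def)
  show "Y = X" if "Y \<in> carrier_mat (dim_row A) (dim_row A) \<and> inverts_mat A Y \<and> inverts_mat Y A" for Y
    by (rule mat_right_inverse_unique[of A n]) (use that assms in \<open>auto simp: inverts_mat_def\<close>)
qed

text \<open>A fixed-point equation of entrywise conjugation, which passes through products and
  transposes by rewriting.\<close>

definition real_matrix :: "complex mat \<Rightarrow> bool" where
  "real_matrix A \<longleftrightarrow> map_mat cnj A = A"

lemma real_matrixI: "elements_mat A \<subseteq> \<real> \<Longrightarrow> real_matrix A"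
  unfolding real_matrix_def
  by (rule eq_matI) (auto intro!: Reals_cnj_iff[THEN iffD1] simp: elements_matI[of A "dim_row A" "dim_col A"] subset_iff)

lemma cnj_mat_mult: "dim_col A = dim_row B \<Longrightarrow> map_mat cnj (A * B) = map_mat cnj A * map_mat cnj B"
  by (rule eq_matI) (auto simp: scalar_prod_def)

lemma map_mat_one_cnj: "map_mat cnj (1\<^sub>m n) = 1\<^sub>m n"
  by (rule eq_matI) auto

lemma real_matrix_mult: "real_matrix A \<Longrightarrow> real_matrix B \<Longrightarrow> dim_col A = dim_row B \<Longrightarrow> real_matrix (A * B)"
  by (simp add: real_matrix_def cnj_mat_mult)

lemma real_matrix_transpose: "real_matrix A \<Longrightarrow> real_matrix A\<^sup>T"
  unfolding real_matrix_def by (metis map_mat_transpose)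

lemma real_matrix_index: "real_matrix A \<Longrightarrow> i < dim_row A \<Longrightarrow> j < dim_col A \<Longrightarrow> cnj (A $$ (i, j)) = A $$ (i, j)"
  unfolding real_matrix_def by (metis index_map_mat(1))

lemma conjugate_mult_mat_vec:
  "dim_vec x = dim_col A \<Longrightarrow> conjugate (A *\<^sub>v x) = map_mat cnj A *\<^sub>v conjugate x"
  for A :: "complex mat"
  by (rule eq_vecI) (auto simp: scalar_prod_def)

text \<open>The coarse matrices are built with transposes, the forms with conjugation. For real
  matrices transpose and adjoint agree, so such factors can be moved across
  \<open>\<bullet>c\<close>.\<close>

lemma cscalar_prod_real_matrix:
  assumes "real_matrix A" "dim_vec x = dim_row A" "dim_vec y = dim_col A"
  shows "x \<bullet>c (A *\<^sub>v y) = (A\<^sup>T *\<^sub>v x) \<bullet>c y"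
proof -
  have "x \<bullet>c (A *\<^sub>v y) = x \<bullet> (A *\<^sub>v conjugate y)"
    using assms(1) conjugate_mult_mat_vec[OF assms(3)] by (simp add: real_matrix_def)
  also have "\<dots> = (A\<^sup>T *\<^sub>v x) \<bullet>c y"
    by (rule transpose_vec_mult_scalar[symmetric, of A "dim_row A" "dim_col A"])
      (use assms(2,3) in \<open>auto simp flip: carrier_vec_dim_vec intro!: carrier_vecI\<close>)
  finally show ?thesis .
qed

lemma cscalar_prod_self: "x \<bullet>c x = complex_of_real ((L2_set (\<lambda>r. cmod (x $ r)) {..<dim_vec x})\<^sup>2)"
  by (simp add: scalar_prod_def L2_set_def sum_nonneg complex_norm_square[symmetric] atLeast0LessThan)

subsection \<open>Selected columns\<close>

abbreviation positions :: "(nat \<Rightarrow> bool) \<Rightarrow> nat \<Rightarrow> nat list" where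
  "positions P n \<equiv> filter P [0..<n]"

lemma select_cols_dim [simp]:
  "dim_row (select_cols P Q) = dim_row Q"
  "dim_col (select_cols P Q) = length (positions P (dim_col Q))"
  by (auto simp: select_cols_def)

lemma select_cols_index:
  assumes "i < dim_row Q" "r < length (positions P (dim_col Q))"
  shows "select_cols P Q $$ (i, r) = Q $$ (i, positions P (dim_col Q) ! r)"
  using assms nth_mem[OF assms(2)] unfolding select_cols_def by (subst mat_of_cols_index) auto

lemma positions_nth: "r < length (positions P n) \<Longrightarrow> positions P n ! r < n \<and> P (positions P n ! r)"
  using nth_mem[of r "positions P n"] by auto

lemma col_select_cols:
  assumes "r < length (positions P (dim_col Q))"
  shows "col (select_cols P Q) r = col Q (positions P (dim_col Q) ! r)"
  using assms positions_nth[OF assms] by (intro eq_vecI) (auto simp: select_cols_index)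

lemma real_matrix_select_cols: "real_matrix Q \<Longrightarrow> real_matrix (select_cols P Q)"
  unfolding real_matrix_def[of "select_cols P Q"]
  by (rule eq_matI) (auto simp: select_cols_index real_matrix_index positions_nth)

lemma index_gram:
  assumes "dim_row A = dim_row M" "dim_row B = dim_col M" "r < dim_col A" "c < dim_col B"
  shows "(A\<^sup>T * M * B) $$ (r, c) = col A r \<bullet> (M *\<^sub>v col B c)"
proof -
  have "col (M * B) c = M *\<^sub>v col B c"
    using assms by (intro col_mult2[of M "dim_row M" "dim_col M" B "dim_col B" c]) auto
  moreover have "A\<^sup>T * M * B = A\<^sup>T * (M * B)"
    using assms by (intro mat_mult_assoc_dim) auto
  ultimately show ?thesis using assms by simp
qed

lemma select_cols_gram:
  assumes "dim_row Q = dim_row M" "dim_row Q = dim_col M" "dim_col Q = n"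
  shows "(select_cols P Q)\<^sup>T * M * select_cols P' Q =
    Matrix.mat (length (positions P n)) (length (positions P' n))
      (\<lambda>(r, c). (Q\<^sup>T * M * Q) $$ (positions P n ! r, positions P' n ! c))"
  by (rule eq_matI)
    (use assms in \<open>auto simp: index_gram col_select_cols positions_nth simp del: index_mult_mat(1)\<close>)

lemma positions_nth_eq_iff:
  "r < length (positions P n) \<Longrightarrow> c < length (positions P n) \<Longrightarrow> positions P n ! r = positions P n ! c \<longleftrightarrow> r = c"
  by (simp add: nth_eq_iff_index_eq)

text \<open>Selecting columns on both sides picks a submatrix of the diagonal matrix. An index
  satisfying \<open>P\<close> never equals one violating it, so the mixed blocks contain
  off-diagonal entries only.\<close>

lemma select_cols_diag:
  assumes "dim_row Q = dim_row M" "dim_row Q = dim_col M" "dim_col Q = n" "Q\<^sup>T * M * Q = mat_diag n d"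
  shows "(select_cols P Q)\<^sup>T * M * select_cols P Q =
      mat_diag (length (positions P n)) (\<lambda>r. d (positions P n ! r))"
    and "(select_cols P Q)\<^sup>T * M * select_cols (\<lambda>j. \<not> P j) Q = 0\<^sub>m (length (positions P n)) (length (positions (\<lambda>j. \<not> P j) n))"
    and "(select_cols (\<lambda>j. \<not> P j) Q)\<^sup>T * M * select_cols P Q = 0\<^sub>m (length (positions (\<lambda>j. \<not> P j) n)) (length (positions P n))"
proof -
  show "(select_cols P Q)\<^sup>T * M * select_cols P Q =
      mat_diag (length (positions P n)) (\<lambda>r. d (positions P n ! r))"
    unfolding select_cols_gram[OF assms(1-3)] assms(4)
    by (rule eq_matI) (auto simp: mat_diag_def positions_nth positions_nth_eq_iff)
  have ne: "positions P n ! r \<noteq> positions (\<lambda>j. \<not> P j) n ! c"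
    if "r < length (positions P n)" "c < length (positions (\<lambda>j. \<not> P j) n)" for r c
    using positions_nth[OF that(1)] positions_nth[OF that(2)] by metis
  show "(select_cols P Q)\<^sup>T * M * select_cols (\<lambda>j. \<not> P j) Q = 0\<^sub>m (length (positions P n)) (length (positions (\<lambda>j. \<not> P j) n))"
    unfolding select_cols_gram[OF assms(1-3)] assms(4)
    by (rule eq_matI) (auto simp: mat_diag_def positions_nth ne)
  show "(select_cols (\<lambda>j. \<not> P j) Q)\<^sup>T * M * select_cols P Q = 0\<^sub>m (length (positions (\<lambda>j. \<not> P j) n)) (length (positions P n))"
    unfolding select_cols_gram[OF assms(1-3)] assms(4)
    by (rule eq_matI) (auto simp: mat_diag_def positions_nth ne[symmetric])
qed

lemma sum_positions: "(\<Sum>k<length (positions P n). f (positions P n ! k)) = (\<Sum>k | k < n \<and> P k. f k)"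
  for f :: "nat \<Rightarrow> 'a::comm_monoid_add"
proof -
  have "(\<Sum>k<length (positions P n). f (positions P n ! k)) = sum_list (map f (positions P n))"
    by (simp add: sum_list_sum_nth atLeast0LessThan)
  also have "\<dots> = sum f (set (positions P n))" by (simp add: sum_list_distinct_conv_sum_set)
  also have "set (positions P n) = {k. k < n \<and> P k}" by auto
  finally show ?thesis .
qed

text \<open>The outer product is a sum of one rank-one term per column, and each column belongs to
  exactly one of the two selections.\<close>

lemma select_cols_outer:
  "select_cols P Q * (select_cols P Q)\<^sup>T + select_cols (\<lambda>j. \<not> P j) Q * (select_cols (\<lambda>j. \<not> P j) Q)\<^sup>T = Q * Q\<^sup>T"
  (is "?L = _")
proof (rule eq_matI)
  fix i j assume "i < dim_row (Q * Q\<^sup>T)" "j < dim_col (Q * Q\<^sup>T)"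
  then have ij: "i < dim_row Q" "j < dim_row Q" by auto
  have *: "(select_cols P Q * (select_cols P Q)\<^sup>T) $$ (i, j) = (\<Sum>k | k < dim_col Q \<and> P k. Q $$ (i, k) * Q $$ (j, k))" for P
    unfolding sum_positions[symmetric, of "\<lambda>k. Q $$ (i, k) * Q $$ (j, k)"]
    using ij by (auto simp: scalar_prod_def atLeast0LessThan select_cols_index intro!: sum.cong)
  have "?L $$ (i, j) = (\<Sum>k | k < dim_col Q \<and> P k. Q $$ (i, k) * Q $$ (j, k)) + (\<Sum>k | k < dim_col Q \<and> \<not> P k. Q $$ (i, k) * Q $$ (j, k))"
    using ij by (subst index_add_mat) (auto simp only: * index_mult_mat select_cols_dim index_transpose_mat)
  also have "\<dots> = (\<Sum>k<dim_col Q. Q $$ (i, k) * Q $$ (j, k))"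
    by (subst sum.union_disjoint[symmetric]) (auto intro!: sum.cong)
  finally show "?L $$ (i, j) = (Q * Q\<^sup>T) $$ (i, j)"
    using ij by (simp add: scalar_prod_def atLeast0LessThan)
qed auto

lemma select_cols_diag_inverse:
  assumes Q: "Q \<in> carrier_mat n n" and II: "II \<in> carrier_mat n n"
    and QIIQ: "Q\<^sup>T * II * Q = mat_diag n d" and nonzero: "\<And>j. j < n \<Longrightarrow> P j \<Longrightarrow> d j \<noteq> 0"
  shows "mat_inv ((select_cols P Q)\<^sup>T * II * select_cols P Q) =
    mat_diag (length (positions P n)) (\<lambda>r. inverse (d (positions P n ! r)))"
proof (rule mat_inv_eq)
  have eq: "(select_cols P Q)\<^sup>T * II * select_cols P Q = mat_diag (length (positions P n)) (\<lambda>r. d (positions P n ! r))"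
    by (rule select_cols_diag) (use Q II QIIQ in auto)
  show "(select_cols P Q)\<^sup>T * II * select_cols P Q \<in> carrier_mat (length (positions P n)) (length (positions P n))"
    unfolding eq by (rule mat_diag_dim)
  have "d (positions P n ! r) \<noteq> 0" if "r < length (positions P n)" for r
    using positions_nth[OF that] nonzero by blast
  then show "(select_cols P Q)\<^sup>T * II * select_cols P Q * mat_diag (length (positions P n)) (\<lambda>r. inverse (d (positions P n ! r)))
      = 1\<^sub>m (length (positions P n))"
    unfolding eq mat_diag_diag by (intro eq_matI) (auto simp: mat_diag_def)
qed (rule mat_diag_dim)

subsection \<open>Eigenbases\<close>

text \<open>Orthonormality makes \<open>Q\<^sup>T * M\<close> a left inverse of the square matrix
  \<open>Q\<close>, hence a right inverse, which is the resolution of the identity. Realness of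
  \<open>M\<close> follows: \<open>M\<close> and its conjugate are both right inverses of the real
  matrix \<open>Q * Q\<^sup>T\<close>.\<close>

lemma real_eigenbasis_diag:
  assumes eig: "real_eigenbasis A M Q \<mu>" and A: "A \<in> carrier_mat n n" and M: "M \<in> carrier_mat n n"
  shows "Q \<in> carrier_mat n n" "real_matrix Q" "Q\<^sup>T * M * Q = mat_diag n (\<lambda>_. 1)"
    and "Q\<^sup>T * A * Q = mat_diag n (\<lambda>j. complex_of_real (\<mu> j))"
    and "Q * Q\<^sup>T * M = 1\<^sub>m n" "real_matrix M"
proof -
  show Q: "Q \<in> carrier_mat n n" and R: "real_matrix Q"
    using eig A by (auto simp: real_eigenbasis_def intro: real_matrixI)
  have orth: "col Q j \<bullet> (M *\<^sub>v col Q l) = (if j = l then 1 else 0)" if "j < n" "l < n" for j l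
    using eig A that by (auto simp: real_eigenbasis_def)
  have ev: "A *\<^sub>v col Q j = complex_of_real (\<mu> j) \<cdot>\<^sub>v (M *\<^sub>v col Q j)" if "j < n" for j
    using eig A that by (auto simp: real_eigenbasis_def)
  show QMQ: "Q\<^sup>T * M * Q = mat_diag n (\<lambda>_. 1)"
    by (rule eq_matI) (use Q M orth in \<open>auto simp: index_gram mat_diag_def simp del: index_mult_mat(1) mat_diag_one\<close>)
  show "Q\<^sup>T * A * Q = mat_diag n (\<lambda>j. complex_of_real (\<mu> j))"
  proof (rule eq_matI)
    fix j l assume "j < dim_row (mat_diag n (\<lambda>j. complex_of_real (\<mu> j)))" "l < dim_col (mat_diag n (\<lambda>j. complex_of_real (\<mu> j)))"
    then have jl: "j < n" "l < n" by (auto simp: mat_diag_def)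
    have "(Q\<^sup>T * A * Q) $$ (j, l) = col Q j \<bullet> (complex_of_real (\<mu> l) \<cdot>\<^sub>v (M *\<^sub>v col Q l))"
      using Q A jl by (simp add: index_gram ev del: index_mult_mat(1))
    also have "\<dots> = complex_of_real (\<mu> l) * (col Q j \<bullet> (M *\<^sub>v col Q l))"
      by (rule scalar_prod_smult_right) (use Q M in auto)
    finally show "(Q\<^sup>T * A * Q) $$ (j, l) = mat_diag n (\<lambda>j. complex_of_real (\<mu> j)) $$ (j, l)"
      using jl orth[OF jl] by (simp add: mat_diag_def)
  qed (use Q A in \<open>auto simp: mat_diag_def\<close>)
  have "Q * (Q\<^sup>T * M) = 1\<^sub>m n"
    by (rule mat_mult_left_right_inverse[of "Q\<^sup>T * M" n Q]) (use Q M QMQ in auto)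
  then show QQM: "Q * Q\<^sup>T * M = 1\<^sub>m n" using Q M by (simp add: mat_mult_assoc_dim)
  have "map_mat cnj (Q * Q\<^sup>T * M) = map_mat cnj (Q * Q\<^sup>T) * map_mat cnj M"
    using Q M by (intro cnj_mat_mult) auto
  also have "map_mat cnj (Q * Q\<^sup>T) = Q * Q\<^sup>T"
    using real_matrix_mult[OF R real_matrix_transpose[OF R]] by (simp add: real_matrix_def)
  finally have QQc: "Q * Q\<^sup>T * map_mat cnj M = 1\<^sub>m n" unfolding QQM by (simp add: map_mat_one_cnj)
  show "real_matrix M"
    unfolding real_matrix_def
    by (rule mat_right_inverse_unique[OF _ _ _ QQc QQM]) (use Q M in simp_all)
qed

text \<open>The resolution of the identity \<open>Q * Q\<^sup>T * M = 1\<close>, with the outer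
  product split into two groups of modes; the coefficients are the \<open>M\<close>-products with
  the modes.\<close>

lemma eigenbasis_split:
  assumes Q: "Q \<in> carrier_mat n n" and M: "M \<in> carrier_mat n n" and QQM: "Q * Q\<^sup>T * M = 1\<^sub>m n" and z: "z \<in> carrier_vec n"
  shows "z = select_cols P Q *\<^sub>v ((select_cols P Q)\<^sup>T *\<^sub>v (M *\<^sub>v z)) +
    select_cols (\<lambda>j. \<not> P j) Q *\<^sub>v ((select_cols (\<lambda>j. \<not> P j) Q)\<^sup>T *\<^sub>v (M *\<^sub>v z))"
proof -
  let ?S = "select_cols P Q" and ?L = "select_cols (\<lambda>j. \<not> P j) Q"
  have "z = (Q * Q\<^sup>T * M) *\<^sub>v z" unfolding QQM using z by simp
  also have "\<dots> = (Q * Q\<^sup>T) *\<^sub>v (M *\<^sub>v z)"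
    by (rule mat_vec_assoc_dim) (use Q M z in auto)
  also have "Q * Q\<^sup>T = ?S * ?S\<^sup>T + ?L * ?L\<^sup>T" by (simp add: select_cols_outer)
  also have "\<dots> *\<^sub>v (M *\<^sub>v z) = (?S * ?S\<^sup>T) *\<^sub>v (M *\<^sub>v z) + (?L * ?L\<^sup>T) *\<^sub>v (M *\<^sub>v z)"
    by (rule add_mult_distrib_mat_vec[of _ n n]) (use Q M z in \<open>auto intro!: carrier_matI\<close>)
  also have "(?S * ?S\<^sup>T) *\<^sub>v (M *\<^sub>v z) = ?S *\<^sub>v (?S\<^sup>T *\<^sub>v (M *\<^sub>v z))"
    by (rule mat_vec_assoc_dim) (use Q M z in auto)
  also have "(?L * ?L\<^sup>T) *\<^sub>v (M *\<^sub>v z) = ?L *\<^sub>v (?L\<^sup>T *\<^sub>v (M *\<^sub>v z))"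
    by (rule mat_vec_assoc_dim) (use Q M z in auto)
  finally show ?thesis .
qed

subsection \<open>Block elimination\<close>

text \<open>The interior vector \<open>w\<close> is chosen so that the interior residual
  \<open>IG u + II w\<close> is orthogonal to all high modes. Pairing with \<open>z\<close> then
  sees only the low coefficients \<open>b\<close>, and the arbitrary \<open>c\<close> is absent from
  the right-hand side. What remains is the Schur complement in which only the high modes have been
  eliminated. No symmetry of the blocks enters, so the lemma applies to the local matrices of b and
  of the energy product.\<close>

lemma block_elimination:
  fixes n g :: nat and P :: "nat \<Rightarrow> bool"
  assumes GG: "GG \<in> carrier_mat g g" and GI: "GI \<in> carrier_mat g n" and IG: "IG \<in> carrier_mat n g"
    and II: "II \<in> carrier_mat n n" and Q: "Q \<in> carrier_mat n n" "real_matrix Q"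
    and QIIQ: "Q\<^sup>T * II * Q = mat_diag n d" and nonzero: "\<And>j. j < n \<Longrightarrow> \<not> P j \<Longrightarrow> d j \<noteq> 0"
    and QS: "QS = select_cols P Q" and QL: "QL = select_cols (\<lambda>j. \<not> P j) Q"
    and EL: "EL = QL * mat_inv (QL\<^sup>T * II * QL) * QL\<^sup>T"
    and u: "u \<in> carrier_vec g" and v: "v \<in> carrier_vec g"
    and a: "a \<in> carrier_vec (dim_col QS)" and b: "b \<in> carrier_vec (dim_col QS)" and c: "c \<in> carrier_vec (dim_col QL)"
    and w: "w = - (EL *\<^sub>v (IG *\<^sub>v u)) + QS *\<^sub>v a" and z: "z = QS *\<^sub>v b + QL *\<^sub>v c"
  shows "(GG *\<^sub>v u + GI *\<^sub>v w) \<bullet>c v + (IG *\<^sub>v u + II *\<^sub>v w) \<bullet>c z =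
    (four_block_mat (GG - GI * EL * IG) (GI * QS) (QS\<^sup>T * IG) (QS\<^sup>T * II * QS) *\<^sub>v (u @\<^sub>v a)) \<bullet>c (v @\<^sub>v b)"
proof -
  define l where "l = dim_col QL"
  define s where "s = dim_col QS"
  have l: "l = length (positions (\<lambda>j. \<not> P j) n)" and s: "s = length (positions P n)"
    using Q by (simp_all add: l_def s_def QL QS)
  define d' where "d' r = d (positions (\<lambda>j. \<not> P j) n ! r)" for r
  have qs: "QS \<in> carrier_mat n s" and ql: "QL \<in> carrier_mat n l" 
    using Q l s by (auto simp: QS QL intro!: carrier_matI)
  have qsr: "real_matrix QS" and qlr: "real_matrix QL" using Q by (simp_all add: QS QL real_matrix_select_cols)
  have LL: "QL\<^sup>T * II * QL = mat_diag l d'"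
    unfolding QL d'_def l by (rule select_cols_diag) (use Q II QIIQ in auto)
  have SL: "QS\<^sup>T * II * QL = 0\<^sub>m s l" and LS: "QL\<^sup>T * II * QS = 0\<^sub>m l s"
    unfolding QL QS s l using select_cols_diag[of Q II n d P] Q II QIIQ by auto
  define D where "D = mat_diag l (\<lambda>r. inverse (d' r))"
  have D: "D \<in> carrier_mat l l" by (simp add: D_def)
  have inv: "mat_inv (QL\<^sup>T * II * QL) = D"
    unfolding QL D_def d'_def l by (rule select_cols_diag_inverse[OF Q(1) II QIIQ nonzero])
  have "d' r \<noteq> 0" if "r < l" for r
    unfolding d'_def using positions_nth[OF that[unfolded l]] nonzero by blast
  then have LLD: "mat_diag l d' * D = 1\<^sub>m l"
    unfolding D_def mat_diag_diag by (intro eq_matI) (auto simp: mat_diag_def)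
  define f where "f = IG *\<^sub>v u"
  have f: "f \<in> carrier_vec n" using IG u by (auto simp: f_def)
  \<comment> \<open>The coefficients of the high modes that balance the load \<open>f\<close>:
    \<open>y\<close> solves the diagonal system with matrix \<open>QL\<^sup>T * II * QL\<close> and
    right-hand side \<open>QL\<^sup>T f\<close>.\<close>
  define y where "y = D *\<^sub>v (QL\<^sup>T *\<^sub>v f)"
  have y: "y \<in> carrier_vec l" using D by (auto simp: y_def intro!: carrier_vecI)
  have ELf: "EL *\<^sub>v f = QL *\<^sub>v y"
    unfolding EL inv y_def using ql D f by (simp add: mat_vec_assoc_dim)
  have a': "a \<in> carrier_vec s" and b': "b \<in> carrier_vec s" and c': "c \<in> carrier_vec l"
    using a b c by (auto simp: s_def l_def)
  have w': "w = QS *\<^sub>v a - QL *\<^sub>v y"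
    unfolding w f_def[symmetric] ELf using qs ql a' y by (intro eq_vecI) auto
  have wc: "w \<in> carrier_vec n" unfolding w' using qs ql a' y by (auto intro!: carrier_vecI)
  have IIw: "II *\<^sub>v w = II *\<^sub>v (QS *\<^sub>v a) - II *\<^sub>v (QL *\<^sub>v y)"
    unfolding w' by (rule mult_minus_distrib_mat_vec[OF II]) (use qs ql a' y in auto)
  have adj: "X\<^sup>T *\<^sub>v (II *\<^sub>v (Y *\<^sub>v t)) = (X\<^sup>T * II * Y) *\<^sub>v t" 
    if "X \<in> carrier_mat n p" "Y \<in> carrier_mat n q" "t \<in> carrier_vec q" for X Y p q t
    using that II by (simp add: mat_vec_assoc_dim)
  have adjw: "X\<^sup>T *\<^sub>v (f + II *\<^sub>v w) = X\<^sup>T *\<^sub>v f + ((X\<^sup>T * II * QS) *\<^sub>v a - (X\<^sup>T * II * QL) *\<^sub>v y)"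
    if X: "X \<in> carrier_mat n p" for X p
  proof -
    have "X\<^sup>T *\<^sub>v (f + II *\<^sub>v w) = X\<^sup>T *\<^sub>v f + X\<^sup>T *\<^sub>v (II *\<^sub>v w)"
      by (rule mult_add_distrib_mat_vec[of _ p n]) (use X f II wc in auto)
    also have "X\<^sup>T *\<^sub>v (II *\<^sub>v w) = X\<^sup>T *\<^sub>v (II *\<^sub>v (QS *\<^sub>v a)) - X\<^sup>T *\<^sub>v (II *\<^sub>v (QL *\<^sub>v y))"
      unfolding IIw by (rule mult_minus_distrib_mat_vec[of _ p n]) (use X II qs ql a' y in auto)
    finally show ?thesis unfolding adj[OF X qs a'] adj[OF X ql y] .
  qed
  have "mat_diag l d' *\<^sub>v y = QL\<^sup>T *\<^sub>v f"
    unfolding y_def using LLD D ql f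
    by (simp add: mat_vec_assoc_dim[of "mat_diag l d'" D, symmetric] carrier_matD[OF mat_diag_dim])
  \<comment> \<open>The low part of \<open>w\<close> does not disturb this balance, because low and
    high modes decouple in \<open>II\<close>.\<close>
  then have L0: "QL\<^sup>T *\<^sub>v (f + II *\<^sub>v w) = 0\<^sub>v l"
    unfolding adjw[OF ql] LS LL using ql f a' by (intro eq_vecI) auto
  have "(QS\<^sup>T * IG) *\<^sub>v u = QS\<^sup>T *\<^sub>v f"
    unfolding f_def by (rule mat_vec_assoc_dim) (use qs IG u in auto)
  then have S0: "QS\<^sup>T *\<^sub>v (f + II *\<^sub>v w) = (QS\<^sup>T * IG) *\<^sub>v u + (QS\<^sup>T * II * QS) *\<^sub>v a"
    unfolding adjw[OF qs] SL using qs y f II a' by (intro eq_vecI) auto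
  have fw: "f + II *\<^sub>v w \<in> carrier_vec n" using f II wc by auto
  have "(f + II *\<^sub>v w) \<bullet>c z = (f + II *\<^sub>v w) \<bullet>c (QS *\<^sub>v b) + (f + II *\<^sub>v w) \<bullet>c (QL *\<^sub>v c)"
    unfolding z using fw qs ql b' c' II wc
    by (subst conjugate_add_vec[of _ n]) (auto intro!: scalar_prod_add_distrib[of _ n])
  also have "\<dots> = (QS\<^sup>T *\<^sub>v (f + II *\<^sub>v w)) \<bullet>c b + (QL\<^sup>T *\<^sub>v (f + II *\<^sub>v w)) \<bullet>c c"
    using fw qs ql b' c' II by (simp add: cscalar_prod_real_matrix qsr qlr)
  also have "\<dots> = ((QS\<^sup>T * IG) *\<^sub>v u + (QS\<^sup>T * II * QS) *\<^sub>v a) \<bullet>c b"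
    unfolding L0 S0 using c' by simp
  finally have 1: "(IG *\<^sub>v u + II *\<^sub>v w) \<bullet>c z = ((QS\<^sup>T * IG) *\<^sub>v u + (QS\<^sup>T * II * QS) *\<^sub>v a) \<bullet>c b"
    by (simp add: f_def)
  have mlc: "EL \<in> carrier_mat n n" unfolding EL inv using ql D by auto
  have "GI *\<^sub>v w = GI *\<^sub>v (QS *\<^sub>v a) - GI *\<^sub>v (EL *\<^sub>v f)"
    unfolding w' ELf by (rule mult_minus_distrib_mat_vec[OF GI]) (use qs ql a' y in auto)
  then have 2: "GG *\<^sub>v u + GI *\<^sub>v w = (GG - GI * EL * IG) *\<^sub>v u + (GI * QS) *\<^sub>v a"
    using GG GI IG mlc qs a' u 
    by (subst minus_mult_distrib_mat_vec[of _ g g]) (auto simp: mat_vec_assoc_dim f_def intro!: eq_vecI)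
  have 3: "four_block_mat (GG - GI * EL * IG) (GI * QS) (QS\<^sup>T * IG) (QS\<^sup>T * II * QS) *\<^sub>v (u @\<^sub>v a)
    = ((GG - GI * EL * IG) *\<^sub>v u + (GI * QS) *\<^sub>v a) @\<^sub>v ((QS\<^sup>T * IG) *\<^sub>v u + (QS\<^sup>T * II * QS) *\<^sub>v a)"
    by (rule four_block_mat_mult_vec[of _ g g _ s _ s]) (use GG GI IG II mlc qs a' u in auto)
  have conj: "conjugate (v @\<^sub>v b) = conjugate v @\<^sub>v conjugate b"
    by (rule eq_vecI) auto
  show ?thesis
    unfolding 1 2 3 conj
    by (subst scalar_prod_append[of _ g _ s]) (use GG GI IG II mlc qs a' b' u v in \<open>auto intro!: carrier_vecI\<close>)
qed

text \<open>The elimination correction lies in the range of the high modes, so it leaves the coarse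
  components \<open>a\<close> untouched.\<close>

lemma elimination_split:
  fixes L :: "complex mat"
  assumes L: "L \<in> carrier_mat n l" and Q: "Q \<in> carrier_mat n s" and E: "E \<in> carrier_mat l l"
    and f: "f \<in> carrier_vec n" and a: "a \<in> carrier_vec s"
  shows "\<exists>c\<in>carrier_vec l. - (L * E * L\<^sup>T *\<^sub>v f) + Q *\<^sub>v a = Q *\<^sub>v a + L *\<^sub>v c"
proof -
  define y where "y = E *\<^sub>v (L\<^sup>T *\<^sub>v f)"
  have y: "y \<in> carrier_vec l" using E by (auto simp: y_def intro!: carrier_vecI)
  have "L * E * L\<^sup>T *\<^sub>v f = L *\<^sub>v y"
    unfolding y_def using L E f by (simp add: mat_vec_assoc_dim)
  moreover have "L *\<^sub>v (- y) = - (L *\<^sub>v y)"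
    using L y by (intro eq_vecI) auto
  ultimately have "- (L * E * L\<^sup>T *\<^sub>v f) + Q *\<^sub>v a = Q *\<^sub>v a + L *\<^sub>v (- y)"
    using L Q y a by (intro eq_vecI) auto
  then show ?thesis using y by (intro bexI[of _ "- y"]) auto
qed


subsection \<open>The perturbation estimate\<close>

abbreviation vnorm :: "complex Matrix.vec \<Rightarrow> real" where
  "vnorm x \<equiv> L2_set (\<lambda>r. cmod (x $ r)) {..<dim_vec x}"

lemma diag_perturbation:
  assumes x: "x \<in> carrier_vec m" and y: "y \<in> carrier_vec m" and \<eta>: "\<And>j. j < m \<Longrightarrow> \<bar>\<mu> j - 1\<bar> \<le> \<eta>"
  shows "cmod ((mat_diag m (\<lambda>j. complex_of_real (\<mu> j)) *\<^sub>v x) \<bullet>c y - x \<bullet>c y) \<le> \<eta> * (vnorm x * vnorm y)"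
\<comment> \<open>With no index at hand the sign of \<open>\<eta>\<close> is unknown, but then both
  sides are 0.\<close>
proof (cases "m = 0")
  case True
  then show ?thesis using x y by (simp add: scalar_prod_def)
next
  case False
  then have \<eta>0: "0 \<le> \<eta>" using \<eta>[of 0] by linarith
  have ind: "(mat_diag m (\<lambda>j. complex_of_real (\<mu> j)) *\<^sub>v x) $ r = complex_of_real (\<mu> r) * x $ r" if "r < m" for r
  proof -
    have "(mat_diag m (\<lambda>j. complex_of_real (\<mu> j)) *\<^sub>v x) $ r = (\<Sum>i<m. (if r = i then complex_of_real (\<mu> i) else 0) * x $ i)"
      using that x by (auto simp: mat_diag_def scalar_prod_def atLeast0LessThan intro!: sum.cong)
    also have "\<dots> = (\<Sum>i<m. if i = r then complex_of_real (\<mu> i) * x $ i else 0)" by (intro sum.cong) auto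
    finally show ?thesis using that by simp
  qed
  have "(mat_diag m (\<lambda>j. complex_of_real (\<mu> j)) *\<^sub>v x) \<bullet>c y - x \<bullet>c y =
      (\<Sum>r<m. complex_of_real (\<mu> r - 1) * x $ r * cnj (y $ r))"
    using x y by (auto simp: scalar_prod_def atLeast0LessThan ind sum_subtractf[symmetric] algebra_simps
        simp del: index_mult_mat_vec intro!: sum.cong)
  also have "cmod \<dots> \<le> (\<Sum>r<m. \<bar>\<mu> r - 1\<bar> * (cmod (x $ r) * cmod (y $ r)))"
    by (rule order_trans[OF norm_sum]) (simp add: norm_mult mult.assoc del: of_real_diff)
  also have "\<dots> \<le> (\<Sum>r<m. \<eta> * (cmod (x $ r) * cmod (y $ r)))"
    by (intro sum_mono mult_right_mono) (use \<eta> in auto)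
  also have "\<dots> = \<eta> * (\<Sum>r<m. \<bar>cmod (x $ r)\<bar> * \<bar>cmod (y $ r)\<bar>)"
    by (simp add: sum_distrib_left)
  also have "\<dots> \<le> \<eta> * (vnorm x * vnorm y)"
    using L2_set_mult_ineq[of "\<lambda>r. cmod (x $ r)" "\<lambda>r. cmod (y $ r)" "{..<m}"] x y \<eta>0 by (intro mult_left_mono) auto
  finally show ?thesis .
qed

lemma real_matrix_adjoint:
  assumes "real_matrix A" "dim_vec x = dim_row A" "dim_vec y = dim_col A"
  shows "(A *\<^sub>v y) \<bullet>c x = y \<bullet>c (A\<^sup>T *\<^sub>v x)"
  using cscalar_prod_real_matrix[OF real_matrix_transpose[OF assms(1)], of y x] assms(2,3) by simp

lemma real_matrix_outer:
  assumes "real_matrix A" "dim_vec s = dim_row A"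
  shows "(A * A\<^sup>T *\<^sub>v s) \<bullet>c s = complex_of_real ((vnorm (A\<^sup>T *\<^sub>v s))\<^sup>2)"
proof -
  have "A * A\<^sup>T *\<^sub>v s = A *\<^sub>v (A\<^sup>T *\<^sub>v s)" using assms by (intro mat_vec_assoc_dim) auto
  moreover have "(A *\<^sub>v (A\<^sup>T *\<^sub>v s)) \<bullet>c s = (A\<^sup>T *\<^sub>v s) \<bullet>c (A\<^sup>T *\<^sub>v s)"
    by (rule real_matrix_adjoint) (use assms in auto)
  ultimately show ?thesis by (simp only: cscalar_prod_self)
qed

text \<open>With y = \<open>Q\<^sup>T *\<^sub>v (H *\<^sub>v x)\<close> one has x = Q y, so the form
  of \<open>H\<close> becomes the squared Euclidean length of the modal coefficients. Positive
  definiteness of \<open>H\<close> is thus a consequence of having an orthonormal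
  eigenbasis.\<close>

lemma eigenbasis_form:
  assumes Q: "Q \<in> carrier_mat n n" "real_matrix Q" and H: "H \<in> carrier_mat n n"
    and QQH: "Q * Q\<^sup>T * H = 1\<^sub>m n" and x: "x \<in> carrier_vec n"
  shows "(H *\<^sub>v x) \<bullet>c x = complex_of_real ((vnorm (Q\<^sup>T *\<^sub>v (H *\<^sub>v x)))\<^sup>2)"
    and "x \<noteq> 0\<^sub>v n \<Longrightarrow> vnorm (Q\<^sup>T *\<^sub>v (H *\<^sub>v x)) > 0"
proof -
  define y where "y = Q\<^sup>T *\<^sub>v (H *\<^sub>v x)"
  have "x = (Q * Q\<^sup>T * H) *\<^sub>v x" unfolding QQH using x by simp
  also have "\<dots> = Q *\<^sub>v y" unfolding y_def using Q H x by (simp add: mat_vec_assoc_dim)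
  finally have xy: "x = Q *\<^sub>v y" .
  have "(H *\<^sub>v x) \<bullet>c x = (H *\<^sub>v x) \<bullet>c (Q *\<^sub>v y)" using xy by simp
  also have "\<dots> = (Q\<^sup>T *\<^sub>v (H *\<^sub>v x)) \<bullet>c y"
    by (rule cscalar_prod_real_matrix) (use Q H in \<open>auto simp: y_def\<close>)
  finally show "(H *\<^sub>v x) \<bullet>c x = complex_of_real ((vnorm (Q\<^sup>T *\<^sub>v (H *\<^sub>v x)))\<^sup>2)"
    unfolding y_def[symmetric] cscalar_prod_self .
  show "vnorm (Q\<^sup>T *\<^sub>v (H *\<^sub>v x)) > 0" if "x \<noteq> 0\<^sub>v n"
  proof (rule ccontr)
    assume "\<not> vnorm (Q\<^sup>T *\<^sub>v (H *\<^sub>v x)) > 0"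
    then have "vnorm y = 0" unfolding y_def[symmetric] using L2_set_nonneg[of "\<lambda>r. cmod (y $ r)" "{..<dim_vec y}"] by linarith
    then have "\<forall>r<dim_vec y. y $ r = 0" by (simp add: L2_set_eq_0_iff)
    moreover have "dim_vec y = n" using Q by (simp add: y_def)
    ultimately have "y = 0\<^sub>v n" by (intro eq_vecI) auto
    then have "x = 0\<^sub>v n" unfolding xy using Q by (intro eq_vecI) auto
    with that show False by simp
  qed
qed

lemma append_cols_dim [simp]:
  "dim_row (append_cols A B) = dim_row A" "dim_col (append_cols A B) = dim_col A + dim_col B"
  by (auto simp: append_cols_def)

lemma append_cols_index:
  assumes "i < dim_row A" "dim_row B = dim_row A" "k < dim_col A + dim_col B"
  shows "append_cols A B $$ (i, k) = (if k < dim_col A then A $$ (i, k) else B $$ (i, k - dim_col A))"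
  using assms by (auto simp: append_cols_def mat_of_cols_index nth_append)

lemma sum_lessThan_add: "(\<Sum>k<a + b. f k) = (\<Sum>k<a. f k) + (\<Sum>k<b. f (a + k))"
  for f :: "nat \<Rightarrow> 'a::comm_monoid_add"
  by (induction b) (auto simp: add.assoc)

lemma append_cols_outer:
  fixes A B :: "complex mat"
  assumes "dim_row B = dim_row A"
  shows "append_cols A B * (append_cols A B)\<^sup>T = A * A\<^sup>T + B * B\<^sup>T"
proof (rule eq_matI)
  fix i j assume "i < dim_row (A * A\<^sup>T + B * B\<^sup>T)" "j < dim_col (A * A\<^sup>T + B * B\<^sup>T)"
  then have ij: "i < dim_row A" "j < dim_row A" using assms by auto
  have "(append_cols A B * (append_cols A B)\<^sup>T) $$ (i, j) =
      (\<Sum>k<dim_col A + dim_col B. append_cols A B $$ (i, k) * append_cols A B $$ (j, k))"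
    using ij by (auto simp: scalar_prod_def atLeast0LessThan)
  also have "\<dots> = (\<Sum>k<dim_col A. append_cols A B $$ (i, k) * append_cols A B $$ (j, k)) +
      (\<Sum>k<dim_col B. append_cols A B $$ (i, dim_col A + k) * append_cols A B $$ (j, dim_col A + k))"
    by (rule sum_lessThan_add)
  also have "\<dots> = (A * A\<^sup>T + B * B\<^sup>T) $$ (i, j)"
    using ij assms by (auto simp: scalar_prod_def atLeast0LessThan append_cols_index intro!: arg_cong2[where f = "(+)"] sum.cong)
  finally show "(append_cols A B * (append_cols A B)\<^sup>T) $$ (i, j) = (A * A\<^sup>T + B * B\<^sup>T) $$ (i, j)" .
qed (use assms in auto)

lemma real_matrix_append_cols:
  assumes "real_matrix A" "real_matrix B" "dim_row B = dim_row A"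
  shows "real_matrix (append_cols A B)"
  unfolding real_matrix_def
  by (rule eq_matI) (use assms in \<open>auto simp: append_cols_index real_matrix_index\<close>)

lemma not_selected_bound: "\<not> selected \<eta> x \<Longrightarrow> \<bar>x - 1\<bar> \<le> \<eta>"
  by (auto simp: selected_def)

text \<open>\<open>J\<close> is the \<open>H\<close>-orthogonal projection onto the span of the
  vectors that neither eigenproblem selects. In orthonormal coordinates of that span,
  \<open>C\<close> and \<open>A\<close> both act as the identity up to \<eta>, so their difference
  is at most 2\<eta>; Bessel's inequality returns from coordinates to the
  \<open>H\<close>-norm.\<close>

lemma spectral_perturbation:
  assumes A: "A \<in> carrier_mat n n" and H: "H \<in> carrier_mat n n" and C: "C \<in> carrier_mat n n"
    and eig1: "real_eigenbasis A H Q \<mu>"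
    and Q1: "Q1 = select_cols (\<lambda>j. selected \<eta> (\<mu> j)) Q" and Qp: "Qp = select_cols (\<lambda>j. \<not> selected \<eta> (\<mu> j)) Q"
    and eig2: "real_eigenbasis (Qp\<^sup>T * C * Qp) (Qp\<^sup>T * H * Qp) W \<nu>"
    and Q2: "Q2 = Qp * select_cols (\<lambda>j. selected \<eta> (\<nu> j)) W"
    and QR: "QR = append_cols Q1 Q2" and J: "J = 1\<^sub>m n - QR * QR\<^sup>T * H"
    and u: "u \<in> carrier_vec n" and v: "v \<in> carrier_vec n" and \<eta>: "0 \<le> \<eta>"
  shows "cmod ((J\<^sup>T * C * J *\<^sub>v u) \<bullet>c v - (J\<^sup>T * A * J *\<^sub>v u) \<bullet>c v)
    \<le> 2 * \<eta> * (sqrt (Re ((H *\<^sub>v u) \<bullet>c u)) * sqrt (Re ((H *\<^sub>v v) \<bullet>c v)))"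
proof -
  note d1 = real_eigenbasis_diag[OF eig1 A H]
  define m where "m = length (positions (\<lambda>j. \<not> selected \<eta> (\<mu> j)) n)"
  define l where "l = length (positions (\<lambda>j. \<not> selected \<eta> (\<nu> j)) m)"
  have dQ: "dim_row Q = n" "dim_col Q = n" using d1(1) by auto
  have dA: "dim_row A = n" "dim_col A = n" "dim_row C = n" "dim_col C = n" "dim_row H = n" "dim_col H = n"
    using A C H by auto
  have dQp: "dim_row Qp = n" "dim_col Qp = m" and dQ1: "dim_row Q1 = n" by (simp_all add: Qp Q1 dQ m_def)
  have real_Qp: "real_matrix Qp" and real_Q1: "real_matrix Q1" using d1(2) by (simp_all add: Qp Q1 real_matrix_select_cols)
  \<comment> \<open>On the retained first eigenvectors \<open>H\<close> is the identity, so the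
    second eigenproblem is an ordinary Euclidean one and its eigenvectors are orthonormal in the
    usual sense.\<close>
  have HH: "Qp\<^sup>T * H * Qp = 1\<^sub>m m"
    unfolding Qp m_def mat_diag_one[symmetric] by (rule select_cols_diag) (use d1 dQ dA in auto)
  define \<mu>' where "\<mu>' r = \<mu> (positions (\<lambda>j. \<not> selected \<eta> (\<mu> j)) n ! r)" for r
  have AA: "Qp\<^sup>T * A * Qp = mat_diag m (\<lambda>j. complex_of_real (\<mu>' j))"
    unfolding Qp m_def \<mu>'_def by (rule select_cols_diag) (use d1 dQ dA in auto)
  have CC: "Qp\<^sup>T * C * Qp \<in> carrier_mat m m" using dQp by auto
  note d2 = real_eigenbasis_diag[OF eig2[unfolded HH] CC one_carrier_mat]
  have dW: "dim_row W = m" "dim_col W = m" using d2(1) by auto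
  define Ws where "Ws = select_cols (\<lambda>j. selected \<eta> (\<nu> j)) W"
  define Wu where "Wu = select_cols (\<lambda>j. \<not> selected \<eta> (\<nu> j)) W"
  have dWs: "dim_row Ws = m" "dim_row Wu = m" "dim_col Wu = l" by (simp_all add: Ws_def Wu_def dW l_def)
  have real_Ws: "real_matrix Ws" and real_Wu: "real_matrix Wu"
    using d2(2) by (simp_all add: Ws_def Wu_def real_matrix_select_cols)
  define \<nu>' where "\<nu>' r = \<nu> (positions (\<lambda>j. \<not> selected \<eta> (\<nu> j)) m ! r)" for r
  have WC: "Wu\<^sup>T * (Qp\<^sup>T * C * Qp) * Wu = mat_diag l (\<lambda>j. complex_of_real (\<nu>' j))"
    unfolding Wu_def l_def \<nu>'_def by (rule select_cols_diag) (use d2 dW dQp in auto)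
  have "Wu\<^sup>T * 1\<^sub>m m * Wu = 1\<^sub>m l"
    unfolding Wu_def l_def mat_diag_one[symmetric, of "length _"] by (rule select_cols_diag) (use d2 dW in auto)
  then have WW: "Wu\<^sup>T * Wu = 1\<^sub>m l" by (metis dWs(2) index_transpose_mat(3) carrier_mat_triv right_mult_one_mat)
  \<comment> \<open>The columns of \<open>Z\<close> are the vectors left over by both selections;
    together with those of \<open>QR\<close> they have the same outer product sum as the full
    eigenbasis.\<close>
  define Z where "Z = Qp * Wu"
  have dZ: "dim_row Z = n" "dim_col Z = l" by (simp_all add: Z_def dQp dWs)
  have dQ2: "dim_row Q2 = n" by (simp add: Q2 dQp)
  have real_Z: "real_matrix Z" and real_Q2: "real_matrix Q2"
    unfolding Z_def Q2 Ws_def[symmetric] using real_Qp real_Ws real_Wu dQp dWs by (auto intro!: real_matrix_mult)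
  have real_QR: "real_matrix QR" and dQR: "dim_row QR = n"
    unfolding QR using real_Q1 real_Q2 dQ1 dQ2 by (auto intro!: real_matrix_append_cols)
  have outer: "(Qp * X) * (Qp * X)\<^sup>T = Qp * (X * X\<^sup>T) * Qp\<^sup>T" if "dim_row X = m" for X
    using that dQp by (simp add: transpose_mult_dim mat_mult_assoc_dim)
  have "Q2 * Q2\<^sup>T + Z * Z\<^sup>T = Qp * (Ws * Ws\<^sup>T) * Qp\<^sup>T + Qp * (Wu * Wu\<^sup>T) * Qp\<^sup>T"
    unfolding Q2 Z_def Ws_def[symmetric] by (simp add: outer dWs)
  also have "\<dots> = (Qp * (Ws * Ws\<^sup>T) + Qp * (Wu * Wu\<^sup>T)) * Qp\<^sup>T"
    by (rule add_mult_distrib_mat[symmetric, of _ n m _ _ n]) (auto intro!: carrier_matI simp: dQp dWs)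
  also have "Qp * (Ws * Ws\<^sup>T) + Qp * (Wu * Wu\<^sup>T) = Qp * (Ws * Ws\<^sup>T + Wu * Wu\<^sup>T)"
    by (rule mult_add_distrib_mat[symmetric, of _ n m _ m]) (auto intro!: carrier_matI simp: dQp dWs)
  also have "Ws * Ws\<^sup>T + Wu * Wu\<^sup>T = W * W\<^sup>T"
    unfolding Ws_def Wu_def by (rule select_cols_outer)
  also have "W * W\<^sup>T = 1\<^sub>m m" using d2(5) dW by (metis carrier_mat_triv index_mult_mat(3) index_transpose_mat(3) right_mult_one_mat)
  also have "Qp * 1\<^sub>m m = Qp" using dQp by (metis carrier_mat_triv right_mult_one_mat)
  finally have Q2Z: "Q2 * Q2\<^sup>T + Z * Z\<^sup>T = Qp * Qp\<^sup>T" .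
  have "QR * QR\<^sup>T + Z * Z\<^sup>T = Q1 * Q1\<^sup>T + (Q2 * Q2\<^sup>T + Z * Z\<^sup>T)"
    unfolding QR using dQ1 dQ2 dZ by (subst append_cols_outer) (auto intro!: assoc_add_mat[of _ n n] carrier_matI)
  also have "\<dots> = Q * Q\<^sup>T" unfolding Q2Z unfolding Q1 Qp by (rule select_cols_outer)
  finally have QRZ: "QR * QR\<^sup>T + Z * Z\<^sup>T = Q * Q\<^sup>T" .
  have "1\<^sub>m n = (QR * QR\<^sup>T + Z * Z\<^sup>T) * H" using d1(5) QRZ by simp
  also have "\<dots> = QR * QR\<^sup>T * H + Z * Z\<^sup>T * H"
    by (rule add_mult_distrib_mat[of _ n n _ _ n]) (auto intro!: carrier_matI simp: dQR dZ dA)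
  finally have JZ: "J = Z * Z\<^sup>T * H"
    unfolding J by (intro eq_matI) (auto simp: dQR dZ dA)
  have dJ: "dim_row J = n" "dim_col J = n" by (simp_all add: JZ dZ dA)
  have real_J: "real_matrix J"
    unfolding JZ using real_Z real_matrix_transpose[OF real_Z] d1(6) dZ dA by (intro real_matrix_mult) auto
  define y where "y x = Z\<^sup>T *\<^sub>v (H *\<^sub>v x)" for x
  have yc: "y x \<in> carrier_vec l" for x by (rule carrier_vecI) (simp add: y_def dZ)
  have Jx: "J *\<^sub>v x = Z *\<^sub>v y x" if "x \<in> carrier_vec n" for x
    unfolding JZ y_def using that dZ dA by (simp add: mat_vec_assoc_dim)
  have red: "(J\<^sup>T * X * J *\<^sub>v u) \<bullet>c v = (Wu\<^sup>T * (Qp\<^sup>T * X * Qp) * Wu *\<^sub>v y u) \<bullet>c y v"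
    if X: "X \<in> carrier_mat n n" for X
  proof -
    have "J\<^sup>T * X * J *\<^sub>v u = J\<^sup>T *\<^sub>v (X *\<^sub>v (J *\<^sub>v u))"
      using X u dJ by (simp add: mat_vec_assoc_dim mat_mult_assoc_dim)
    also have "\<dots> \<bullet>c v = (X *\<^sub>v (J *\<^sub>v u)) \<bullet>c (J *\<^sub>v v)"
      using real_matrix_adjoint[OF real_matrix_transpose[OF real_J], of v "X *\<^sub>v (J *\<^sub>v u)"] X v dJ by simp
    also have "\<dots> = (X *\<^sub>v (Z *\<^sub>v y u)) \<bullet>c (Z *\<^sub>v y v)" using u v by (simp add: Jx)
    also have "\<dots> = (Z\<^sup>T *\<^sub>v (X *\<^sub>v (Z *\<^sub>v y u))) \<bullet>c y v"
      by (rule cscalar_prod_real_matrix) (use real_Z X dZ yc[of v] in auto)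
    also have "Z\<^sup>T *\<^sub>v (X *\<^sub>v (Z *\<^sub>v y u)) = Wu\<^sup>T * (Qp\<^sup>T * X * Qp) * Wu *\<^sub>v y u"
      unfolding Z_def using X dQp dWs yc[of u] by (simp add: transpose_mult_dim mat_vec_assoc_dim mat_mult_assoc_dim)
    finally show ?thesis .
  qed
  \<comment> \<open>The squared length of all coefficients in the eigenbasis \<open>Q\<close> is the
    sum of the parts along \<open>QR\<close> and along \<open>Z\<close>; dropping the former gives
    the bound.\<close>
  have bessel: "vnorm (y x) \<le> sqrt (Re ((H *\<^sub>v x) \<bullet>c x))" if x: "x \<in> carrier_vec n" for x
  proof -
    define s where "s = H *\<^sub>v x"
    have s: "s \<in> carrier_vec n" using H x by (simp add: s_def)
    have "complex_of_real ((vnorm (Q\<^sup>T *\<^sub>v s))\<^sup>2) = (Q * Q\<^sup>T *\<^sub>v s) \<bullet>c s"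
      by (rule real_matrix_outer[symmetric]) (use d1 dQ s in auto)
    also have "\<dots> = (QR * QR\<^sup>T *\<^sub>v s + Z * Z\<^sup>T *\<^sub>v s) \<bullet>c s"
      unfolding QRZ[symmetric] by (subst add_mult_distrib_mat_vec[of _ n n]) (auto intro!: carrier_matI simp: dQR dZ s)
    also have "\<dots> = (QR * QR\<^sup>T *\<^sub>v s) \<bullet>c s + (Z * Z\<^sup>T *\<^sub>v s) \<bullet>c s"
      by (rule add_scalar_prod_distrib[of _ n]) (use s in \<open>auto intro!: carrier_vecI simp: dQR dZ\<close>)
    also have "\<dots> = complex_of_real ((vnorm (QR\<^sup>T *\<^sub>v s))\<^sup>2 + (vnorm (Z\<^sup>T *\<^sub>v s))\<^sup>2)"
      using real_matrix_outer[OF real_QR] real_matrix_outer[OF real_Z] s dQR dZ by simp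
    finally have eq: "(vnorm (Q\<^sup>T *\<^sub>v s))\<^sup>2 = (vnorm (QR\<^sup>T *\<^sub>v s))\<^sup>2 + (vnorm (Z\<^sup>T *\<^sub>v s))\<^sup>2"
      using of_real_eq_iff by blast
    have "(vnorm (y x))\<^sup>2 \<le> (vnorm (Q\<^sup>T *\<^sub>v s))\<^sup>2" unfolding eq y_def s_def[symmetric] by simp
    also have "\<dots> = Re ((H *\<^sub>v x) \<bullet>c x)"
      unfolding eigenbasis_form(1)[OF d1(1,2) H d1(5) x] s_def by simp
    finally show ?thesis by (rule real_le_rsqrt)
  qed
  have Wy: "Wu *\<^sub>v y x \<in> carrier_vec m" for x by (rule carrier_vecI) (simp add: dWs)
  have Wadj: "(Wu\<^sup>T *\<^sub>v t) \<bullet>c y x = t \<bullet>c (Wu *\<^sub>v y x)" if "t \<in> carrier_vec m" for t x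
    by (rule cscalar_prod_real_matrix[symmetric]) (use that yc[of x] dWs real_Wu in auto)
  \<comment> \<open>\<open>A\<close> is diagonal in the first eigenbasis, not in the coordinates
    \<open>y\<close>. The map \<open>Wu\<close> between the two has orthonormal columns, so passing
    to \<open>Wu *\<^sub>v y x\<close> changes neither inner products nor norms.\<close>
  have Wiso: "(Wu *\<^sub>v y x) \<bullet>c (Wu *\<^sub>v y x') = y x \<bullet>c y x'" for x x'
    using Wadj[OF Wy, of x x'] WW yc[of x] dWs
    by (simp add: mat_vec_assoc_dim[of "Wu\<^sup>T" Wu, symmetric])
  have "(vnorm (Wu *\<^sub>v y x))\<^sup>2 = (vnorm (y x))\<^sup>2" for x
    using Wiso[of x x] unfolding cscalar_prod_self of_real_eq_iff .
  then have Wnorm: "vnorm (Wu *\<^sub>v y x) = vnorm (y x)" for x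
    by (rule power2_eq_imp_eq) (rule L2_set_nonneg)+
  have C1: "cmod ((Wu\<^sup>T * (Qp\<^sup>T * C * Qp) * Wu *\<^sub>v y u) \<bullet>c y v - y u \<bullet>c y v) \<le> \<eta> * (vnorm (y u) * vnorm (y v))"
    unfolding WC by (rule diag_perturbation[OF yc yc])
      (use positions_nth in \<open>auto simp: \<nu>'_def l_def intro!: not_selected_bound\<close>)
  have "(Wu\<^sup>T * (Qp\<^sup>T * A * Qp) * Wu *\<^sub>v y u) = Wu\<^sup>T *\<^sub>v (mat_diag m (\<lambda>j. complex_of_real (\<mu>' j)) *\<^sub>v (Wu *\<^sub>v y u))"
    unfolding AA using dWs yc[of u] carrier_matD[OF mat_diag_dim[of m "\<lambda>j. complex_of_real (\<mu>' j)"]]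
    by (simp add: mat_vec_assoc_dim mat_mult_assoc_dim)
  then have A0: "(Wu\<^sup>T * (Qp\<^sup>T * A * Qp) * Wu *\<^sub>v y u) \<bullet>c y v = (mat_diag m (\<lambda>j. complex_of_real (\<mu>' j)) *\<^sub>v (Wu *\<^sub>v y u)) \<bullet>c (Wu *\<^sub>v y v)"
    using Wadj[OF mult_mat_vec_carrier[OF mat_diag_dim Wy]] by simp
  have A1: "cmod ((Wu\<^sup>T * (Qp\<^sup>T * A * Qp) * Wu *\<^sub>v y u) \<bullet>c y v - y u \<bullet>c y v) \<le> \<eta> * (vnorm (y u) * vnorm (y v))"
    unfolding A0 Wiso[symmetric] Wnorm[symmetric] by (rule diag_perturbation[OF Wy Wy])
      (use positions_nth in \<open>auto simp: \<mu>'_def m_def intro!: not_selected_bound\<close>)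
  have "cmod ((J\<^sup>T * C * J *\<^sub>v u) \<bullet>c v - (J\<^sup>T * A * J *\<^sub>v u) \<bullet>c v) \<le> 2 * \<eta> * (vnorm (y u) * vnorm (y v))"
    unfolding red[OF C] red[OF A]
    using norm_triangle_ineq4[of "(Wu\<^sup>T * (Qp\<^sup>T * C * Qp) * Wu *\<^sub>v y u) \<bullet>c y v - y u \<bullet>c y v"
        "(Wu\<^sup>T * (Qp\<^sup>T * A * Qp) * Wu *\<^sub>v y u) \<bullet>c y v - y u \<bullet>c y v"] C1 A1
    by simp
  also have "\<dots> \<le> 2 * \<eta> * (sqrt (Re ((H *\<^sub>v u) \<bullet>c u)) * sqrt (Re ((H *\<^sub>v v) \<bullet>c v)))"
    using \<eta> bessel[OF u] bessel[OF v] by (intro mult_left_mono mult_mono) (auto intro: L2_set_nonneg order_trans[OF L2_set_nonneg bessel[OF u]] simp del: real_sqrt_ge_0_iff)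
  finally show ?thesis .
qed

subsection \<open>Touching convex sets on a supporting hyperplane\<close>

text \<open>Both sets lie on the same side of the hyperplane supporting \<open>P\<close> along
  \<open>F\<close>. If they shared a piece of that hyperplane of full dimension d - 1, then near a
  relative interior point of it each would fill a one-sided neighbourhood, and they would meet off
  the hyperplane. But a proper common face that contains such a piece has no room left and lies in
  the hyperplane.\<close>

lemma common_face_dim:
  fixes K K' P F :: "'a::euclidean_space set"
  assumes K: "convex K" "interior K \<noteq> {}" "K \<subseteq> P" and K': "convex K'" "interior K' \<noteq> {}" "K' \<subseteq> P"
    and ne: "K \<noteq> K'" and face: "K \<inter> K' face_of K" "K \<inter> K' face_of K'"
    and P: "polyhedron P" and F: "F facet_of P"
  shows "aff_dim (K \<inter> K' \<inter> F) < DIM('a) - 1"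
proof (rule ccontr)
  define N where "N = K \<inter> K' \<inter> F"
  assume "\<not> ?thesis"
  then have dimN: "aff_dim N \<ge> DIM('a) - 1" by (simp add: N_def)
  have conP: "convex P" using P polyhedron_imp_convex by blast
  have intP: "interior P \<noteq> {}" using K interior_mono by blast
  have FP: "F face_of P" "F \<noteq> P" using F facet_of_imp_face_of facet_of_irrefl by blast+
  obtain a b where Pab: "P \<subseteq> {x. inner a x \<le> b}" and Fab: "F = P \<inter> {x. inner a x = b}"
    using FP exposed_face_of_polyhedron[OF P] unfolding exposed_face_of_def by metis
  have a0: "a \<noteq> 0"
  proof
    assume "a = 0"
    moreover have "F \<noteq> {}" using F facet_of_def by blast
    ultimately show False using Fab FP(2) by (auto split: if_splits)
  qed
  have KK': "K \<inter> K' \<noteq> K"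
  proof
    assume "K \<inter> K' = K"
    then have "K face_of K'" using face by simp
    moreover have "aff_dim K = aff_dim K'" using K K' aff_dim_nonempty_interior by metis
    ultimately have "K = K'" using face_of_aff_dim_lt[OF K'(1)] by fastforce
    with ne show False ..
  qed
  have faceF: "K \<inter> F face_of K"
    using face_of_slice[OF FP(1) K(1)] K(3) by (simp add: Int_absorb2 Int_commute)
  have N_face: "N face_of K" unfolding N_def
    using face_of_Int[OF face(1) faceF] face_of_imp_subset[OF face(1)] by (simp add: Int_ac Int_absorb1)
  have dimE: "aff_dim (K \<inter> K') < DIM('a)"
    using face_of_aff_dim_lt[OF K(1) face(1) KK'] aff_dim_le_DIM[of K] by linarith
  \<comment> \<open>\<open>N\<close> is a face of \<open>K \<inter> K'\<close>. A proper face has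
    smaller dimension, yet \<open>N\<close> has dimension at least d - 1 and
    \<open>K \<inter> K'\<close> at most d - 1.\<close>
  have NE: "N = K \<inter> K'"
  proof (rule ccontr)
    assume "N \<noteq> K \<inter> K'"
    moreover have "N face_of K \<inter> K'"
      using face_of_subset[OF N_face] by (auto simp: N_def)
    ultimately have "aff_dim N < aff_dim (K \<inter> K')"
      using face_of_aff_dim_lt[of "K \<inter> K'" N] K(1) K'(1) convex_Int by blast
    with dimN dimE show False by linarith
  qed
  have Nab: "N \<subseteq> {x. inner a x = b}" using Fab N_def by blast
  have "aff_dim {x. inner a x = b} = DIM('a) - 1" using a0 by (rule aff_dim_hyperplane)
  then have "aff_dim N = aff_dim {x. inner a x = b}"
    using aff_dim_subset[OF Nab] dimN by linarith
  then have "affine hull N = affine hull {x. inner a x = b}"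
    using aff_dim_eq_full_gen[OF Nab] by blast
  also have "\<dots> = {x. inner a x = b}" using affine_hyperplane by (rule hull_same)
  finally have affN: "affine hull N = {x. inner a x = b}" .
  have conN: "convex N" using N_face face_of_imp_convex[OF N_face] by simp
  have "affine hull N \<noteq> {}" unfolding affN hyperplane_eq_empty using a0 by simp
  then have "N \<noteq> {}" by auto
  then obtain x where x: "x \<in> rel_interior N" using conN rel_interior_eq_empty by blast
  then obtain e where xN: "x \<in> N" and e: "e > 0" "ball x e \<inter> affine hull N \<subseteq> N"
    using rel_interior_ball by (auto simp: mem_rel_interior_ball)
  have strict: "inner a p < b" if "p \<in> interior C" "C \<subseteq> P" for p C
  proof -
    have "p \<in> interior P" using that interior_mono by blast
    then have "p \<in> P" "p \<notin> F" using face_of_disjoint_interior[OF FP] interior_subset by blast+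
    then show ?thesis using Pab Fab by force
  qed
  obtain p p' where p: "p \<in> interior K" and p': "p' \<in> interior K'" using K K' by blast
  \<comment> \<open>The ratio of the heights of \<open>p\<close> and \<open>p'\<close> above the
    hyperplane. With this weight the heights of \<open>t (p - x)\<close> and
    \<open>c t (p' - x)\<close> cancel, which keeps the point \<open>w t\<close> below on the
    hyperplane.\<close>
  define c where "c = (b - inner a p) / (b - inner a p')"
  have bp: "b - inner a p > 0" "b - inner a p' > 0" using strict[OF p K(3)] strict[OF p' K'(3)] by simp_all
  then have c: "c > 0" by (simp add: c_def)
  have c_eq: "c * (b - inner a p') = b - inner a p" using bp by (simp add: c_def)
  \<comment> \<open>For small \<open>t\<close> the point \<open>x + t (p - x)\<close> of \<open>K\<close> is a convex combination of \<open>p'\<close> and a point \<open>w t\<close>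
    of the hyperplane near \<open>x\<close>, hence lies in \<open>K'\<close> as well, off the hyperplane.\<close>
  define w where "w t = (1 / (1 - c * t)) *\<^sub>R (x + t *\<^sub>R (p - x) - (c * t) *\<^sub>R p')" for t
  have "(w \<longlongrightarrow> (1 / (1 - c * 0)) *\<^sub>R (x + 0 *\<^sub>R (p - x) - (c * 0) *\<^sub>R p')) (at_right 0)"
    unfolding w_def by (intro tendsto_intros) auto
  then have "\<forall>\<^sub>F t in at_right 0. w t \<in> ball x e"
    using e(1) by (auto dest!: tendstoD[of _ _ _ e] simp: dist_commute)
  moreover have "\<forall>\<^sub>F t in at_right (0::real). 0 < t \<and> t < min 1 (1 / c)"
    using c by (intro eventually_at_rightI[of 0 "min 1 (1 / c)"]) auto
  ultimately have "\<forall>\<^sub>F t in at_right 0. w t \<in> ball x e \<and> 0 < t \<and> t < min 1 (1 / c)"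
    by eventually_elim auto
  from eventually_happens'[OF trivial_limit_at_right_real this]
  obtain t where t: "w t \<in> ball x e" "t < 1" "t < 1 / c" "0 < t" by auto
  have ct: "c * t < 1" "c * t > 0" using t c by (auto simp: field_simps)
  have ax: "inner a x = b" using xN Nab by blast
  have "inner a (x + t *\<^sub>R (p - x) - (c * t) *\<^sub>R p') = b - t * (b - inner a p) - c * t * inner a p'"
    by (simp add: inner_add_right inner_diff_right ax algebra_simps)
  also have "\<dots> = (1 - c * t) * b" unfolding c_eq[symmetric] by (simp add: algebra_simps)
  finally have "inner a (w t) = b" using ct by (simp add: w_def)
  then have "w t \<in> N" using e t affN by blast
  then have wK': "w t \<in> K'" by (simp add: N_def)
  define z where "z = x + t *\<^sub>R (p - x)"
  have "z = (1 - c * t) *\<^sub>R w t + (c * t) *\<^sub>R p'" using ct by (simp add: w_def z_def)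
  moreover have "p' \<in> K'" "p \<in> K" using p p' interior_subset by blast+
  ultimately have "z \<in> K'" using convexD_alt[OF K'(1) wK' \<open>p' \<in> K'\<close>, of "c * t"] ct by simp
  moreover have "z = (1 - t) *\<^sub>R x + t *\<^sub>R p" by (simp add: z_def algebra_simps)
  then have "z \<in> K" using convexD_alt[OF K(1) _ \<open>p \<in> K\<close>, of x t] xN t by (simp add: N_def)
  ultimately have "inner a z = b" using NE Nab by blast
  moreover have "inner a z = b - t * (b - inner a p)"
    by (simp add: z_def inner_add_right inner_diff_right ax algebra_simps)
  ultimately show False using t(4) bp by simp
qed

lemma negligible_aff_dim:
  fixes A :: "'a::euclidean_space set"
  assumes "aff_dim A < DIM('a)"
  shows "negligible A"
proof -
  obtain a b where "a \<noteq> 0" "A \<subseteq> {x. inner a x = b}"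
    using aff_lowdim_subset_hyperplane[OF assms] by metis
  then show ?thesis using negligible_hyperplane negligible_subset by metis
qed

text \<open>With \<open>y\<close> an affine set also contains its reflection in the closest point.
  The variational inequality for both points has opposite signs and becomes an equation.\<close>

lemma closest_point_affine_orth:
  fixes A :: "'a::euclidean_space set"
  assumes "affine A" "closed A" "y \<in> A"
  shows "inner (z - closest_point A z) (y - closest_point A z) = 0"
proof -
  have ne: "A \<noteq> {}" using assms by blast
  let ?c = "closest_point A z"
  have c: "?c \<in> A" using closest_point_in_set assms ne by blast
  have "2 *\<^sub>R ?c - y = 1 *\<^sub>R ?c + (1::real) *\<^sub>R (?c - y)" by (simp add: scaleR_2)
  then have "2 *\<^sub>R ?c - y \<in> A" using mem_affine_3_minus[OF assms(1) c c assms(3), of 1] by (simp add: add_diff_eq)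
  from closest_point_dot[OF affine_imp_convex[OF assms(1)] assms(2) this, of z]
    closest_point_dot[OF affine_imp_convex[OF assms(1)] assms(2,3), of z]
  show ?thesis by (simp add: scaleR_2 inner_diff_right inner_add_right)
qed

text \<open>Projection onto the hyperplane moves points along the normal \<open>a\<close>, so the
  fibre over \<open>N\<close> lies in the affine hull of \<open>N\<close> and one further point in
  normal direction. This raises the dimension by at most 1 and leaves it below that of the
  space.\<close>

lemma negligible_fibre_closest_point:
  fixes F N :: "'a::euclidean_space set"
  assumes N: "aff_dim N < DIM('a) - 1" "N \<subseteq> F" and F: "aff_dim F = DIM('a) - 1"
  shows "negligible {z. closest_point (affine hull F) z \<in> N}"
proof (cases "N = {}")
  case False
  then obtain x0 where x0: "x0 \<in> N" by blast
  obtain a b where a0: "a \<noteq> 0" and Fab: "affine hull F = {x. inner a x = b}"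
    using F aff_dim_eq_hyperplane by blast
  have "{z. closest_point (affine hull F) z \<in> N} \<subseteq> affine hull (insert (x0 + a) N)"
  proof safe
    fix z assume c: "closest_point (affine hull F) z \<in> N"
    define c where "c = closest_point (affine hull F) z"
    \<comment> \<open>The tangential part of \<open>z - c\<close>. It is a direction of the
      hyperplane and orthogonal to \<open>z - c\<close>, hence to itself.\<close>
    define v where "v = (z - c) - (inner a (z - c) / inner a a) *\<^sub>R a"
    have av: "inner a v = 0" using a0 by (simp add: v_def inner_diff_right)
    have "c \<in> affine hull F" using c N(2) by (auto simp: c_def hull_inc)
    then have "c + v \<in> affine hull F" using av by (simp add: Fab inner_add_right)
    then have "inner (z - c) v = 0"
      using closest_point_affine_orth[of "affine hull F" "c + v" z] by (simp add: c_def)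
    moreover have "inner v v = inner (z - c) v - (inner a (z - c) / inner a a) * inner a v"
      unfolding v_def by (simp add: inner_diff_left)
    ultimately have "v = 0" using av by simp
    then have "z = c + (inner a (z - c) / inner a a) *\<^sub>R ((x0 + a) - x0)"
      by (simp add: v_def algebra_simps)
    moreover have "c \<in> affine hull (insert (x0 + a) N)" "x0 \<in> affine hull (insert (x0 + a) N)"
      "x0 + a \<in> affine hull (insert (x0 + a) N)"
      using c x0 by (auto simp: c_def hull_inc)
    ultimately show "z \<in> affine hull (insert (x0 + a) N)"
      using mem_affine_3_minus[OF affine_affine_hull] by metis
  qed
  moreover have "aff_dim (insert (x0 + a) N) \<le> aff_dim N + 1"
    using aff_dim_insert[of "x0 + a" N] by (auto split: if_splits)
  then have "negligible (affine hull (insert (x0 + a) N))"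
    using N by (intro negligible_aff_dim) simp
  ultimately show ?thesis using negligible_subset by blast
qed auto

subsection \<open>The surface measure of a facet\<close>

lemma facet_prism_compact:
  assumes "compact F"
  shows "compact {x + t *\<^sub>R (n :: real^'d::finite) | x t. x \<in> F \<and> 0 \<le> t \<and> t \<le> 1}"
proof -
  have "{x + t *\<^sub>R n | x t. x \<in> F \<and> 0 \<le> t \<and> t \<le> 1} = (\<lambda>(x, t). x + t *\<^sub>R n) ` (F \<times> {0..1})"
    by force
  moreover have "compact \<dots>"
    by (intro compact_continuous_image compact_Times assms compact_Icc)
      (auto simp: case_prod_beta intro!: continuous_intros)
  ultimately show ?thesis by simp
qed

lemma sets_facet_measure [simp, measurable_cong]: "sets (facet_measure F) = sets borel"
  by (simp add: facet_measure_def)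

lemma space_facet_measure [simp]: "space (facet_measure F) = UNIV"
  by (simp add: facet_measure_def)

lemma emeasure_facet_measure:
  assumes F: "compact F" "F \<noteq> {}" and A: "A \<in> sets borel"
  shows "emeasure (facet_measure F) A = emeasure lborel
    ({z. closest_point (affine hull F) z \<in> A} \<inter> {x + t *\<^sub>R unit_normal F | x t. x \<in> F \<and> 0 \<le> t \<and> t \<le> 1})"
proof -
  let ?P = "{x + t *\<^sub>R unit_normal F | x t. x \<in> F \<and> 0 \<le> t \<and> t \<le> 1}"
  have P: "?P \<in> sets lborel"
    using facet_prism_compact[OF F(1), of "unit_normal F"] by (auto dest: compact_imp_closed)
  have "closest_point (affine hull F) \<in> borel_measurable lborel"
    using F by (auto intro!: borel_measurable_continuous_onI continuous_on_closest_point affine_imp_convex)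
  then have m: "closest_point (affine hull F) \<in> measurable (restrict_space lborel ?P) borel"
    by (rule measurable_restrict_space1)
  show ?thesis
    unfolding facet_measure_def
    using P by (subst emeasure_distr[OF m A], subst emeasure_restrict_space)
      (auto simp: space_restrict_space vimage_def Int_commute intro!: arg_cong[where f = "emeasure lborel"])
qed

lemma finite_measure_facet:
  assumes "compact F" "F \<noteq> {}"
  shows "finite_measure (facet_measure F)"
proof
  have "emeasure (facet_measure F) UNIV \<noteq> \<infinity>"
    using emeasure_compact_finite[OF facet_prism_compact[OF assms(1), of "unit_normal F"]]
    by (subst emeasure_facet_measure[OF assms]) auto
  then show "emeasure (facet_measure F) (space (facet_measure F)) \<noteq> \<infinity>" by simp
qed

text \<open>The surface measure of \<open>N\<close> is at most the volume of the whole fibre over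
  \<open>N\<close>. Closedness of \<open>N\<close> makes that fibre a Borel set, so negligibility
  for the completed measure gives measure 0 for \<open>lborel\<close>.\<close>

lemma AE_facet_measure_lowdim:
  fixes F N :: "(real^'d::finite) set"
  assumes F: "compact F" "F \<noteq> {}" "aff_dim F = DIM(real^'d) - 1"
    and N: "closed N" "N \<subseteq> F" "aff_dim N < DIM(real^'d) - 1"
  shows "AE x in facet_measure F. x \<notin> N"
proof (rule AE_I')
  have "closest_point (affine hull F) -` N \<inter> space lborel \<in> sets lborel"
    using F N by (intro measurable_sets[of _ lborel borel])
      (auto intro!: borel_measurable_continuous_onI continuous_on_closest_point affine_imp_convex)
  then have fibre: "{z. closest_point (affine hull F) z \<in> N} \<in> sets lborel" by (simp add: vimage_def)
  have "{z. closest_point (affine hull F) z \<in> N} \<in> null_sets lebesgue"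
    using negligible_fibre_closest_point[OF N(3,2) F(3)] by (simp add: negligible_iff_null_sets)
  with fibre have 0: "emeasure lborel {z. closest_point (affine hull F) z \<in> N} = 0"
    by (auto simp: null_sets_def)
  have "emeasure (facet_measure F) N \<le> emeasure lborel {z. closest_point (affine hull F) z \<in> N}"
    using F N fibre by (subst emeasure_facet_measure) (auto intro!: emeasure_mono)
  with 0 show "N \<in> null_sets (facet_measure F)"
    using N(1) by (auto simp: null_sets_def)
qed auto

text \<open>Disjointness holds only almost everywhere, because the closures of neighbouring
  subdomains can share points of a facet.\<close>

lemma set_integral_finite_Union_AE:
  fixes f :: "_ \<Rightarrow> _ :: {banach, second_countable_topology}"
  assumes "finite I" "\<And>i j. i \<in> I \<Longrightarrow> j \<in> I \<Longrightarrow> i \<noteq> j \<Longrightarrow> AE x in M. \<not> (x \<in> A i \<and> x \<in> A j)"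
    and "\<And>i. i \<in> I \<Longrightarrow> set_integrable M (A i) f" "\<And>i. i \<in> I \<Longrightarrow> A i \<in> sets M"
  shows "set_lebesgue_integral M (\<Union>i\<in>I. A i) f = (\<Sum>i\<in>I. set_lebesgue_integral M (A i) f)"
  using assms
proof induction
  case (insert k J)
  have "AE x in M. \<forall>j\<in>J. \<not> (x \<in> A k \<and> x \<in> A j)"
    using insert by (intro AE_finite_allI) (auto intro!: insert.prems(1))
  then have "AE x in M. \<not> (x \<in> A k \<and> x \<in> (\<Union>j\<in>J. A j))" by eventually_elim auto
  then have "set_lebesgue_integral M (A k \<union> (\<Union>j\<in>J. A j)) f = 
      set_lebesgue_integral M (A k) f + set_lebesgue_integral M (\<Union>j\<in>J. A j) f"
    using insert by (intro set_integral_Un_AE set_integrable_UN sets.finite_UN) auto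
  with insert show ?case by simp
qed (simp add: set_lebesgue_integral_def)

subsection \<open>Finite element forms\<close>

text \<open>Split off without its imaginary factor, the boundary term is conjugate symmetric like
  the gradient and mass terms, so linearity in the first argument already yields
  sesquilinearity.\<close>

definition bnd_form :: "('d::finite, 'z) fe_decomposition_scheme \<Rightarrow> (real^'d) set \<Rightarrow>
    (real^'d \<Rightarrow> complex) \<Rightarrow> (real^'d \<Rightarrow> complex) \<Rightarrow> complex" where
  "bnd_form S D u v = boundary_int (dom S) (frontier D \<inter> frontier (dom S)) (\<lambda>x. u x * cnj (v x))"

definition sesquilinear_on :: "('a \<Rightarrow> complex) set \<Rightarrow> (('a \<Rightarrow> complex) \<Rightarrow> ('a \<Rightarrow> complex) \<Rightarrow> complex) \<Rightarrow> bool" where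
  "sesquilinear_on V f \<longleftrightarrow>
     (\<forall>u\<in>V. \<forall>w\<in>V. \<forall>v\<in>V. f (\<lambda>x. u x + w x) v = f u v + f w v \<and> f v (\<lambda>x. u x + w x) = f v u + f v w) \<and>
     (\<forall>u\<in>V. \<forall>v\<in>V. \<forall>c. f (\<lambda>x. c * u x) v = c * f u v \<and> f v (\<lambda>x. c * u x) = cnj c * f v u)"

lemma sesquilinear_onD:
  assumes "sesquilinear_on V f"
  shows "\<forall>u\<in>V. \<forall>w\<in>V. \<forall>v\<in>V. f (\<lambda>x. u x + w x) v = f u v + f w v \<and> f v (\<lambda>x. u x + w x) = f v u + f v w"
    and "\<forall>u\<in>V. \<forall>v\<in>V. \<forall>c. f (\<lambda>x. c * u x) v = c * f u v \<and> f v (\<lambda>x. c * u x) = cnj c * f v u"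
  using assms unfolding sesquilinear_on_def by (rule conjunct1, rule conjunct2)

lemma hermitian_sesquilinear_on:
  assumes "\<And>u w v. u \<in> V \<Longrightarrow> w \<in> V \<Longrightarrow> v \<in> V \<Longrightarrow> f (\<lambda>x. u x + w x) v = f u v + f w v"
    and "\<And>u v c. u \<in> V \<Longrightarrow> v \<in> V \<Longrightarrow> f (\<lambda>x. c * u x) v = c * f u v"
    and "\<And>u v. f v u = cnj (f u v)"
  shows "sesquilinear_on V f"
  unfolding sesquilinear_on_def
proof (intro conjI ballI allI)
  show "f v (\<lambda>x. u x + w x) = f v u + f v w" if "u \<in> V" "w \<in> V" "v \<in> V" for u w v
    using assms(1)[OF that] assms(3)[of v u] assms(3)[of v w] assms(3)[of v "\<lambda>x. u x + w x"] by simp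
  show "f v (\<lambda>x. c * u x) = cnj c * f v u" if "u \<in> V" "v \<in> V" for u v c
    using assms(2)[OF that] assms(3)[of v u] assms(3)[of v "\<lambda>x. c * u x"] by simp
qed (use assms(1,2) in auto)

lemma sesquilinear_on_linear_combination:
  assumes "sesquilinear_on V f" "sesquilinear_on V g"
  shows "sesquilinear_on V (\<lambda>u v. f u v + c * g u v)"
  using assms unfolding sesquilinear_on_def by (simp add: algebra_simps)

text \<open>\<open>frechet_derivative\<close> is a choice from the derivatives at the point.
  Equality of the \<open>has_derivative\<close> relations therefore suffices, also at points where
  no derivative exists.\<close>

lemma partial_deriv_cong_open:
  assumes "open D" "x \<in> D" "\<And>y. y \<in> D \<Longrightarrow> u y = v y"
  shows "partial_deriv j u x = partial_deriv j v x"
proof -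
  have "(u has_derivative f) (at x) \<longleftrightarrow> (v has_derivative f) (at x)" for f
    using has_derivative_transform_within_open[OF _ assms(1,2), of u f UNIV v]
      has_derivative_transform_within_open[OF _ assms(1,2), of v f UNIV u] assms(3) by auto
  then show ?thesis by (simp add: partial_deriv_def frechet_derivative_def)
qed

lemma grad_int_cnj: "grad_int D v u = cnj (grad_int D u v)"
  unfolding grad_int_def set_lebesgue_integral_def Bochner_Integration.integral_cnj[symmetric]
  by (intro Bochner_Integration.integral_cong) (auto simp: mult.commute)

lemma mass_int_cnj: "mass_int D v u = cnj (mass_int D u v)"
  unfolding mass_int_def set_lebesgue_integral_def Bochner_Integration.integral_cnj[symmetric]
  by (intro Bochner_Integration.integral_cong) (auto simp: mult.commute)

lemma bnd_form_cnj: "bnd_form S D v u = cnj (bnd_form S D u v)"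
  unfolding bnd_form_def boundary_int_def set_lebesgue_integral_def cnj_sum Bochner_Integration.integral_cnj[symmetric]
  by (intro sum.cong Bochner_Integration.integral_cong) (auto simp: mult.commute)

lemma H_form_cnj: "H_form S D v u = cnj (H_form S D u v)"
  by (simp add: H_form_def grad_int_cnj[of D v u] mass_int_cnj[of D v u])

text \<open>This covers functions whose integrals diverge as well: their default value 0 is
  nonnegative.\<close>

lemma Re_H_form_nonneg: "0 \<le> Re (H_form S D v v)"
proof -
  have sq: "z * cnj z = complex_of_real ((cmod z)\<^sup>2)" for z by (simp only: complex_norm_square)
  have 1: "grad_int D v v = complex_of_real (set_lebesgue_integral lebesgue D (\<lambda>x. \<Sum>j\<in>UNIV. (cmod (partial_deriv j v x))\<^sup>2))"
    unfolding grad_int_def sq of_real_sum[symmetric] set_integral_complex_of_real ..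
  have 2: "mass_int D v v = complex_of_real (set_lebesgue_integral lebesgue D (\<lambda>x. (cmod (v x))\<^sup>2))"
    unfolding mass_int_def sq set_integral_complex_of_real ..
  have "0 \<le> set_lebesgue_integral lebesgue D (\<lambda>x. \<Sum>j\<in>UNIV. (cmod (partial_deriv j v x))\<^sup>2)"
    "0 \<le> set_lebesgue_integral lebesgue D (\<lambda>x. (cmod (v x))\<^sup>2)"
    unfolding set_lebesgue_integral_def by (auto intro!: Bochner_Integration.integral_nonneg mult_nonneg_nonneg sum_nonneg)
  then show ?thesis by (simp add: H_form_def 1 2 flip: of_real_power of_real_mult of_real_add)
qed

locale fe_space =
  fixes S :: "('d::finite, 'z) fe_decomposition_scheme" and h \<sigma> :: real
  assumes fe: "fe_setting h \<sigma> S"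
begin

section \<open>Geometry of the domain, the mesh and the subdomains\<close>

lemma domain: "open (dom S)" "bounded (dom S)" "convex (dom S)" "dom S \<noteq> {}" "polytope (closure (dom S))"
  using fe by (auto simp: fe_setting_def)

lemma mesh: "finite (mesh S)" "\<Union>(mesh S) = closure (dom S)"
  using fe by (auto simp: fe_setting_def conforming_mesh_def)

lemma element:
  assumes "K \<in> mesh S"
  shows "compact K" "convex K" "interior K \<noteq> {}" "K \<subseteq> closure (dom S)"
  using assms fe mesh(2) by (auto simp: fe_setting_def conforming_mesh_def polytope_imp_compact polytope_imp_convex)

lemma elements_common_face:
  "K \<in> mesh S \<Longrightarrow> K' \<in> mesh S \<Longrightarrow> K \<inter> K' face_of K \<and> K \<inter> K' face_of K'"
  using fe by (auto simp: fe_setting_def conforming_mesh_def)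

lemma compact_closure_dom: "compact (closure (dom S))"
  using domain by (simp add: compact_closure)

lemma subdomain:
  assumes "i < nsub S"
  shows "open (sub S i)" "interior (closure (sub S i)) = sub S i" "sub S i \<subseteq> dom S"
    and "\<exists>T\<subseteq>mesh S. closure (sub S i) = \<Union>T"
proof -
  show "open (sub S i)" and int: "interior (closure (sub S i)) = sub S i" and "\<exists>T\<subseteq>mesh S. closure (sub S i) = \<Union>T"
    using assms fe by (auto simp: fe_setting_def subdomain_decomposition_def)
  have "closure (sub S i) \<subseteq> closure (dom S)"
    using assms fe unfolding fe_setting_def subdomain_decomposition_def by blast
  then show "sub S i \<subseteq> dom S"
    using int interior_mono convex_interior_closure[OF domain(3)] domain(1) interior_open by metis
qed

lemma subdomains_disjoint: "i < nsub S \<Longrightarrow> j < nsub S \<Longrightarrow> i \<noteq> j \<Longrightarrow> sub S i \<inter> sub S j = {}"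
  using fe unfolding fe_setting_def subdomain_decomposition_def by blast

lemma closure_dom_subdomains: "closure (dom S) = (\<Union>i<nsub S. closure (sub S i))"
  using fe unfolding fe_setting_def subdomain_decomposition_def by blast

lemma closure_subdomain: "i < nsub S \<Longrightarrow> closure (sub S i) = sub S i \<union> frontier (sub S i)"
  using subdomain(1)[of i] closure_Un_frontier by blast

lemma negligible_frontier_element: "K \<in> mesh S \<Longrightarrow> negligible (frontier K)"
  using element negligible_convex_frontier by blast

lemma negligible_skeleton: "negligible (closure (dom S) - (\<Union>K\<in>mesh S. interior K))"
proof (rule negligible_subset)
  show "negligible (\<Union>K\<in>mesh S. frontier K)"
    using mesh(1) negligible_frontier_element by blast
  show "closure (dom S) - (\<Union>K\<in>mesh S. interior K) \<subseteq> (\<Union>K\<in>mesh S. frontier K)"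
    unfolding mesh(2)[symmetric] frontier_def using closure_subset by blast
qed

text \<open>A point in no subdomain lies in the closure of one, hence, by
  \<open>interior (closure D) = D\<close>, on the frontier of that closure. As a finite union of
  elements, the closure has its frontier inside the element frontiers, which are null sets by
  convexity.\<close>

lemma negligible_outside_subdomains: "negligible (dom S - (\<Union>i<nsub S. sub S i))"
proof (rule negligible_subset)
  have "negligible (frontier (closure (sub S i)))" if i: "i < nsub S" for i
  proof -
    obtain T where T: "T \<subseteq> mesh S" "closure (sub S i) = \<Union>T" using subdomain(4)[OF i] by blast
    have fin: "finite T" by (rule finite_subset[OF T(1) mesh(1)])
    have "negligible (\<Union>K\<in>T. frontier K)"
      using fin T(1) by (intro negligible_Union finite_imageI) (auto intro: negligible_frontier_element)
    then show ?thesis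
      unfolding T(2) by (rule negligible_subset[OF _ frontier_Union_subset[OF fin]])
  qed
  then show "negligible (\<Union>i<nsub S. frontier (closure (sub S i)))"
    by (intro negligible_Union) auto
  show "dom S - (\<Union>i<nsub S. sub S i) \<subseteq> (\<Union>i<nsub S. frontier (closure (sub S i)))"
  proof
    fix x assume x: "x \<in> dom S - (\<Union>i<nsub S. sub S i)"
    then obtain i where i: "i < nsub S" "x \<in> closure (sub S i)"
      using closure_dom_subdomains closure_subset[of "dom S"] by blast
    then show "x \<in> (\<Union>i<nsub S. frontier (closure (sub S i)))"
      using x subdomain(2)[OF i(1)] by (auto simp: frontier_def)
  qed
qed

lemma Vh_on_element:
  assumes "u \<in> Vh S" "K \<in> mesh S"
  obtains p q where "p \<in> local_space S K" "q \<in> local_space S K" "\<And>x. x \<in> K \<Longrightarrow> u x = Complex (p x) (q x)"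
  using assms unfolding Vh_def by blast

lemma local_space:
  assumes "K \<in> mesh S"
  shows "(\<lambda>x. 0) \<in> local_space S K"
    and "\<forall>p\<in>local_space S K. C1_up_to_boundary K p \<and>
      (\<forall>q\<in>local_space S K. \<forall>a c. (\<lambda>x. a * p x + c * q x) \<in> local_space S K)"
proof -
  have "\<forall>K\<in>mesh S. (\<lambda>x. 0) \<in> local_space S K \<and> (\<forall>p\<in>local_space S K. C1_up_to_boundary K p \<and>
      (\<forall>q\<in>local_space S K. \<forall>a c. (\<lambda>x. a * p x + c * q x) \<in> local_space S K))"
    using fe unfolding fe_setting_def nodal_fe_space_def by (elim conjE) assumption
  from bspec[OF this assms] show "(\<lambda>x. 0) \<in> local_space S K"
    and "\<forall>p\<in>local_space S K. C1_up_to_boundary K p \<and>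
      (\<forall>q\<in>local_space S K. \<forall>a c. (\<lambda>x. a * p x + c * q x) \<in> local_space S K)"
    by (rule conjunct1, rule conjunct2)
qed

lemma local_space_C1: "K \<in> mesh S \<Longrightarrow> p \<in> local_space S K \<Longrightarrow> C1_up_to_boundary K p"
  using local_space(2)[of K] by simp

lemma local_space_lincomb:
  "K \<in> mesh S \<Longrightarrow> p \<in> local_space S K \<Longrightarrow> q \<in> local_space S K \<Longrightarrow> (\<lambda>x. a * p x + c * q x) \<in> local_space S K"
  using local_space(2)[of K] by simp

text \<open>The gradient on the open element is the restriction of a function continuous on the
  compact element; this provides integrability although nothing is known of the pointwise derivative
  on the skeleton.\<close>

lemma Vh_element:
  assumes u: "u \<in> Vh S" and K: "K \<in> mesh S"
  shows "\<exists>G. \<forall>j. continuous_on K (G j) \<and> (\<forall>x\<in>interior K. u differentiable (at x) \<and> partial_deriv j u x = G j x)"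
proof -
  obtain p q where pq: "p \<in> local_space S K" "q \<in> local_space S K" "\<And>x. x \<in> K \<Longrightarrow> u x = Complex (p x) (q x)"
    by (rule Vh_on_element[OF u K]) (rule that)
  from local_space_C1[OF K pq(1)] local_space_C1[OF K pq(2)] obtain gp gq where g: "continuous_on K gp" "continuous_on K gq"
    and p': "\<And>x. x \<in> K \<Longrightarrow> (p has_derivative (\<lambda>h. inner (gp x) h)) (at x within K)"
    and q': "\<And>x. x \<in> K \<Longrightarrow> (q has_derivative (\<lambda>h. inner (gq x) h)) (at x within K)"
    unfolding C1_up_to_boundary_def by blast
  have der: "(u has_derivative (\<lambda>h. complex_of_real (inner (gp x) h) + \<i> * complex_of_real (inner (gq x) h))) (at x)"
    if x: "x \<in> interior K" for x
  proof -
    have xK: "x \<in> K" and at: "at x within K = at x" using x interior_subset at_within_interior by blast+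
    have "((\<lambda>x. complex_of_real (p x) + \<i> * complex_of_real (q x)) has_derivative
        (\<lambda>h. complex_of_real (inner (gp x) h) + \<i> * complex_of_real (inner (gq x) h))) (at x)"
      using p'[OF xK] q'[OF xK] unfolding at by (auto intro!: derivative_eq_intros)
    then show ?thesis
      by (rule has_derivative_transform_within_open[OF _ open_interior x])
        (simp add: pq(3) subsetD[OF interior_subset] flip: Complex_eq)
  qed
  define G where "G j x = complex_of_real (inner (gp x) (axis j 1)) + \<i> * complex_of_real (inner (gq x) (axis j 1))" for j x
  have "continuous_on K (G j)" for j unfolding G_def by (intro continuous_intros g)
  moreover have "u differentiable (at x)" "partial_deriv j u x = G j x" if "x \<in> interior K" for x j
    using der[OF that] frechet_derivative_at[OF der[OF that], symmetric] 
    by (auto simp: partial_deriv_def G_def differentiable_def)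
  ultimately show ?thesis by blast
qed

lemma set_integrable_continuous:
  fixes f :: "real^'d \<Rightarrow> complex"
  assumes "compact K" "continuous_on K f" "D \<in> sets lebesgue" "D \<subseteq> K"
  shows "set_integrable lebesgue D f"
proof -
  have "integrable lborel (\<lambda>x. indicator K x *\<^sub>R f x)" using assms by (intro borel_integrable_compact)
  then have "set_integrable lebesgue K f"
    unfolding set_integrable_def by (subst integrable_completion) auto
  then show ?thesis using assms(3,4) by (rule set_integrable_subset)
qed

text \<open>The integrand is continuous up to the boundary on each open element. On the skeleton the
  partial derivatives may be arbitrary values, but only on a null set.\<close>

lemma grad_integrable:
  assumes u: "u \<in> Vh S" and v: "v \<in> Vh S" and D: "D \<in> sets lebesgue" "D \<subseteq> closure (dom S)"
  shows "set_integrable lebesgue D (\<lambda>x. \<Sum>j\<in>UNIV. partial_deriv j u x * cnj (partial_deriv j v x))" (is "set_integrable _ _ ?f")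
proof -
  have K: "set_integrable lebesgue (interior K) ?f" if K: "K \<in> mesh S" for K
  proof -
    obtain G where G: "\<And>j. continuous_on K (G j)" "\<And>j x. x \<in> interior K \<Longrightarrow> partial_deriv j u x = G j x"
      using Vh_element[OF u K] by blast
    obtain G' where G': "\<And>j. continuous_on K (G' j)" "\<And>j x. x \<in> interior K \<Longrightarrow> partial_deriv j v x = G' j x"
      using Vh_element[OF v K] by blast
    have "set_integrable lebesgue (interior K) (\<lambda>x. \<Sum>j\<in>UNIV. G j x * cnj (G' j x))"
      by (rule set_integrable_continuous[OF element(1)[OF K]])
        (auto intro!: continuous_intros G(1) G'(1) interior_subset)
    then show ?thesis
      by (subst set_integrable_cong[OF refl refl, of _ _ "\<lambda>x. \<Sum>j\<in>UNIV. G j x * cnj (G' j x)"]) (auto simp: G(2) G'(2))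
  qed
  have "set_integrable lebesgue (\<Union>K\<in>mesh S. interior K) ?f"
    using mesh(1) K by (intro set_integrable_UN) auto
  then have "set_integrable lebesgue (closure (dom S)) ?f"
  proof (rule absolutely_integrable_spike_set)
    show "negligible {x \<in> closure (dom S) - (\<Union>K\<in>mesh S. interior K). ?f x \<noteq> 0}"
      by (rule negligible_subset[OF negligible_skeleton]) auto
    have "(\<Union>K\<in>mesh S. interior K) \<subseteq> closure (dom S)" using element(4) interior_subset by blast
    then have "{x \<in> (\<Union>K\<in>mesh S. interior K) - closure (dom S). ?f x \<noteq> 0} = {}" by blast
    then show "negligible {x \<in> (\<Union>K\<in>mesh S. interior K) - closure (dom S). ?f x \<noteq> 0}"
      by (simp only: negligible_empty)
  qed
  then show ?thesis using D by (rule set_integrable_subset)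
qed

lemma Vh_continuous: "u \<in> Vh S \<Longrightarrow> continuous_on (closure (dom S)) u"
  by (simp add: Vh_def)

lemma mass_integrable:
  assumes "u \<in> Vh S" "v \<in> Vh S" "D \<in> sets lebesgue" "D \<subseteq> closure (dom S)"
  shows "set_integrable lebesgue D (\<lambda>x. u x * cnj (v x))"
  by (rule set_integrable_continuous[OF compact_closure_dom _ assms(3,4)])
    (intro continuous_intros Vh_continuous assms)

lemma Vh_add: assumes "u \<in> Vh S" "w \<in> Vh S" shows "(\<lambda>x. u x + w x) \<in> Vh S"
proof -
  have "\<exists>p\<in>local_space S K. \<exists>q\<in>local_space S K. \<forall>x\<in>K. u x + w x = Complex (p x) (q x)" if K: "K \<in> mesh S" for K
  proof -
    obtain p q where pq: "p \<in> local_space S K" "q \<in> local_space S K" "\<And>x. x \<in> K \<Longrightarrow> u x = Complex (p x) (q x)"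
      by (rule Vh_on_element[OF assms(1) K]) (rule that)
    obtain p' q' where pq': "p' \<in> local_space S K" "q' \<in> local_space S K" "\<And>x. x \<in> K \<Longrightarrow> w x = Complex (p' x) (q' x)"
      by (rule Vh_on_element[OF assms(2) K]) (rule that)
    show ?thesis
      using local_space_lincomb[OF K pq(1) pq'(1), of 1 1] local_space_lincomb[OF K pq(2) pq'(2), of 1 1]
      by - (rule bexI[of _ "\<lambda>x. 1 * p x + 1 * p' x"], rule bexI[of _ "\<lambda>x. 1 * q x + 1 * q' x"],
          auto simp: pq pq' complex_eq_iff)
  qed
  then show ?thesis using assms by (auto simp: Vh_def intro!: continuous_intros)
qed

lemma Vh_scale: assumes "u \<in> Vh S" shows "(\<lambda>x. c * u x) \<in> Vh S"
proof -
  have "\<exists>p\<in>local_space S K. \<exists>q\<in>local_space S K. \<forall>x\<in>K. c * u x = Complex (p x) (q x)" if K: "K \<in> mesh S" for K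
  proof -
    obtain p q where pq: "p \<in> local_space S K" "q \<in> local_space S K" "\<And>x. x \<in> K \<Longrightarrow> u x = Complex (p x) (q x)"
      by (rule Vh_on_element[OF assms K]) (rule that)
    have "(\<lambda>x. Re c * p x + (- Im c) * q x) \<in> local_space S K" "(\<lambda>x. Re c * q x + Im c * p x) \<in> local_space S K"
      by (rule local_space_lincomb[OF K pq(1) pq(2)], rule local_space_lincomb[OF K pq(2) pq(1)])
    then show ?thesis
      by - (rule bexI[of _ "\<lambda>x. Re c * p x + (- Im c) * q x"], rule bexI[of _ "\<lambda>x. Re c * q x + Im c * p x"],
          auto simp: pq complex_eq_iff)
  qed
  then show ?thesis using assms by (auto simp: Vh_def intro!: continuous_intros)
qed

lemma Vh_zero: "(\<lambda>x. 0) \<in> Vh S"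
proof -
  show ?thesis by (auto simp: Vh_def complex_eq_iff intro!: bexI[of _ "\<lambda>x. 0"] local_space(1))
qed

lemma Vh_sum: "(\<And>r. r \<in> A \<Longrightarrow> u r \<in> Vh S) \<Longrightarrow> (\<lambda>x. \<Sum>r\<in>A. u r x) \<in> Vh S"
  by (induction A rule: infinite_finite_induct) (auto simp: Vh_zero intro: Vh_add)

section \<open>Sesquilinearity of the forms\<close>

lemma partial_deriv_lincomb:
  assumes u: "u \<in> Vh S" and w: "w \<in> Vh S" and K: "K \<in> mesh S" "x \<in> interior K"
  shows "partial_deriv j (\<lambda>x. u x + w x) x = partial_deriv j u x + partial_deriv j w x"
    and "partial_deriv j (\<lambda>x. c * u x) x = c * partial_deriv j u x"
proof -
  have d: "(u has_derivative frechet_derivative u (at x)) (at x)" "(w has_derivative frechet_derivative w (at x)) (at x)"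
    using Vh_element[OF u K(1)] Vh_element[OF w K(1)] K(2) frechet_derivative_works by blast+
  show "partial_deriv j (\<lambda>x. u x + w x) x = partial_deriv j u x + partial_deriv j w x"
    unfolding partial_deriv_def frechet_derivative_at[OF has_derivative_add[OF d], symmetric] ..
  show "partial_deriv j (\<lambda>x. c * u x) x = c * partial_deriv j u x"
    unfolding partial_deriv_def frechet_derivative_at[OF has_derivative_mult_right[OF d(1)], symmetric] ..
qed

lemma integral_off_skeleton:
  fixes f g :: "real^'d \<Rightarrow> complex"
  assumes D: "D \<subseteq> closure (dom S)" and "set_integrable lebesgue D f" "set_integrable lebesgue D g"
    and eq: "\<And>K x. K \<in> mesh S \<Longrightarrow> x \<in> interior K \<Longrightarrow> f x = g x"
  shows "set_lebesgue_integral lebesgue D f = set_lebesgue_integral lebesgue D g"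
proof -
  have "integral D f = integral D g"
    by (rule integral_spike[OF negligible_skeleton]) (use D eq in auto)
  then show ?thesis using assms by (simp add: set_lebesgue_integral_eq_integral)
qed

lemma sesquilinear_grad_int:
  assumes D: "D \<in> sets lebesgue" "D \<subseteq> closure (dom S)"
  shows "sesquilinear_on (Vh S) (grad_int D)"
proof (rule hermitian_sesquilinear_on)
  fix u w v assume V: "u \<in> Vh S" "w \<in> Vh S" "v \<in> Vh S"
  note int = grad_integrable[OF _ V(3) D]
  show "grad_int D (\<lambda>x. u x + w x) v = grad_int D u v + grad_int D w v"
    unfolding grad_int_def set_integral_add(2)[OF int[OF V(1)] int[OF V(2)], symmetric]
    by (rule integral_off_skeleton[OF D(2) int[OF Vh_add[OF V(1,2)]] set_integral_add(1)[OF int[OF V(1)] int[OF V(2)]]])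
      (simp add: partial_deriv_lincomb(1)[OF V(1,2)] distrib_right sum.distrib)
next
  fix u v c assume V: "u \<in> Vh S" "v \<in> Vh S"
  note int = grad_integrable[OF _ V(2) D]
  show "grad_int D (\<lambda>x. c * u x) v = c * grad_int D u v"
    unfolding grad_int_def set_integral_mult_right[symmetric]
    by (rule integral_off_skeleton[OF D(2) int[OF Vh_scale[OF V(1)]] set_integrable_mult_right[OF int[OF V(1)]]])
      (simp add: partial_deriv_lincomb(2)[OF V(1) V(1)] sum_distrib_left mult.assoc)
qed (rule grad_int_cnj)

lemma sesquilinear_mass_int:
  assumes D: "D \<in> sets lebesgue" "D \<subseteq> closure (dom S)"
  shows "sesquilinear_on (Vh S) (mass_int D)"
proof (rule hermitian_sesquilinear_on)
  fix u w v assume V: "u \<in> Vh S" "w \<in> Vh S" "v \<in> Vh S"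
  note int = mass_integrable[OF _ V(3) D]
  show "mass_int D (\<lambda>x. u x + w x) v = mass_int D u v + mass_int D w v"
    unfolding mass_int_def set_integral_add(2)[OF int[OF V(1)] int[OF V(2)], symmetric]
    by (simp add: distrib_right)
next
  show "mass_int D (\<lambda>x. c * u x) v = c * mass_int D u v" for u v c
    unfolding mass_int_def set_integral_mult_right[symmetric] by (simp add: mult.assoc)
qed (rule mass_int_cnj)

lemma facet:
  assumes F: "F facet_of closure (dom S)"
  shows "compact F" "F \<noteq> {}" "aff_dim F = DIM(real^'d) - 1" "F \<subseteq> closure (dom S)" "F \<subseteq> frontier (dom S)"
proof -
  have int: "interior (closure (dom S)) = dom S"
    using convex_interior_closure[OF domain(3)] interior_open[OF domain(1)] by simp
  then have "aff_dim (closure (dom S)) = DIM(real^'d)"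
    using domain(4) aff_dim_nonempty_interior by metis
  then show "F \<noteq> {}" "aff_dim F = DIM(real^'d) - 1" using F by (auto simp: facet_of_def)
  show sub: "F \<subseteq> closure (dom S)" using F facet_of_imp_subset by blast
  have face: "F face_of closure (dom S)" "F \<noteq> closure (dom S)"
    using F facet_of_imp_face_of facet_of_irrefl by blast+
  show "compact F"
    using face(1) compact_closure_dom domain(5) face_of_imp_compact polytope_imp_convex by blast
  have "F \<inter> dom S = {}" using face_of_disjoint_interior[OF face] int by simp
  then show "F \<subseteq> frontier (dom S)"
    using sub interior_open[OF domain(1)] by (auto simp: frontier_def)
qed

lemma bnd_integrable:
  assumes u: "u \<in> Vh S" and v: "v \<in> Vh S" and F: "F facet_of closure (dom S)" and A: "closed A"
  shows "set_integrable (facet_measure F) (A \<inter> F) (\<lambda>x. u x * cnj (v x))"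
proof -
  interpret finite_measure "facet_measure F" using finite_measure_facet facet[OF F] by blast
  have comp: "compact (A \<inter> F)" using A facet(1)[OF F] by (rule closed_Int_compact)
  have "continuous_on (closure (dom S)) (\<lambda>x. u x * cnj (v x))"
    by (intro continuous_on_mult continuous_on_cnj Vh_continuous u v)
  then have cont: "continuous_on (A \<inter> F) (\<lambda>x. u x * cnj (v x))"
    by (rule continuous_on_subset) (use facet(4)[OF F] in auto)
  then have "bounded ((\<lambda>x. u x * cnj (v x)) ` (A \<inter> F))"
    using comp compact_continuous_image compact_imp_bounded by blast
  then obtain B where B: "B > 0" "\<And>x. x \<in> A \<inter> F \<Longrightarrow> cmod (u x * cnj (v x)) \<le> B"
    unfolding bounded_pos by blast
  have "(\<lambda>x. indicator (A \<inter> F) x *\<^sub>R (u x * cnj (v x))) \<in> borel_measurable borel"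
    by (rule borel_measurable_continuous_on_indicator[OF borel_closed[OF compact_imp_closed[OF comp]] cont])
  then have "(\<lambda>x. indicator (A \<inter> F) x *\<^sub>R (u x * cnj (v x))) \<in> borel_measurable (facet_measure F)"
    by simp
  moreover have "cmod (indicator (A \<inter> F) x *\<^sub>R (u x * cnj (v x))) \<le> B" for x
    using B by (cases "x \<in> A \<inter> F") (auto simp: indicator_def)
  ultimately show ?thesis unfolding set_integrable_def by (intro integrable_const_bound[of _ B]) auto
qed

lemma sesquilinear_bnd_form: "sesquilinear_on (Vh S) (bnd_form S D)"
proof (rule hermitian_sesquilinear_on)
  fix u w v assume V: "u \<in> Vh S" "w \<in> Vh S" "v \<in> Vh S"
  have cl: "closed (frontier D \<inter> frontier (dom S))" by auto
  show "bnd_form S D (\<lambda>x. u x + w x) v = bnd_form S D u v + bnd_form S D w v"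
    unfolding bnd_form_def boundary_int_def sum.distrib[symmetric]
    by (intro sum.cong refl, subst set_integral_add(2)[symmetric])
      (auto intro!: bnd_integrable V cl simp: distrib_right)
next
  show "bnd_form S D (\<lambda>x. c * u x) v = c * bnd_form S D u v" for u v c
    unfolding bnd_form_def boundary_int_def sum_distrib_left set_integral_mult_right[symmetric]
    by (simp add: mult.assoc)
qed (rule bnd_form_cnj)

lemma b_form_alt: "b_form S D u v = (grad_int D u v + (- (complex_of_real (wavenumber S))\<^sup>2) * mass_int D u v) +
    (\<i> * complex_of_real (wavenumber S)) * bnd_form S D u v"
  by (simp add: b_form_def bnd_form_def)

lemma sesquilinear_b_form:
  assumes "D \<in> sets lebesgue" "D \<subseteq> closure (dom S)"
  shows "sesquilinear_on (Vh S) (b_form S D)"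
  unfolding b_form_alt[abs_def]
  by (intro sesquilinear_on_linear_combination sesquilinear_grad_int sesquilinear_mass_int sesquilinear_bnd_form assms)

lemma sesquilinear_H_form:
  assumes "D \<in> sets lebesgue" "D \<subseteq> closure (dom S)"
  shows "sesquilinear_on (Vh S) (H_form S D)"
  unfolding H_form_def[abs_def]
  by (intro sesquilinear_on_linear_combination sesquilinear_grad_int sesquilinear_mass_int assms)

section \<open>Splitting the forms over the subdomains\<close>

lemma subdomain_sets: 
  assumes "i < nsub S" shows "sub S i \<in> sets lebesgue" "sub S i \<subseteq> closure (dom S)"
  using subdomain(1,3)[OF assms] closure_subset by (auto intro: borel_open)

lemma dom_sets: "dom S \<in> sets lebesgue" "dom S \<subseteq> closure (dom S)"
  using domain(1) closure_subset by (auto intro: borel_open)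

lemma integral_subdomains:
  fixes f :: "real^'d \<Rightarrow> complex"
  assumes "\<And>D. D \<in> sets lebesgue \<Longrightarrow> D \<subseteq> closure (dom S) \<Longrightarrow> set_integrable lebesgue D f"
  shows "set_lebesgue_integral lebesgue (dom S) f = (\<Sum>i<nsub S. set_lebesgue_integral lebesgue (sub S i) f)"
proof -
  let ?U = "\<Union>i<nsub S. sub S i"
  have U: "?U \<in> sets lebesgue" "?U \<subseteq> closure (dom S)" using subdomain_sets by auto
  have "?U \<subseteq> dom S" using subdomain(3) by blast
  then have "{x \<in> ?U - dom S. f x \<noteq> 0} = {}" by blast
  then have "integral (dom S) f = integral ?U f"
    by (intro integral_spike_set) (auto intro: negligible_subset[OF negligible_outside_subdomains])
  then have "set_lebesgue_integral lebesgue (dom S) f = set_lebesgue_integral lebesgue ?U f"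
    using assms[OF U] assms[OF dom_sets] by (simp add: set_lebesgue_integral_eq_integral)
  also have "\<dots> = (\<Sum>i<nsub S. set_lebesgue_integral lebesgue (sub S i) f)"
    using subdomain_sets assms subdomains_disjoint
    by (intro set_integral_finite_Union) (auto simp: disjoint_family_on_def)
  finally show ?thesis .
qed

text \<open>Both closures are finite unions of elements. The interior of each element lies in its
  own subdomain, so two elements from different subdomains are distinct and
  \<open>common_face_dim\<close> bounds their overlap on the facet. Finitely many such overlaps have
  surface measure 0.\<close>

lemma AE_facet_subdomains_disjoint:
  assumes F: "F facet_of closure (dom S)" and ij: "i < nsub S" "j < nsub S" "i \<noteq> j"
  shows "AE x in facet_measure F. \<not> (x \<in> closure (sub S i) \<inter> F \<and> x \<in> closure (sub S j) \<inter> F)"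
proof -
  obtain T where T: "T \<subseteq> mesh S" "closure (sub S i) = \<Union>T" using subdomain(4)[OF ij(1)] by blast
  obtain T' where T': "T' \<subseteq> mesh S" "closure (sub S j) = \<Union>T'" using subdomain(4)[OF ij(2)] by blast
  have fin: "finite T" "finite T'" using T T' mesh(1) finite_subset by blast+
  have "AE x in facet_measure F. x \<notin> K \<inter> K' \<inter> F" if K: "K \<in> T" and K': "K' \<in> T'" for K K'
  proof -
    have m: "K \<in> mesh S" "K' \<in> mesh S" using K K' T T' by blast+
    have "interior K \<subseteq> interior (\<Union>T)" "interior K' \<subseteq> interior (\<Union>T')"
      using K K' by (auto intro!: interior_mono)
    then have "interior K \<subseteq> sub S i" "interior K' \<subseteq> sub S j"
      using subdomain(2)[OF ij(1)] subdomain(2)[OF ij(2)] T(2) T'(2) by simp_all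
    then have "K \<noteq> K'" using element(3)[OF m(1)] subdomains_disjoint[OF ij] by blast
    then have "aff_dim (K \<inter> K' \<inter> F) < DIM(real^'d) - 1"
      using common_face_dim[of K "closure (dom S)" K' F] element m elements_common_face[OF m] F
        polytope_imp_polyhedron[OF domain(5)] by blast
    moreover have "closed (K \<inter> K' \<inter> F)"
      by (intro closed_Int compact_imp_closed element(1) m facet(1)[OF F])
    ultimately show ?thesis
      using AE_facet_measure_lowdim[OF facet(1,2,3)[OF F], of "K \<inter> K' \<inter> F"] by blast
  qed
  then have "AE x in facet_measure F. \<forall>K\<in>T. \<forall>K'\<in>T'. x \<notin> K \<inter> K' \<inter> F"
    using fin by (intro AE_finite_allI) auto
  then show ?thesis by eventually_elim (auto simp: T T')
qed

lemma bnd_form_subdomains: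
  assumes u: "u \<in> Vh S" and v: "v \<in> Vh S"
  shows "bnd_form S (dom S) u v = (\<Sum>i<nsub S. bnd_form S (sub S i) u v)"
proof -
  let ?f = "\<lambda>x. u x * cnj (v x)"
  have "set_lebesgue_integral (facet_measure F) (frontier (dom S) \<inter> frontier (dom S) \<inter> F) ?f =
      (\<Sum>i<nsub S. set_lebesgue_integral (facet_measure F) (frontier (sub S i) \<inter> frontier (dom S) \<inter> F) ?f)"
    if F: "F facet_of closure (dom S)" for F
  proof -
    have "frontier (dom S) \<inter> F \<subseteq> (\<Union>i<nsub S. frontier (sub S i) \<inter> frontier (dom S) \<inter> F)"
    proof
      fix x assume x: "x \<in> frontier (dom S) \<inter> F"
      then have "x \<in> closure (dom S)" by (simp add: frontier_def)
      then obtain i where i: "i < nsub S" "x \<in> closure (sub S i)" using closure_dom_subdomains by blast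
      have "x \<notin> sub S i" using x subdomain(3)[OF i(1)] interior_open[OF domain(1)] by (auto simp: frontier_def)
      then show "x \<in> (\<Union>i<nsub S. frontier (sub S i) \<inter> frontier (dom S) \<inter> F)"
        using i x closure_subdomain[OF i(1)] by auto
    qed
    then have eq: "frontier (dom S) \<inter> frontier (dom S) \<inter> F = (\<Union>i<nsub S. frontier (sub S i) \<inter> frontier (dom S) \<inter> F)"
      by blast
    show ?thesis unfolding eq
    proof (rule set_integral_finite_Union_AE)
      show "AE x in facet_measure F. \<not> (x \<in> frontier (sub S i) \<inter> frontier (dom S) \<inter> F \<and> x \<in> frontier (sub S j) \<inter> frontier (dom S) \<inter> F)"
        if "i \<in> {..<nsub S}" "j \<in> {..<nsub S}" "i \<noteq> j" for i j
      proof -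
        have "AE x in facet_measure F. \<not> (x \<in> closure (sub S i) \<inter> F \<and> x \<in> closure (sub S j) \<inter> F)"
          using that by (intro AE_facet_subdomains_disjoint[OF F]) auto
        then show ?thesis by eventually_elim (auto simp: frontier_def)
      qed
      show "set_integrable (facet_measure F) (frontier (sub S i) \<inter> frontier (dom S) \<inter> F) ?f" for i
        by (rule bnd_integrable[OF u v F]) auto
      show "frontier (sub S i) \<inter> frontier (dom S) \<inter> F \<in> sets (facet_measure F)" for i
        by (auto intro!: borel_closed closed_Int compact_imp_closed[OF facet(1)[OF F]])
    qed auto
  qed
  then show ?thesis
    unfolding bnd_form_def boundary_int_def by (subst sum.swap) (auto intro!: sum.cong)
qed

lemma b_form_subdomains:
  assumes "u \<in> Vh S" "v \<in> Vh S"
  shows "b_form S (dom S) u v = (\<Sum>i<nsub S. b_form S (sub S i) u v)"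
  unfolding b_form_alt bnd_form_subdomains[OF assms] sum.distrib sum_distrib_left[symmetric]
  unfolding grad_int_def mass_int_def
  by (simp only: integral_subdomains[OF grad_integrable[OF assms]] integral_subdomains[OF mass_integrable[OF assms]])

lemma H_form_subdomains:
  assumes "u \<in> Vh S" "v \<in> Vh S"
  shows "H_form S (dom S) u v = (\<Sum>i<nsub S. H_form S (sub S i) u v)"
  unfolding H_form_def sum.distrib sum_distrib_left[symmetric] grad_int_def mass_int_def
  by (simp only: integral_subdomains[OF grad_integrable[OF assms]] integral_subdomains[OF mass_integrable[OF assms]])

text \<open>Derivatives are taken inside the open subdomain and traces on its frontier, so values
  beyond the closure do not count.\<close>

lemma local_forms_cong:
  assumes i: "i < nsub S" and eq: "\<And>x. x \<in> closure (sub S i) \<Longrightarrow> u x = u' x" "\<And>x. x \<in> closure (sub S i) \<Longrightarrow> v x = v' x"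
  shows "b_form S (sub S i) u v = b_form S (sub S i) u' v'" "H_form S (sub S i) u v = H_form S (sub S i) u' v'"
proof -
  have in_cl: "x \<in> closure (sub S i)" if "x \<in> sub S i" for x using that closure_subset by blast
  have pd: "partial_deriv j u x = partial_deriv j u' x" "partial_deriv j v x = partial_deriv j v' x" if "x \<in> sub S i" for j x
    using that eq in_cl by (auto intro!: partial_deriv_cong_open[OF subdomain(1)[OF i]])
  have g: "grad_int (sub S i) u v = grad_int (sub S i) u' v'"
    unfolding grad_int_def by (rule set_lebesgue_integral_cong) (use subdomain_sets[OF i] pd in auto)
  have m: "mass_int (sub S i) u v = mass_int (sub S i) u' v'"
    unfolding mass_int_def by (rule set_lebesgue_integral_cong) (use subdomain_sets[OF i] eq in_cl in auto)
  have "bnd_form S (sub S i) u v = bnd_form S (sub S i) u' v'"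
    unfolding bnd_form_def boundary_int_def
  proof (intro sum.cong refl set_lebesgue_integral_cong)
    show "frontier (sub S i) \<inter> frontier (dom S) \<inter> F \<in> sets (facet_measure F)" if "F \<in> {F. F facet_of closure (dom S)}" for F
      using that compact_imp_closed[OF facet(1)[of F]] by auto
  qed (use eq in \<open>auto simp: frontier_def\<close>)
  with g m show "b_form S (sub S i) u v = b_form S (sub S i) u' v'" "H_form S (sub S i) u v = H_form S (sub S i) u' v'"
    by (simp_all add: b_form_alt H_form_def)
qed

end

subsection \<open>Nodal vectors\<close>

lemma numbering:
  assumes "finite A"
  shows "distinct (numbering A)" "set (numbering A) = A" "length (numbering A) = card A"
proof -
  have "\<exists>xs. distinct xs \<and> set xs = A" using finite_distinct_list[OF assms] by blast
  from someI_ex[OF this] show "distinct (numbering A)" "set (numbering A) = A"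
    by (simp_all add: numbering_def)
  then show "length (numbering A) = card A" using distinct_card by force
qed

lemma numbering_bij: "finite A \<Longrightarrow> bij_betw (\<lambda>r. numbering A ! r) {..<card A} A"
  using bij_betw_nth[of "numbering A" "{..<card A}" A] numbering[of A] by simp

lemma numbering_nth: "finite A \<Longrightarrow> r < card A \<Longrightarrow> numbering A ! r \<in> A"
  using numbering_bij[of A] by (auto simp: bij_betw_def)

text \<open>The inverse of the numbering: the entry belonging to node \<open>y\<close>, and 0 if
  \<open>y\<close> is not a node of \<open>Y\<close>. It turns sums over matrix indices into sums
  over nodes, independent of the chosen order.\<close>

definition coeff_at :: "'a set \<Rightarrow> complex Matrix.vec \<Rightarrow> 'a \<Rightarrow> complex" where
  "coeff_at Y x y = (\<Sum>r<card Y. if numbering Y ! r = y then x $ r else 0)"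

lemma coeff_at_numbering:
  assumes "finite Y" "r < card Y"
  shows "coeff_at Y x (numbering Y ! r) = x $ r"
proof -
  have "numbering Y ! s = numbering Y ! r \<longleftrightarrow> s = r" if "s < card Y" for s
    using that assms numbering[OF assms(1)] by (simp add: nth_eq_iff_index_eq)
  then have "coeff_at Y x (numbering Y ! r) = (\<Sum>s<card Y. if s = r then x $ s else 0)"
    unfolding coeff_at_def by (intro sum.cong) auto
  then show ?thesis using assms(2) by simp
qed

lemma coeff_at_outside: "finite Y \<Longrightarrow> y \<notin> Y \<Longrightarrow> coeff_at Y x y = 0"
  unfolding coeff_at_def using numbering_nth by (intro sum.neutral) fastforce

lemma restriction_carrier: "restriction X Y \<in> carrier_mat (card X) (card Y)"
  by (simp add: restriction_def)

lemma restriction_index: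
  assumes "dim_vec x = card Y" "r < card X"
  shows "(restriction X Y *\<^sub>v x) $ r = coeff_at Y x (numbering X ! r)"
  using assms by (auto simp: restriction_def scalar_prod_def coeff_at_def atLeast0LessThan intro!: sum.cong)

lemma transpose_restriction_index:
  assumes "dim_vec x = card X" "s < card Y"
  shows "((restriction X Y)\<^sup>T *\<^sub>v x) $ s = coeff_at X x (numbering Y ! s)"
  using assms by (auto simp: restriction_def scalar_prod_def coeff_at_def atLeast0LessThan intro!: sum.cong)

definition expand :: "('d::finite, 'z) fe_decomposition_scheme \<Rightarrow> (real^'d) set \<Rightarrow> complex Matrix.vec \<Rightarrow> real^'d \<Rightarrow> complex" where
  "expand S X x t = (\<Sum>r<dim_vec x. x $ r * nodal_cfun S (numbering X ! r) t)"

lemma expand_fun: "expand S X x = (\<lambda>t. \<Sum>r<dim_vec x. x $ r * nodal_cfun S (numbering X ! r) t)"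
  by (simp add: expand_def fun_eq_iff)

lemma fe_function_expand: "fe_function S a b = (\<lambda>t. expand S (all_\<Gamma>_nodes S) a t + expand S (all_I_nodes S) b t)"
  by (simp add: fe_function_def expand_def fun_eq_iff)

lemma expand_coeff_at:
  assumes "finite X" "dim_vec x = card X"
  shows "expand S X x t = (\<Sum>y\<in>X. coeff_at X x y * nodal_cfun S y t)"
proof -
  have "expand S X x t = (\<Sum>r<card X. coeff_at X x (numbering X ! r) * nodal_cfun S (numbering X ! r) t)"
    using assms by (simp add: expand_def coeff_at_numbering)
  also have "\<dots> = (\<Sum>y\<in>X. coeff_at X x y * nodal_cfun S y t)"
    by (rule sum.reindex_bij_betw[OF numbering_bij[OF assms(1)]])
  finally show ?thesis .
qed

context fe_space
begin

lemma finite_nodes: "finite (nodes S)" and nodes_closure: "nodes S \<subseteq> closure (dom S)"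
  using fe by (auto simp: fe_setting_def nodal_fe_space_def)

lemma nodal_cfun_Vh: "y \<in> nodes S \<Longrightarrow> nodal_cfun S y \<in> Vh S"
  using fe unfolding fe_setting_def nodal_fe_space_def nodal_cfun_def[abs_def] by blast

lemma nodal_cfun_nodes: "y \<in> nodes S \<Longrightarrow> x \<in> nodes S \<Longrightarrow> nodal_cfun S y x = (if x = y then 1 else 0)"
  using fe unfolding fe_setting_def nodal_fe_space_def nodal_cfun_def by simp

lemma unisolvent:
  assumes "K \<in> mesh S" "p \<in> local_space S K" "\<And>x. x \<in> nodes S \<inter> K \<Longrightarrow> p x = 0" "x \<in> K"
  shows "p x = 0"
proof -
  have "\<forall>K\<in>mesh S. \<forall>F. F face_of K \<longrightarrow>
      (\<forall>p\<in>local_space S K. (\<forall>x\<in>nodes S \<inter> F. p x = 0) \<longrightarrow> (\<forall>x\<in>F. p x = 0))"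
    using fe unfolding fe_setting_def nodal_fe_space_def by (elim conjE) assumption
  moreover have "K face_of K" using element(2)[OF assms(1)] by (rule face_of_refl)
  ultimately show ?thesis using assms by blast
qed

lemma Vh_zero_on_element:
  assumes v: "v \<in> Vh S" and K: "K \<in> mesh S" and "\<And>y. y \<in> nodes S \<inter> K \<Longrightarrow> v y = 0" and t: "t \<in> K"
  shows "v t = 0"
proof -
  obtain p q where pq: "p \<in> local_space S K" "q \<in> local_space S K" "\<And>x. x \<in> K \<Longrightarrow> v x = Complex (p x) (q x)"
    by (rule Vh_on_element[OF v K]) (rule that)
  have "p y = 0" "q y = 0" if "y \<in> nodes S \<inter> K" for y
    using that assms(3)[OF that] pq(3)[of y] by (auto simp: complex_eq_iff)
  then have "p t = 0" "q t = 0" using unisolvent[OF K] pq(1,2) t by blast+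
  then show ?thesis using pq(3)[OF t] by (simp add: complex_eq_iff)
qed

text \<open>The difference of the two sides vanishes at every node, hence on each element by
  unisolvence, and off the closed domain by the extension by zero.\<close>

lemma nodal_expansion:
  assumes v: "v \<in> Vh S"
  shows "v t = (\<Sum>y\<in>nodes S. v y * nodal_cfun S y t)"
proof -
  define w where "w t = v t + (-1) * (\<Sum>y\<in>nodes S. v y * nodal_cfun S y t)" for t
  have w: "w \<in> Vh S"
    unfolding w_def by (intro Vh_add[OF v] Vh_scale Vh_sum nodal_cfun_Vh)
  have node: "w y = 0" if "y \<in> nodes S" for y
  proof -
    have "(\<Sum>x\<in>nodes S. v x * nodal_cfun S x y) = (\<Sum>x\<in>nodes S. if x = y then v x else 0)"
      using that by (intro sum.cong) (auto simp: nodal_cfun_nodes)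
    then show ?thesis using that finite_nodes by (simp add: w_def)
  qed
  have "w t = 0"
  proof (cases "t \<in> closure (dom S)")
    case True
    then obtain K where "K \<in> mesh S" "t \<in> K" using mesh(2) by blast
    then show ?thesis using Vh_zero_on_element[OF w] node by blast
  next
    case False
    then show ?thesis using w by (simp add: Vh_def)
  qed
  then show ?thesis by (simp add: w_def)
qed

text \<open>All nodes of an element of the subdomain differ from \<open>y\<close>, so the basis
  function vanishes at each of them and, by unisolvence, on the whole element.\<close>

lemma nodal_cfun_local:
  assumes i: "i < nsub S" and y: "y \<in> nodes S" "y \<notin> closure (sub S i)" and t: "t \<in> closure (sub S i)"
  shows "nodal_cfun S y t = 0"
proof -
  obtain T where T: "T \<subseteq> mesh S" "closure (sub S i) = \<Union>T" using subdomain(4)[OF i] by blast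
  then obtain K where K: "K \<in> T" "t \<in> K" using t by blast
  show ?thesis
  proof (rule Vh_zero_on_element[OF nodal_cfun_Vh[OF y(1)] _ _ K(2)])
    show "K \<in> mesh S" using K T by blast
    show "nodal_cfun S y x = 0" if "x \<in> nodes S \<inter> K" for x
      using that K T y by (subst nodal_cfun_nodes) auto
  qed
qed

lemma interior_not_frontier: "i < nsub S \<Longrightarrow> j < nsub S \<Longrightarrow> sub S i \<inter> frontier (sub S j) = {}"
  using subdomains_disjoint[of i j] subdomain(1)[of i] open_Int_closure_eq_empty[of "sub S i" "sub S j"]
  by (cases "i = j") (auto simp: frontier_def interior_open)

lemma nodes_finite: "finite (\<Gamma>_nodes S i)" "finite (I_nodes S i)" "finite (all_\<Gamma>_nodes S)" "finite (all_I_nodes S)"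
  using finite_nodes by (auto simp: \<Gamma>_nodes_def I_nodes_def all_\<Gamma>_nodes_def all_I_nodes_def)

lemma nodes_subset: "\<Gamma>_nodes S i \<subseteq> nodes S" "I_nodes S i \<subseteq> nodes S" "all_\<Gamma>_nodes S \<subseteq> nodes S" "all_I_nodes S \<subseteq> nodes S"
  by (auto simp: \<Gamma>_nodes_def I_nodes_def all_\<Gamma>_nodes_def all_I_nodes_def)

lemma local_nodes_subset:
  "i < nsub S \<Longrightarrow> \<Gamma>_nodes S i \<subseteq> all_\<Gamma>_nodes S" "i < nsub S \<Longrightarrow> I_nodes S i \<subseteq> all_I_nodes S"
  by (auto simp: all_\<Gamma>_nodes_def all_I_nodes_def)

lemma nodes_partition: "nodes S = all_\<Gamma>_nodes S \<union> all_I_nodes S" "all_\<Gamma>_nodes S \<inter> all_I_nodes S = {}"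
proof -
  have "nodes S \<subseteq> (\<Union>i<nsub S. sub S i \<union> frontier (sub S i))"
    using nodes_closure closure_dom_subdomains closure_subdomain by auto
  then show "nodes S = all_\<Gamma>_nodes S \<union> all_I_nodes S"
    by (auto simp: \<Gamma>_nodes_def I_nodes_def all_\<Gamma>_nodes_def all_I_nodes_def)
  show "all_\<Gamma>_nodes S \<inter> all_I_nodes S = {}"
    using interior_not_frontier by (fastforce simp: \<Gamma>_nodes_def I_nodes_def all_\<Gamma>_nodes_def all_I_nodes_def)
qed

lemma nonlocal_nodes:
  assumes i: "i < nsub S"
  shows "y \<in> all_\<Gamma>_nodes S - \<Gamma>_nodes S i \<Longrightarrow> y \<notin> closure (sub S i)"
    and "y \<in> all_I_nodes S - I_nodes S i \<Longrightarrow> y \<notin> closure (sub S i)"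
proof -
  show "y \<notin> closure (sub S i)" if y: "y \<in> all_\<Gamma>_nodes S - \<Gamma>_nodes S i"
    using y i interior_not_frontier closure_subdomain[OF i] by (fastforce simp: \<Gamma>_nodes_def all_\<Gamma>_nodes_def)
  show "y \<notin> closure (sub S i)" if y: "y \<in> all_I_nodes S - I_nodes S i"
    using y i interior_not_frontier closure_subdomain[OF i] by (fastforce simp: I_nodes_def all_I_nodes_def)
qed

lemma expand_Vh: 
  assumes "X \<subseteq> nodes S" "x \<in> carrier_vec (card X)"
  shows "expand S X x \<in> Vh S"
proof -
  have "finite X" using assms(1) finite_nodes finite_subset by blast
  then show ?thesis
    unfolding expand_def[abs_def] using assms numbering_nth[of X] by (intro Vh_sum Vh_scale nodal_cfun_Vh) auto
qed

lemma fe_function_Vh: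
  "a \<in> carrier_vec (card (all_\<Gamma>_nodes S)) \<Longrightarrow> b \<in> carrier_vec (card (all_I_nodes S)) \<Longrightarrow> fe_function S a b \<in> Vh S"
  unfolding fe_function_expand by (intro Vh_add expand_Vh nodes_subset)

text \<open>The nodes that the restriction discards carry basis functions that vanish on the closed
  subdomain.\<close>

lemma expand_restriction:
  assumes X: "X \<subseteq> Y" "Y \<subseteq> nodes S" and i: "i < nsub S" and loc: "\<And>y. y \<in> Y - X \<Longrightarrow> y \<notin> closure (sub S i)"
    and t: "t \<in> closure (sub S i)" and a: "a \<in> carrier_vec (card Y)"
  shows "expand S Y a t = expand S X (restriction X Y *\<^sub>v a) t"
proof -
  have fin: "finite X" "finite Y"
    using finite_subset[OF X(2) finite_nodes] finite_subset[OF X(1)] by simp_all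
  have "expand S Y a t = (\<Sum>y\<in>Y. coeff_at Y a y * nodal_cfun S y t)"
    using a fin by (intro expand_coeff_at) auto
  also have "\<dots> = (\<Sum>y\<in>X. coeff_at Y a y * nodal_cfun S y t)"
  proof (rule sum.mono_neutral_right[OF fin(2) X(1)], rule ballI)
    show "coeff_at Y a y * nodal_cfun S y t = 0" if "y \<in> Y - X" for y
      using nodal_cfun_local[OF i _ loc[OF that] t] that X(2) by auto
  qed
  also have "\<dots> = (\<Sum>r<card X. coeff_at Y a (numbering X ! r) * nodal_cfun S (numbering X ! r) t)"
    by (rule sum.reindex_bij_betw[OF numbering_bij[OF fin(1)], symmetric])
  also have "\<dots> = expand S X (restriction X Y *\<^sub>v a) t"
    unfolding expand_def dim_mult_mat_vec carrier_matD(1)[OF restriction_carrier]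
    by (intro sum.cong refl) (simp only: restriction_index[OF carrier_vecD[OF a]] lessThan_iff)
  finally show ?thesis .
qed

lemma fe_function_local:
  assumes i: "i < nsub S" and t: "t \<in> closure (sub S i)"
    and a: "a \<in> carrier_vec (card (all_\<Gamma>_nodes S))" and b: "b \<in> carrier_vec (card (all_I_nodes S))"
  shows "fe_function S a b t = expand S (\<Gamma>_nodes S i) (R\<^sub>\<Gamma> S i *\<^sub>v a) t + expand S (I_nodes S i) (R\<^sub>I S i *\<^sub>v b) t"
  unfolding fe_function_expand
  using expand_restriction[OF local_nodes_subset(1)[OF i] nodes_subset(3) i nonlocal_nodes(1)[OF i] t a]
    expand_restriction[OF local_nodes_subset(2)[OF i] nodes_subset(4) i nonlocal_nodes(2)[OF i] t b]
  by simp

lemma Vh_fe_function: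
  assumes v: "v \<in> Vh S"
  obtains a b where "a \<in> carrier_vec (card (all_\<Gamma>_nodes S))" "b \<in> carrier_vec (card (all_I_nodes S))"
    "v = fe_function S a b"
proof -
  define nv where "nv X = Matrix.vec (card X) (\<lambda>r. v (numbering X ! r))" for X
  have nv: "expand S X (nv X) t = (\<Sum>y\<in>X. v y * nodal_cfun S y t)" if "finite X" for X t
    unfolding expand_def nv_def
    using sum.reindex_bij_betw[OF numbering_bij[OF that], of "\<lambda>y. v y * nodal_cfun S y t"] by simp
  have "v t = fe_function S (nv (all_\<Gamma>_nodes S)) (nv (all_I_nodes S)) t" for t
    unfolding fe_function_expand nv[OF nodes_finite(3)] nv[OF nodes_finite(4)]
    using nodal_expansion[OF v, of t] sum.union_disjoint[OF nodes_finite(3,4) nodes_partition(2)]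
    unfolding nodes_partition(1)[symmetric] by simp
  then have "v = fe_function S (nv (all_\<Gamma>_nodes S)) (nv (all_I_nodes S))" by (rule ext)
  moreover have "nv X \<in> carrier_vec (card X)" for X by (simp add: nv_def)
  ultimately show ?thesis using that by blast
qed

section \<open>Forms as matrices acting on nodal vectors\<close>

lemma sesquilinear_sum:
  assumes f: "sesquilinear_on (Vh S) f" and g: "\<And>r. r \<in> A \<Longrightarrow> g r \<in> Vh S" and v: "v \<in> Vh S"
  shows "f (\<lambda>t. \<Sum>r\<in>A. c r * g r t) v = (\<Sum>r\<in>A. c r * f (g r) v)"
    and "f v (\<lambda>t. \<Sum>r\<in>A. c r * g r t) = (\<Sum>r\<in>A. cnj (c r) * f v (g r))"
proof -
  note add = sesquilinear_onD(1)[OF f]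
  note scale = sesquilinear_onD(2)[OF f]
  have 0: "f (\<lambda>t. 0) v = 0" "f v (\<lambda>t. 0) = 0"
    using scale[rule_format, OF v v, of 0] by simp_all
  have "f (\<lambda>t. \<Sum>r\<in>A. c r * g r t) v = (\<Sum>r\<in>A. c r * f (g r) v) \<and>
      f v (\<lambda>t. \<Sum>r\<in>A. c r * g r t) = (\<Sum>r\<in>A. cnj (c r) * f v (g r))"
    using g
  proof (induction A rule: infinite_finite_induct)
    case (insert r A)
    have V: "g r \<in> Vh S" "(\<lambda>t. c r * g r t) \<in> Vh S" "(\<lambda>t. \<Sum>r\<in>A. c r * g r t) \<in> Vh S"
      using insert.prems by (auto intro!: Vh_scale Vh_sum)
    show ?case
      using insert add[rule_format, OF V(2,3) v] scale[rule_format, OF V(1) v, of "c r"] by simp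
  qed (use 0 in auto)
  then show "f (\<lambda>t. \<Sum>r\<in>A. c r * g r t) v = (\<Sum>r\<in>A. c r * f (g r) v)"
    and "f v (\<lambda>t. \<Sum>r\<in>A. c r * g r t) = (\<Sum>r\<in>A. cnj (c r) * f v (g r))" by auto
qed

text \<open>Rows belong to test functions and columns to trial functions, hence the order
  \<open>Y X\<close> in the matrix.\<close>

lemma form_expand:
  assumes f: "sesquilinear_on (Vh S) f" and X: "X \<subseteq> nodes S" and Y: "Y \<subseteq> nodes S"
    and x: "x \<in> carrier_vec (card X)" and y: "y \<in> carrier_vec (card Y)"
  shows "f (expand S X x) (expand S Y y) = (form_matrix S f Y X *\<^sub>v x) \<bullet>c y"
proof -
  have fin: "finite X" "finite Y"
    using finite_subset[OF X finite_nodes] finite_subset[OF Y finite_nodes] by simp_all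
  have gX: "nodal_cfun S (numbering X ! r) \<in> Vh S" if "r \<in> {..<dim_vec x}" for r
    using that x X numbering_nth[OF fin(1)] by (intro nodal_cfun_Vh) auto
  have gY: "nodal_cfun S (numbering Y ! r) \<in> Vh S" if "r \<in> {..<dim_vec y}" for r
    using that y Y numbering_nth[OF fin(2)] by (intro nodal_cfun_Vh) auto
  have "f (expand S X x) (expand S Y y) = (\<Sum>s<dim_vec y. cnj (y $ s) * f (expand S X x) (nodal_cfun S (numbering Y ! s)))"
    using sesquilinear_sum(2)[OF f gY expand_Vh[OF X x]] unfolding expand_fun[of S Y y] .
  also have "\<dots> = (\<Sum>s<dim_vec y. cnj (y $ s) * (\<Sum>r<dim_vec x. x $ r * f (nodal_cfun S (numbering X ! r)) (nodal_cfun S (numbering Y ! s))))"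
    unfolding expand_fun[of S X x]
    using sesquilinear_sum(1)[OF f, of "{..<dim_vec x}" "\<lambda>r. nodal_cfun S (numbering X ! r)", OF gX gY] by simp
  also have "\<dots> = (form_matrix S f Y X *\<^sub>v x) \<bullet>c y"
    using x y by (auto simp: form_matrix_def scalar_prod_def atLeast0LessThan mult.commute intro!: sum.cong)
  finally show ?thesis .
qed

lemma form_matrix_carrier: "form_matrix S f X Y \<in> carrier_mat (card X) (card Y)"
  by (simp add: form_matrix_def)

lemma form_expand_blocks:
  assumes f: "sesquilinear_on (Vh S) f" and X: "X \<subseteq> nodes S" and Y: "Y \<subseteq> nodes S"
    and x: "a \<in> carrier_vec (card X)" "v \<in> carrier_vec (card X)" and y: "b \<in> carrier_vec (card Y)" "w \<in> carrier_vec (card Y)"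
  shows "f (\<lambda>t. expand S X a t + expand S Y b t) (\<lambda>t. expand S X v t + expand S Y w t) =
    (form_matrix S f X X *\<^sub>v a + form_matrix S f X Y *\<^sub>v b) \<bullet>c v +
    (form_matrix S f Y X *\<^sub>v a + form_matrix S f Y Y *\<^sub>v b) \<bullet>c w"
proof -
  note add = sesquilinear_onD(1)[OF f]
  note V = expand_Vh[OF X x(1)] expand_Vh[OF X x(2)] expand_Vh[OF Y y(1)] expand_Vh[OF Y y(2)]
  have "f (\<lambda>t. expand S X a t + expand S Y b t) (\<lambda>t. expand S X v t + expand S Y w t) =
     f (expand S X a) (expand S X v) + f (expand S Y b) (expand S X v) +
     (f (expand S X a) (expand S Y w) + f (expand S Y b) (expand S Y w))"
    using add[rule_format, OF V(1,3) Vh_add[OF V(2,4)]] add[rule_format, OF V(2,4) V(1)] add[rule_format, OF V(2,4) V(3)]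
    by simp
  also have "\<dots> = (form_matrix S f X X *\<^sub>v a) \<bullet>c v + (form_matrix S f X Y *\<^sub>v b) \<bullet>c v +
     ((form_matrix S f Y X *\<^sub>v a) \<bullet>c w + (form_matrix S f Y Y *\<^sub>v b) \<bullet>c w)"
    by (simp only: form_expand[OF f X X x] form_expand[OF f Y X y(1) x(2)] form_expand[OF f X Y x(1) y(2)] form_expand[OF f Y Y y])
  also have "(form_matrix S f X X *\<^sub>v a) \<bullet>c v + (form_matrix S f X Y *\<^sub>v b) \<bullet>c v =
      (form_matrix S f X X *\<^sub>v a + form_matrix S f X Y *\<^sub>v b) \<bullet>c v"
    by (rule add_scalar_prod_distrib[symmetric, of _ "card X"]) (use form_matrix_carrier x y in \<open>auto intro!: mult_mat_vec_carrier\<close>)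
  also have "(form_matrix S f Y X *\<^sub>v a) \<bullet>c w + (form_matrix S f Y Y *\<^sub>v b) \<bullet>c w =
      (form_matrix S f Y X *\<^sub>v a + form_matrix S f Y Y *\<^sub>v b) \<bullet>c w"
    by (rule add_scalar_prod_distrib[symmetric, of _ "card Y"]) (use form_matrix_carrier x y in \<open>auto intro!: mult_mat_vec_carrier\<close>)
  finally show ?thesis .
qed

lemma local_form_fe_function:
  assumes i: "i < nsub S" and a: "a \<in> carrier_vec (card (all_\<Gamma>_nodes S))" "v \<in> carrier_vec (card (all_\<Gamma>_nodes S))"
    and b: "b \<in> carrier_vec (card (all_I_nodes S))" "w \<in> carrier_vec (card (all_I_nodes S))"
  shows "b_form S (sub S i) (fe_function S a b) (fe_function S v w) =
      (B\<^sub>\<Gamma>\<^sub>\<Gamma> S i *\<^sub>v (R\<^sub>\<Gamma> S i *\<^sub>v a) + B\<^sub>\<Gamma>\<^sub>I S i *\<^sub>v (R\<^sub>I S i *\<^sub>v b)) \<bullet>c (R\<^sub>\<Gamma> S i *\<^sub>v v) +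
      (B\<^sub>I\<^sub>\<Gamma> S i *\<^sub>v (R\<^sub>\<Gamma> S i *\<^sub>v a) + B\<^sub>I\<^sub>I S i *\<^sub>v (R\<^sub>I S i *\<^sub>v b)) \<bullet>c (R\<^sub>I S i *\<^sub>v w)"
    and "H_form S (sub S i) (fe_function S a b) (fe_function S v w) =
      (H\<^sub>\<Gamma>\<^sub>\<Gamma> S i *\<^sub>v (R\<^sub>\<Gamma> S i *\<^sub>v a) + H\<^sub>\<Gamma>\<^sub>I S i *\<^sub>v (R\<^sub>I S i *\<^sub>v b)) \<bullet>c (R\<^sub>\<Gamma> S i *\<^sub>v v) +
      (H\<^sub>I\<^sub>\<Gamma> S i *\<^sub>v (R\<^sub>\<Gamma> S i *\<^sub>v a) + H\<^sub>I\<^sub>I S i *\<^sub>v (R\<^sub>I S i *\<^sub>v b)) \<bullet>c (R\<^sub>I S i *\<^sub>v w)"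
proof -
  let ?e = "\<lambda>a b t. expand S (\<Gamma>_nodes S i) (R\<^sub>\<Gamma> S i *\<^sub>v a) t + expand S (I_nodes S i) (R\<^sub>I S i *\<^sub>v b) t"
  note loc = fe_function_local[OF i _ a(1) b(1)] fe_function_local[OF i _ a(2) b(2)]
  have cong: "b_form S (sub S i) (fe_function S a b) (fe_function S v w) = b_form S (sub S i) (?e a b) (?e v w)"
    "H_form S (sub S i) (fe_function S a b) (fe_function S v w) = H_form S (sub S i) (?e a b) (?e v w)"
    by (rule local_forms_cong[OF i loc]; assumption)+
  have c: "R\<^sub>\<Gamma> S i *\<^sub>v x \<in> carrier_vec (card (\<Gamma>_nodes S i))" "R\<^sub>I S i *\<^sub>v x \<in> carrier_vec (card (I_nodes S i))" for x
    by (auto intro!: carrier_vecI simp: restriction_def)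
  show "b_form S (sub S i) (fe_function S a b) (fe_function S v w) =
      (B\<^sub>\<Gamma>\<^sub>\<Gamma> S i *\<^sub>v (R\<^sub>\<Gamma> S i *\<^sub>v a) + B\<^sub>\<Gamma>\<^sub>I S i *\<^sub>v (R\<^sub>I S i *\<^sub>v b)) \<bullet>c (R\<^sub>\<Gamma> S i *\<^sub>v v) +
      (B\<^sub>I\<^sub>\<Gamma> S i *\<^sub>v (R\<^sub>\<Gamma> S i *\<^sub>v a) + B\<^sub>I\<^sub>I S i *\<^sub>v (R\<^sub>I S i *\<^sub>v b)) \<bullet>c (R\<^sub>I S i *\<^sub>v w)"
    unfolding cong(1) by (rule form_expand_blocks[OF sesquilinear_b_form[OF subdomain_sets[OF i]] nodes_subset(1,2) c(1) c(1) c(2) c(2)])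
  show "H_form S (sub S i) (fe_function S a b) (fe_function S v w) =
      (H\<^sub>\<Gamma>\<^sub>\<Gamma> S i *\<^sub>v (R\<^sub>\<Gamma> S i *\<^sub>v a) + H\<^sub>\<Gamma>\<^sub>I S i *\<^sub>v (R\<^sub>I S i *\<^sub>v b)) \<bullet>c (R\<^sub>\<Gamma> S i *\<^sub>v v) +
      (H\<^sub>I\<^sub>\<Gamma> S i *\<^sub>v (R\<^sub>\<Gamma> S i *\<^sub>v a) + H\<^sub>I\<^sub>I S i *\<^sub>v (R\<^sub>I S i *\<^sub>v b)) \<bullet>c (R\<^sub>I S i *\<^sub>v w)"
    unfolding cong(2) by (rule form_expand_blocks[OF sesquilinear_H_form[OF subdomain_sets[OF i]] nodes_subset(1,2) c(1) c(1) c(2) c(2)])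
qed

definition assemble :: "(nat \<Rightarrow> complex Matrix.vec) \<Rightarrow> complex Matrix.vec" where
  "assemble w = Matrix.vec (card (all_I_nodes S)) (\<lambda>r. \<Sum>i<nsub S. ((R\<^sub>I S i)\<^sup>T *\<^sub>v w i) $ r)"

lemma assemble_carrier: "assemble w \<in> carrier_vec (card (all_I_nodes S))"
  by (simp add: assemble_def)

text \<open>The interior node sets of different subdomains are disjoint, so only the i-th zero
  extension contributes at a node of subdomain i.\<close>

lemma restriction_assemble:
  assumes i: "i < nsub S" and w: "\<And>i. i < nsub S \<Longrightarrow> w i \<in> carrier_vec (card (I_nodes S i))"
  shows "R\<^sub>I S i *\<^sub>v assemble w = w i"
proof (rule eq_vecI)
  fix r assume "r < dim_vec (w i)"
  then have r: "r < card (I_nodes S i)" using w[OF i] by simp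
  define y where "y = numbering (I_nodes S i) ! r"
  have yi: "y \<in> I_nodes S i" using numbering_nth[OF nodes_finite(2) r] by (simp add: y_def)
  then have "y \<in> all_I_nodes S" using local_nodes_subset(2)[OF i] by blast
  then obtain s where s: "s < card (all_I_nodes S)" "y = numbering (all_I_nodes S) ! s"
    using numbering[OF nodes_finite(4)] by (metis in_set_conv_nth)
  have "(R\<^sub>I S i *\<^sub>v assemble w) $ r = coeff_at (all_I_nodes S) (assemble w) y"
    unfolding y_def using r assemble_carrier by (intro restriction_index) auto
  also have "\<dots> = assemble w $ s" unfolding s(2) by (rule coeff_at_numbering[OF nodes_finite(4) s(1)])
  also have "\<dots> = (\<Sum>j<nsub S. ((R\<^sub>I S j)\<^sup>T *\<^sub>v w j) $ s)" using s(1) by (simp add: assemble_def)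
  also have "\<dots> = (\<Sum>j<nsub S. coeff_at (I_nodes S j) (w j) y)"
    unfolding s(2) using w s(1) by (intro sum.cong refl transpose_restriction_index) auto
  also have "\<dots> = (\<Sum>j<nsub S. if j = i then coeff_at (I_nodes S i) (w i) y else 0)"
  proof (rule sum.cong)
    fix j assume j: "j \<in> {..<nsub S}"
    have "y \<notin> I_nodes S j" if "j \<noteq> i"
      using that yi i j subdomains_disjoint[of i j] by (auto simp: I_nodes_def)
    then show "coeff_at (I_nodes S j) (w j) y = (if j = i then coeff_at (I_nodes S i) (w i) y else 0)"
      using coeff_at_outside[OF nodes_finite(2)] by auto
  qed simp
  also have "\<dots> = coeff_at (I_nodes S i) (w i) y" using i by simp
  also have "\<dots> = w i $ r" unfolding y_def by (rule coeff_at_numbering[OF nodes_finite(2) r])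
  finally show "(R\<^sub>I S i *\<^sub>v assemble w) $ r = w i $ r" .
qed (use w[OF i] in \<open>simp add: restriction_def\<close>)

end

subsection \<open>The coarse space\<close>

text \<open>The first two terms of \<open>B_P1\<close> thus recombine to \<open>B\<^sub>0\<close>,
  and only the two projected terms form the perturbation.\<close>

lemma Re_plus_Im_mat: "Re_mat A + \<i> \<cdot>\<^sub>m Im_mat A = A"
  by (rule eq_matI) (auto simp: Re_mat_def Im_mat_def complex_eq_iff)

locale coarse_space = fe_space S h \<sigma>
  for S :: "('d::finite, 'z) spectral_decomposition_scheme" and h \<sigma> :: real +
  assumes interior_eig: "interior_eigenproblem S" and cutoff_pos: "cutoff S > 0"
    and selection_eig: "selection_eigenproblems S" and threshold_nonneg: "0 \<le> threshold S"
begin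

abbreviation "nI i \<equiv> card (I_nodes S i)"
abbreviation "nG i \<equiv> card (\<Gamma>_nodes S i)"

lemma int_eigenbasis:
  assumes i: "i < nsub S"
  shows "int_vecs S i \<in> carrier_mat (nI i) (nI i)" "real_matrix (int_vecs S i)"
    and "(int_vecs S i)\<^sup>T * H\<^sub>I\<^sub>I S i * int_vecs S i = mat_diag (nI i) (\<lambda>_. 1)"
    and "(int_vecs S i)\<^sup>T * B\<^sub>I\<^sub>I S i * int_vecs S i = mat_diag (nI i) (\<lambda>j. complex_of_real (int_vals S i j))"
    and "int_vecs S i * (int_vecs S i)\<^sup>T * H\<^sub>I\<^sub>I S i = 1\<^sub>m (nI i)"
proof -
  have "real_eigenbasis (B\<^sub>I\<^sub>I S i) (H\<^sub>I\<^sub>I S i) (int_vecs S i) (int_vals S i)"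
    using interior_eig i by (simp add: interior_eigenproblem_def)
  note d = real_eigenbasis_diag[OF this form_matrix_carrier form_matrix_carrier]
  show "int_vecs S i \<in> carrier_mat (nI i) (nI i)" "real_matrix (int_vecs S i)"
    "(int_vecs S i)\<^sup>T * H\<^sub>I\<^sub>I S i * int_vecs S i = mat_diag (nI i) (\<lambda>_. 1)"
    "(int_vecs S i)\<^sup>T * B\<^sub>I\<^sub>I S i * int_vecs S i = mat_diag (nI i) (\<lambda>j. complex_of_real (int_vals S i j))"
    "int_vecs S i * (int_vecs S i)\<^sup>T * H\<^sub>I\<^sub>I S i = 1\<^sub>m (nI i)"
    by (fact d)+
qed

lemma Q_dim:
  assumes i: "i < nsub S"
  shows "Q\<^sub>S S i \<in> carrier_mat (nI i) (dim_col (Q\<^sub>S S i))" "Q\<^sub>L S i \<in> carrier_mat (nI i) (dim_col (Q\<^sub>L S i))"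
  using int_eigenbasis(1)[OF i] by (auto simp: Q\<^sub>S_def Q\<^sub>L_def intro!: carrier_matI)

lemma B_block:
  assumes i: "i < nsub S" and u: "u \<in> carrier_vec (nG i)" and v: "v \<in> carrier_vec (nG i)"
    and a: "a \<in> carrier_vec (dim_col (Q\<^sub>S S i))" and b: "b \<in> carrier_vec (dim_col (Q\<^sub>S S i))" and c: "c \<in> carrier_vec (dim_col (Q\<^sub>L S i))"
    and w: "w = - (B\<^sub>L S i *\<^sub>v (B\<^sub>I\<^sub>\<Gamma> S i *\<^sub>v u)) + Q\<^sub>S S i *\<^sub>v a" and z: "z = Q\<^sub>S S i *\<^sub>v b + Q\<^sub>L S i *\<^sub>v c"
  shows "(B\<^sub>\<Gamma>\<^sub>\<Gamma> S i *\<^sub>v u + B\<^sub>\<Gamma>\<^sub>I S i *\<^sub>v w) \<bullet>c v + (B\<^sub>I\<^sub>\<Gamma> S i *\<^sub>v u + B\<^sub>I\<^sub>I S i *\<^sub>v w) \<bullet>c z = (B\<^sub>0 S i *\<^sub>v (u @\<^sub>v a)) \<bullet>c (v @\<^sub>v b)"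
  unfolding B\<^sub>0_def
proof (rule block_elimination[OF form_matrix_carrier form_matrix_carrier form_matrix_carrier form_matrix_carrier
      int_eigenbasis(1,2,4)[OF i] _ Q\<^sub>S_def Q\<^sub>L_def B\<^sub>L_def u v a b c w z])
  \<comment> \<open>A high mode has eigenvalue of modulus at least the cut-off, which is
    positive.\<close>
  show "complex_of_real (int_vals S i j) \<noteq> 0" if "\<not> \<bar>int_vals S i j\<bar> < cutoff S" for j
    using that cutoff_pos by auto
qed

lemma H_block:
  assumes i: "i < nsub S" and u: "u \<in> carrier_vec (nG i)" and v: "v \<in> carrier_vec (nG i)"
    and a: "a \<in> carrier_vec (dim_col (Q\<^sub>S S i))" and b: "b \<in> carrier_vec (dim_col (Q\<^sub>S S i))" and c: "c \<in> carrier_vec (dim_col (Q\<^sub>L S i))"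
    and w: "w = - (H\<^sub>L S i *\<^sub>v (H\<^sub>I\<^sub>\<Gamma> S i *\<^sub>v u)) + Q\<^sub>S S i *\<^sub>v a" and z: "z = Q\<^sub>S S i *\<^sub>v b + Q\<^sub>L S i *\<^sub>v c"
  shows "(H\<^sub>\<Gamma>\<^sub>\<Gamma> S i *\<^sub>v u + H\<^sub>\<Gamma>\<^sub>I S i *\<^sub>v w) \<bullet>c v + (H\<^sub>I\<^sub>\<Gamma> S i *\<^sub>v u + H\<^sub>I\<^sub>I S i *\<^sub>v w) \<bullet>c z = (H\<^sub>0 S i *\<^sub>v (u @\<^sub>v a)) \<bullet>c (v @\<^sub>v b)"
  unfolding H\<^sub>0_def H_hat_def
  by (rule block_elimination[OF form_matrix_carrier form_matrix_carrier form_matrix_carrier form_matrix_carrier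
      int_eigenbasis(1,2,3)[OF i] _ Q\<^sub>S_def Q\<^sub>L_def H\<^sub>L_def u v a b c w z]) simp

lemma mat_inv_carrier:
  assumes i: "i < nsub S"
  shows "mat_inv ((Q\<^sub>L S i)\<^sup>T * B\<^sub>I\<^sub>I S i * Q\<^sub>L S i) \<in> carrier_mat (dim_col (Q\<^sub>L S i)) (dim_col (Q\<^sub>L S i))"
    and "mat_inv ((Q\<^sub>L S i)\<^sup>T * H\<^sub>I\<^sub>I S i * Q\<^sub>L S i) \<in> carrier_mat (dim_col (Q\<^sub>L S i)) (dim_col (Q\<^sub>L S i))"
proof -
  let ?P = "\<lambda>j. \<not> \<bar>int_vals S i j\<bar> < cutoff S"
  have d: "dim_col (Q\<^sub>L S i) = length (positions ?P (nI i))" using int_eigenbasis(1)[OF i] by (simp add: Q\<^sub>L_def)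
  show "mat_inv ((Q\<^sub>L S i)\<^sup>T * B\<^sub>I\<^sub>I S i * Q\<^sub>L S i) \<in> carrier_mat (dim_col (Q\<^sub>L S i)) (dim_col (Q\<^sub>L S i))"
    unfolding d unfolding Q\<^sub>L_def using cutoff_pos
    by (subst select_cols_diag_inverse[OF int_eigenbasis(1)[OF i] form_matrix_carrier int_eigenbasis(4)[OF i]]) auto
  show "mat_inv ((Q\<^sub>L S i)\<^sup>T * H\<^sub>I\<^sub>I S i * Q\<^sub>L S i) \<in> carrier_mat (dim_col (Q\<^sub>L S i)) (dim_col (Q\<^sub>L S i))"
    unfolding d unfolding Q\<^sub>L_def
    by (subst select_cols_diag_inverse[OF int_eigenbasis(1)[OF i] form_matrix_carrier int_eigenbasis(3)[OF i]]) auto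
qed

text \<open>The extension \<open>u\<^sub>0 \<mapsto> u\<^sub>h\<close> that is discrete harmonic with respect to \<open>b\<close> on the high-frequency
  interior modes; the analogue for the \<open>\<H>\<close>-inner product is \<open>\<H>\<^sub>0\<^sup>T\<close>.\<close>

definition B_interior :: "complex Matrix.vec \<times> (nat \<Rightarrow> complex Matrix.vec) \<Rightarrow> nat \<Rightarrow> complex Matrix.vec" where
  "B_interior u i = - (B\<^sub>L S i *\<^sub>v (B\<^sub>I\<^sub>\<Gamma> S i *\<^sub>v (R\<^sub>\<Gamma> S i *\<^sub>v fst u))) + Q\<^sub>S S i *\<^sub>v snd u i"

definition H_interior :: "complex Matrix.vec \<times> (nat \<Rightarrow> complex Matrix.vec) \<Rightarrow> nat \<Rightarrow> complex Matrix.vec" where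
  "H_interior u i = - (H\<^sub>L S i *\<^sub>v (H\<^sub>I\<^sub>\<Gamma> S i *\<^sub>v (R\<^sub>\<Gamma> S i *\<^sub>v fst u))) + Q\<^sub>S S i *\<^sub>v snd u i"

definition B_extension :: "complex Matrix.vec \<times> (nat \<Rightarrow> complex Matrix.vec) \<Rightarrow> real^'d \<Rightarrow> complex" where
  "B_extension u = fe_function S (fst u) (assemble (B_interior u))"

definition H_extension :: "complex Matrix.vec \<times> (nat \<Rightarrow> complex Matrix.vec) \<Rightarrow> real^'d \<Rightarrow> complex" where
  "H_extension u = fe_function S (fst u) (assemble (H_interior u))"

lemma coarse_norm_extension: "coarse_norm S u = H_norm S (H_extension u)"
  by (simp add: coarse_norm_def H_extension_def coarse_interior_def assemble_def H_interior_def)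

definition b0 :: "complex Matrix.vec \<times> (nat \<Rightarrow> complex Matrix.vec) \<Rightarrow> complex Matrix.vec \<times> (nat \<Rightarrow> complex Matrix.vec) \<Rightarrow> complex" where
  "b0 u v = (\<Sum>i<nsub S. (B\<^sub>0 S i *\<^sub>v coarse_restriction S i u) \<bullet>c coarse_restriction S i v)"

definition h0 :: "complex Matrix.vec \<times> (nat \<Rightarrow> complex Matrix.vec) \<Rightarrow> complex Matrix.vec \<times> (nat \<Rightarrow> complex Matrix.vec) \<Rightarrow> complex" where
  "h0 u v = (\<Sum>i<nsub S. (H\<^sub>0 S i *\<^sub>v coarse_restriction S i u) \<bullet>c coarse_restriction S i v)"

text \<open>\<open>v\<close> has the coarse degrees of freedom \<open>v\<^sub>0\<close>; the high-frequency interior part is arbitrary.\<close>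

definition lifts :: "complex Matrix.vec \<times> (nat \<Rightarrow> complex Matrix.vec) \<Rightarrow> (real^'d \<Rightarrow> complex) \<Rightarrow> bool" where
  "lifts v0 v \<longleftrightarrow> (\<exists>x\<in>carrier_vec (card (all_I_nodes S)). v = fe_function S (fst v0) x \<and>
     (\<forall>i<nsub S. \<exists>c\<in>carrier_vec (dim_col (Q\<^sub>L S i)). R\<^sub>I S i *\<^sub>v x = Q\<^sub>S S i *\<^sub>v snd v0 i + Q\<^sub>L S i *\<^sub>v c))"

lemma V0_carrier:
  assumes "u \<in> V\<^sub>0 S"
  shows "fst u \<in> carrier_vec (card (all_\<Gamma>_nodes S))" "i < nsub S \<Longrightarrow> snd u i \<in> carrier_vec (dim_col (Q\<^sub>S S i))"
proof -
  show "fst u \<in> carrier_vec (card (all_\<Gamma>_nodes S))" using assms by (simp only: V\<^sub>0_def mem_Times_iff)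
  have "snd u \<in> (\<Pi>\<^sub>E i\<in>{..<nsub S}. carrier_vec (dim_col (Q\<^sub>S S i)))"
    using assms by (simp only: V\<^sub>0_def mem_Times_iff)
  from PiE_mem[OF this, of i] show "snd u i \<in> carrier_vec (dim_col (Q\<^sub>S S i))" if "i < nsub S"
    using that by (simp only: lessThan_iff)
qed

lemma lifts_Vh: "v0 \<in> V\<^sub>0 S \<Longrightarrow> lifts v0 v \<Longrightarrow> v \<in> Vh S"
  unfolding lifts_def using fe_function_Vh V0_carrier(1) by blast

lemma R_carrier: "R\<^sub>\<Gamma> S i *\<^sub>v x \<in> carrier_vec (nG i)" "R\<^sub>I S i *\<^sub>v x \<in> carrier_vec (nI i)"
  by (auto intro!: carrier_vecI simp: restriction_def)

lemma lift_exists: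
  assumes v: "v \<in> Vh S"
  obtains v0 where "v0 \<in> V\<^sub>0 S" "lifts v0 v"
proof -
  obtain a b where ab: "a \<in> carrier_vec (card (all_\<Gamma>_nodes S))" "b \<in> carrier_vec (card (all_I_nodes S))" "v = fe_function S a b"
    using Vh_fe_function[OF v] by blast
  \<comment> \<open>Orthonormality of the modes for \<open>H\<^sub>I\<^sub>I\<close> identifies the
    low coefficients as energy products with the low modes.\<close>
  define v0 where "v0 = (a, \<lambda>i\<in>{..<nsub S}. (Q\<^sub>S S i)\<^sup>T *\<^sub>v (H\<^sub>I\<^sub>I S i *\<^sub>v (R\<^sub>I S i *\<^sub>v b)))"
  have "v0 \<in> V\<^sub>0 S" using ab(1) by (auto simp: v0_def V\<^sub>0_def intro!: carrier_vecI)
  moreover have "\<exists>c\<in>carrier_vec (dim_col (Q\<^sub>L S i)). R\<^sub>I S i *\<^sub>v b = Q\<^sub>S S i *\<^sub>v snd v0 i + Q\<^sub>L S i *\<^sub>v c" if i: "i < nsub S" for i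
  proof (rule bexI)
    show "R\<^sub>I S i *\<^sub>v b = Q\<^sub>S S i *\<^sub>v snd v0 i + Q\<^sub>L S i *\<^sub>v ((Q\<^sub>L S i)\<^sup>T *\<^sub>v (H\<^sub>I\<^sub>I S i *\<^sub>v (R\<^sub>I S i *\<^sub>v b)))"
      using eigenbasis_split[OF int_eigenbasis(1)[OF i] form_matrix_carrier int_eigenbasis(5)[OF i] R_carrier(2)[of i b],
          of "\<lambda>j. \<bar>int_vals S i j\<bar> < cutoff S"] i
      unfolding Q\<^sub>S_def[symmetric] Q\<^sub>L_def[symmetric] by (simp add: v0_def)
  qed (auto intro!: carrier_vecI)
  then have "lifts v0 v" unfolding lifts_def using ab by (auto simp: v0_def)
  ultimately show ?thesis by (rule that)
qed

lemma interior_splits: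
  assumes u: "u \<in> V\<^sub>0 S" and i: "i < nsub S"
  shows "\<exists>c\<in>carrier_vec (dim_col (Q\<^sub>L S i)). B_interior u i = Q\<^sub>S S i *\<^sub>v snd u i + Q\<^sub>L S i *\<^sub>v c"
    and "\<exists>c\<in>carrier_vec (dim_col (Q\<^sub>L S i)). H_interior u i = Q\<^sub>S S i *\<^sub>v snd u i + Q\<^sub>L S i *\<^sub>v c"
  unfolding B_interior_def H_interior_def B\<^sub>L_def H\<^sub>L_def
  by (intro elimination_split[OF Q_dim(2,1)[OF i]] mat_inv_carrier[OF i] V0_carrier(2)[OF u i]
      mult_mat_vec_carrier[OF form_matrix_carrier R_carrier(1)])+

lemma interior_carrier:
  assumes i: "i < nsub S"
  shows "B_interior u i \<in> carrier_vec (nI i)" "H_interior u i \<in> carrier_vec (nI i)"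
  by (rule carrier_vecI, simp only: B_interior_def H_interior_def index_add_vec dim_mult_mat_vec
      carrier_matD(1)[OF Q_dim(1)[OF i]])+

lemma restriction_interior:
  assumes i: "i < nsub S"
  shows "R\<^sub>I S i *\<^sub>v assemble (B_interior u) = B_interior u i" "R\<^sub>I S i *\<^sub>v assemble (H_interior u) = H_interior u i"
  by (rule restriction_assemble[OF i interior_carrier(1)], assumption)
    (rule restriction_assemble[OF i interior_carrier(2)])

lemma lifts_extension:
  assumes u: "u \<in> V\<^sub>0 S"
  shows "lifts u (B_extension u)" "lifts u (H_extension u)"
proof -
  have "lifts u (fe_function S (fst u) (assemble w))"
    if "\<And>i. i < nsub S \<Longrightarrow> \<exists>c\<in>carrier_vec (dim_col (Q\<^sub>L S i)). R\<^sub>I S i *\<^sub>v assemble w = Q\<^sub>S S i *\<^sub>v snd u i + Q\<^sub>L S i *\<^sub>v c" for w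
    unfolding lifts_def using that assemble_carrier by blast
  then show "lifts u (B_extension u)" "lifts u (H_extension u)"
    unfolding B_extension_def H_extension_def
    using interior_splits[OF u] restriction_interior by presburger+
qed

text \<open>Local block elimination, summed over the subdomains. The high coefficients of
  \<open>v\<close> drop out in each of them, so an arbitrary function is represented by its coarse
  components.\<close>

lemma extension_form:
  assumes u: "u \<in> V\<^sub>0 S" and v0: "v0 \<in> V\<^sub>0 S" and v: "lifts v0 v"
  shows "b_form S (dom S) (B_extension u) v = b0 u v0" "H_form S (dom S) (H_extension u) v = h0 u v0"
proof -
  obtain x where x: "x \<in> carrier_vec (card (all_I_nodes S))" "v = fe_function S (fst v0) x"
    and c: "\<And>i. i < nsub S \<Longrightarrow> \<exists>c\<in>carrier_vec (dim_col (Q\<^sub>L S i)). R\<^sub>I S i *\<^sub>v x = Q\<^sub>S S i *\<^sub>v snd v0 i + Q\<^sub>L S i *\<^sub>v c"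
    using v unfolding lifts_def by blast
  note uc = V0_carrier(1)[OF u] and vc = V0_carrier(1)[OF v0]
  have V: "v \<in> Vh S" "B_extension u \<in> Vh S" "H_extension u \<in> Vh S"
    using lifts_Vh[OF v0 v] lifts_Vh[OF u lifts_extension(1)[OF u]] lifts_Vh[OF u lifts_extension(2)[OF u]] .
  show "b_form S (dom S) (B_extension u) v = b0 u v0"
    unfolding b_form_subdomains[OF V(2,1)] b0_def
  proof (rule sum.cong)
    fix i assume "i \<in> {..<nsub S}"
    then have i: "i < nsub S" by simp
    obtain c where c: "c \<in> carrier_vec (dim_col (Q\<^sub>L S i))" "R\<^sub>I S i *\<^sub>v x = Q\<^sub>S S i *\<^sub>v snd v0 i + Q\<^sub>L S i *\<^sub>v c"
      using c[OF i] by blast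
    show "b_form S (sub S i) (B_extension u) v = (B\<^sub>0 S i *\<^sub>v coarse_restriction S i u) \<bullet>c coarse_restriction S i v0"
      unfolding B_extension_def x(2) local_form_fe_function(1)[OF i uc vc assemble_carrier x(1)]
        restriction_interior(1)[OF i] coarse_restriction_def
      by (rule B_block[OF i R_carrier(1) R_carrier(1) V0_carrier(2)[OF u i] V0_carrier(2)[OF v0 i] c(1) B_interior_def c(2)])
  qed simp
  show "H_form S (dom S) (H_extension u) v = h0 u v0"
    unfolding H_form_subdomains[OF V(3,1)] h0_def
  proof (rule sum.cong)
    fix i assume "i \<in> {..<nsub S}"
    then have i: "i < nsub S" by simp
    obtain c where c: "c \<in> carrier_vec (dim_col (Q\<^sub>L S i))" "R\<^sub>I S i *\<^sub>v x = Q\<^sub>S S i *\<^sub>v snd v0 i + Q\<^sub>L S i *\<^sub>v c"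
      using c[OF i] by blast
    show "H_form S (sub S i) (H_extension u) v = (H\<^sub>0 S i *\<^sub>v coarse_restriction S i u) \<bullet>c coarse_restriction S i v0"
      unfolding H_extension_def x(2) local_form_fe_function(2)[OF i uc vc assemble_carrier x(1)]
        restriction_interior(2)[OF i] coarse_restriction_def
      by (rule H_block[OF i R_carrier(1) R_carrier(1) V0_carrier(2)[OF u i] V0_carrier(2)[OF v0 i] c(1) H_interior_def c(2)])
  qed simp
qed

section \<open>The coarse norm: minimality and definiteness\<close>

lemma coarse_norm_h0: "u \<in> V\<^sub>0 S \<Longrightarrow> coarse_norm S u = sqrt (Re (h0 u u))"
  using extension_form(2)[OF _ _ lifts_extension(2)] by (simp add: coarse_norm_extension H_norm_def)

text \<open>Pythagoras: \<open>v\<close> and the energy extension E lift the same coarse vector, so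
  the product of E with \<open>v\<close> equals the product of E with itself. The energy of
  \<open>v - E\<close>, which is nonnegative, is therefore the difference of the two
  energies.\<close>

lemma coarse_norm_le:
  assumes u: "u \<in> V\<^sub>0 S" and v: "lifts u v"
  shows "coarse_norm S u \<le> H_norm S v"
proof -
  let ?H = "H_form S (dom S)" and ?E = "H_extension u"
  have V: "v \<in> Vh S" "?E \<in> Vh S" using lifts_Vh[OF u v] lifts_Vh[OF u lifts_extension(2)[OF u]] .
  have W: "(\<lambda>x. (-1) * ?E x) \<in> Vh S" by (rule Vh_scale[OF V(2)])
  have ses: "sesquilinear_on (Vh S) ?H" by (rule sesquilinear_H_form[OF dom_sets])
  note add = sesquilinear_onD(1)[OF ses]
  note scale = sesquilinear_onD(2)[OF ses]
  have "?H (\<lambda>x. v x + (-1) * ?E x) (\<lambda>x. v x + (-1) * ?E x) = ?H v v - ?H v ?E - ?H ?E v + ?H ?E ?E"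
    using add[rule_format, OF V(1) W Vh_add[OF V(1) W]] add[rule_format, OF V(1) W V(1)] add[rule_format, OF V(1) W W]
      scale[rule_format, OF V(2) V(1), of "-1"] scale[rule_format, OF V(2) W, of "-1"] scale[rule_format, OF V(2) V(2), of "-1"]
    by simp
  moreover have "?H ?E v = h0 u u" "?H ?E ?E = h0 u u"
    using extension_form(2)[OF u u] v lifts_extension(2)[OF u] by blast+
  moreover have "Re (?H v ?E) = Re (?H ?E v)" by (simp add: H_form_cnj[of S "dom S" v ?E])
  ultimately have "Re (h0 u u) \<le> Re (?H v v)"
    using Re_H_form_nonneg[of S "dom S" "\<lambda>x. v x + (-1) * ?E x"] by simp
  then show ?thesis unfolding coarse_norm_h0[OF u] H_norm_def by simp
qed

lemma local_dim:
  shows "B\<^sub>0 S i \<in> carrier_mat (nG i + dim_col (Q\<^sub>S S i)) (nG i + dim_col (Q\<^sub>S S i))"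
    and "H\<^sub>0 S i \<in> carrier_mat (nG i + dim_col (Q\<^sub>S S i)) (nG i + dim_col (Q\<^sub>S S i))"
    and "C\<^sub>0 S i \<in> carrier_mat (nG i + dim_col (Q\<^sub>S S i)) (nG i + dim_col (Q\<^sub>S S i))"
  by (auto simp: B\<^sub>0_def H\<^sub>0_def C\<^sub>0_def H_hat_def C_hat_def form_matrix_def intro!: carrier_matI)

lemma Re_mat_carrier: "A \<in> carrier_mat n m \<Longrightarrow> Re_mat A \<in> carrier_mat n m"
  by (simp add: Re_mat_def)

lemma coarse_restriction_carrier:
  assumes "u \<in> V\<^sub>0 S" "i < nsub S"
  shows "coarse_restriction S i u \<in> carrier_vec (nG i + dim_col (Q\<^sub>S S i))"
  unfolding coarse_restriction_def by (rule append_carrier_vec[OF R_carrier(1) V0_carrier(2)[OF assms]])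

text \<open>Definiteness is read off from the first selection eigenproblem, whose eigenvectors are
  orthonormal for \<open>H\<^sub>0\<close>.\<close>

lemma H0_form:
  assumes i: "i < nsub S" and x: "x \<in> carrier_vec (nG i + dim_col (Q\<^sub>S S i))"
  shows "0 \<le> Re ((H\<^sub>0 S i *\<^sub>v x) \<bullet>c x)"
    and "x \<noteq> 0\<^sub>v (nG i + dim_col (Q\<^sub>S S i)) \<Longrightarrow> 0 < Re ((H\<^sub>0 S i *\<^sub>v x) \<bullet>c x)"
proof -
  have "real_eigenbasis (Re_mat (B\<^sub>0 S i)) (H\<^sub>0 S i) (vecs1 S i) (vals1 S i)"
    using selection_eig i by (simp add: selection_eigenproblems_def)
  note d = real_eigenbasis_diag[OF this Re_mat_carrier[OF local_dim(1)] local_dim(2)]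
  note form = eigenbasis_form[OF d(1,2) local_dim(2) d(5) x]
  show "0 \<le> Re ((H\<^sub>0 S i *\<^sub>v x) \<bullet>c x)" unfolding form(1) by simp
  show "0 < Re ((H\<^sub>0 S i *\<^sub>v x) \<bullet>c x)" if "x \<noteq> 0\<^sub>v (nG i + dim_col (Q\<^sub>S S i))"
    unfolding form(1) using form(2)[OF that] by simp
qed

text \<open>As a Euclidean norm of local norms, the coarse norm is ready for Cauchy-Schwarz over the
  subdomains.\<close>

lemma coarse_norm_L2:
  assumes "u \<in> V\<^sub>0 S"
  shows "coarse_norm S u = L2_set (\<lambda>i. sqrt (Re ((H\<^sub>0 S i *\<^sub>v coarse_restriction S i u) \<bullet>c coarse_restriction S i u))) {..<nsub S}"
  unfolding coarse_norm_h0[OF assms] L2_set_def h0_def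
  using H0_form(1) coarse_restriction_carrier[OF assms] by simp

text \<open>Every node of the skeleton \<Gamma> lies on the boundary of some subdomain, so the local
  restrictions together see every coordinate.\<close>

lemma coarse_restriction_nonzero:
  assumes u: "u \<in> V\<^sub>0 S" and nz: "u \<noteq> zero\<^sub>0 S"
  shows "\<exists>i<nsub S. coarse_restriction S i u \<noteq> 0\<^sub>v (nG i + dim_col (Q\<^sub>S S i))"
proof (rule ccontr)
  assume "\<not> ?thesis"
  then have z: "coarse_restriction S i u = 0\<^sub>v (nG i + dim_col (Q\<^sub>S S i))" if "i < nsub S" for i
    using that by blast
  have R0: "(R\<^sub>\<Gamma> S i *\<^sub>v fst u) $ r = 0" if i: "i < nsub S" and r: "r < nG i" for i r
  proof -
    have "(R\<^sub>\<Gamma> S i *\<^sub>v fst u) $ r = coarse_restriction S i u $ r"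
      using r R_carrier(1)[of i "fst u"] by (simp add: coarse_restriction_def carrier_vecD del: index_mult_mat_vec dim_mult_mat_vec)
    then show ?thesis using z[OF i] r by simp
  qed
  have S0: "snd u i = 0\<^sub>v (dim_col (Q\<^sub>S S i))" if i: "i < nsub S" for i
  proof (rule eq_vecI)
    fix r assume "r < dim_vec (0\<^sub>v (dim_col (Q\<^sub>S S i)))"
    then have r: "r < dim_col (Q\<^sub>S S i)" by simp
    have "snd u i $ r = coarse_restriction S i u $ (nG i + r)"
      using r V0_carrier(2)[OF u i] carrier_vecD[OF R_carrier(1)[of i "fst u"]] by (simp add: coarse_restriction_def del: dim_mult_mat_vec)
    then show "snd u i $ r = 0\<^sub>v (dim_col (Q\<^sub>S S i)) $ r" using z[OF i] r by simp
  qed (use V0_carrier(2)[OF u i] in simp)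
  have "fst u = 0\<^sub>v (card (all_\<Gamma>_nodes S))"
  proof (rule eq_vecI)
    fix r assume "r < dim_vec (0\<^sub>v (card (all_\<Gamma>_nodes S)))"
    then have r: "r < card (all_\<Gamma>_nodes S)" by simp
    define y where "y = numbering (all_\<Gamma>_nodes S) ! r"
    have "y \<in> all_\<Gamma>_nodes S" unfolding y_def by (rule numbering_nth[OF nodes_finite(3) r])
    then obtain i where i: "i < nsub S" "y \<in> \<Gamma>_nodes S i" unfolding all_\<Gamma>_nodes_def by blast
    then obtain s where s: "s < nG i" "y = numbering (\<Gamma>_nodes S i) ! s"
      using numbering[OF nodes_finite(1)] by (metis in_set_conv_nth)
    have "fst u $ r = coeff_at (all_\<Gamma>_nodes S) (fst u) y"
      unfolding y_def by (rule coeff_at_numbering[OF nodes_finite(3) r, symmetric])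
    also have "\<dots> = (R\<^sub>\<Gamma> S i *\<^sub>v fst u) $ s"
      unfolding s(2) by (rule restriction_index[symmetric, OF carrier_vecD[OF V0_carrier(1)[OF u]] s(1)])
    finally show "fst u $ r = 0\<^sub>v (card (all_\<Gamma>_nodes S)) $ r" using R0[OF i(1) s(1)] r by simp
  qed (use V0_carrier(1)[OF u] in simp)
  moreover have "snd u = (\<lambda>i\<in>{..<nsub S}. 0\<^sub>v (dim_col (Q\<^sub>S S i)))"
  proof
    \<comment> \<open>Outside the index set both families are \<open>undefined\<close>, since
      members of \<open>V\<^sub>0\<close> are extensional.\<close>
    show "snd u i = (\<lambda>i\<in>{..<nsub S}. 0\<^sub>v (dim_col (Q\<^sub>S S i))) i" for i
      using S0[of i] u by (cases "i < nsub S") (auto simp: V\<^sub>0_def PiE_def extensional_def)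
  qed
  ultimately have "u = zero\<^sub>0 S" unfolding zero\<^sub>0_def by (metis prod.collapse)
  with nz show False ..
qed

lemma coarse_norm_pos:
  assumes u: "u \<in> V\<^sub>0 S" "u \<noteq> zero\<^sub>0 S"
  shows "coarse_norm S u > 0"
proof -
  obtain i where i: "i < nsub S" "coarse_restriction S i u \<noteq> 0\<^sub>v (nG i + dim_col (Q\<^sub>S S i))"
    using coarse_restriction_nonzero[OF u] by blast
  have "0 < (\<Sum>i<nsub S. Re ((H\<^sub>0 S i *\<^sub>v coarse_restriction S i u) \<bullet>c coarse_restriction S i u))"
    using H0_form[OF _ coarse_restriction_carrier[OF u(1)]] i by (intro sum_pos2[of _ i]) auto
  then show ?thesis unfolding coarse_norm_h0[OF u(1)] h0_def by simp
qed

text \<open>Each subdomain contributes at most 2\<eta> times the product of its local norms.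
  Cauchy-Schwarz turns the sum of these products into the product of the global norms without
  enlarging the constant.\<close>

lemma b_P1_perturbation:
  assumes u: "u \<in> V\<^sub>0 S" and v: "v \<in> V\<^sub>0 S"
  shows "cmod (b_P1 S u v - b0 u v) \<le> 2 * threshold S * (coarse_norm S u * coarse_norm S v)"
proof -
  let ?r = "\<lambda>i. coarse_restriction S i"
  let ?n = "\<lambda>i u. sqrt (Re ((H\<^sub>0 S i *\<^sub>v ?r i u) \<bullet>c ?r i u))"
  have loc: "cmod ((B_P1 S i *\<^sub>v ?r i u) \<bullet>c ?r i v - (B\<^sub>0 S i *\<^sub>v ?r i u) \<bullet>c ?r i v) \<le> 2 * threshold S * (?n i u * ?n i v)"
    if i: "i < nsub S" for i
  proof -
    define n where "n = nG i + dim_col (Q\<^sub>S S i)"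
    note dims = local_dim[of i, folded n_def]
    have re: "Re_mat (B\<^sub>0 S i) \<in> carrier_mat n n" by (rule Re_mat_carrier[OF dims(1)])
    have xu: "?r i u \<in> carrier_vec n" and xv: "?r i v \<in> carrier_vec n"
      unfolding n_def using coarse_restriction_carrier u v i by blast+
    have eig1: "real_eigenbasis (Re_mat (B\<^sub>0 S i)) (H\<^sub>0 S i) (vecs1 S i) (vals1 S i)"
      and eig2: "real_eigenbasis ((Q\<^sub>1_perp S i)\<^sup>T * C\<^sub>0 S i * Q\<^sub>1_perp S i) ((Q\<^sub>1_perp S i)\<^sup>T * H\<^sub>0 S i * Q\<^sub>1_perp S i) (vecs2 S i) (vals2 S i)"
      using selection_eig i by (simp_all add: selection_eigenproblems_def)
    define J where "J = 1\<^sub>m n - Q_Re S i * (Q_Re S i)\<^sup>T * H\<^sub>0 S i"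
    have dJ: "J \<in> carrier_mat n n"
      using carrier_matD[OF dims(2)] carrier_matD[OF real_eigenbasis_diag(1)[OF eig1 re dims(2)]]
      unfolding J_def Q_Re_def Q\<^sub>1_def by (intro carrier_matI) simp_all
    define X where "X = J\<^sup>T * Re_mat (B\<^sub>0 S i) * J"
    define Y where "Y = J\<^sup>T * C\<^sub>0 S i * J"
    have X: "X \<in> carrier_mat n n" and Y: "Y \<in> carrier_mat n n"
      using dJ re dims(3) by (auto simp: X_def Y_def)
    have BP: "B_P1 S i = B\<^sub>0 S i - X + Y"
      unfolding B_P1_def Let_def Re_plus_Im_mat \<Pi>_Re_def X_def Y_def J_def using dims(2) by simp
    have "B_P1 S i *\<^sub>v ?r i u = B\<^sub>0 S i *\<^sub>v ?r i u - X *\<^sub>v ?r i u + Y *\<^sub>v ?r i u"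
      unfolding BP using dims(1) X Y xu
      by (subst add_mult_distrib_mat_vec[of _ n n], auto) (subst minus_mult_distrib_mat_vec[of _ n n], auto)
    also have "\<dots> \<bullet>c ?r i v = (B\<^sub>0 S i *\<^sub>v ?r i u) \<bullet>c ?r i v - (X *\<^sub>v ?r i u) \<bullet>c ?r i v + (Y *\<^sub>v ?r i u) \<bullet>c ?r i v"
      using dims(1) X Y xu xv
      by (subst add_scalar_prod_distrib[of _ n], auto) (subst minus_scalar_prod_distrib[of _ n], auto)
    finally have eq: "(B_P1 S i *\<^sub>v ?r i u) \<bullet>c ?r i v - (B\<^sub>0 S i *\<^sub>v ?r i u) \<bullet>c ?r i v =
        (Y *\<^sub>v ?r i u) \<bullet>c ?r i v - (X *\<^sub>v ?r i u) \<bullet>c ?r i v" by simp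
    show ?thesis
      unfolding eq unfolding X_def Y_def
      by (rule spectral_perturbation[OF re dims(2,3) eig1 Q\<^sub>1_def Q\<^sub>1_perp_def eig2 Q\<^sub>2_def Q_Re_def J_def xu xv threshold_nonneg])
  qed
  have "cmod (b_P1 S u v - b0 u v) \<le> (\<Sum>i<nsub S. 2 * threshold S * (?n i u * ?n i v))"
    unfolding b_P1_def b0_def sum_subtractf[symmetric]
    by (rule order_trans[OF norm_sum]) (intro sum_mono loc, simp)
  also have "\<dots> = 2 * threshold S * (\<Sum>i<nsub S. \<bar>?n i u\<bar> * \<bar>?n i v\<bar>)"
    unfolding sum_distrib_left
    using H0_form(1)[OF _ coarse_restriction_carrier[OF u]] H0_form(1)[OF _ coarse_restriction_carrier[OF v]]
    by (intro sum.cong) auto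
  also have "\<dots> \<le> 2 * threshold S * (coarse_norm S u * coarse_norm S v)"
    unfolding coarse_norm_L2[OF u] coarse_norm_L2[OF v]
    using threshold_nonneg by (intro mult_left_mono L2_set_mult_ineq) auto
  finally show ?thesis .
qed

lemma H_norm_zero: "H_norm S (\<lambda>x. 0) = 0"
  using sesquilinear_onD(2)[OF sesquilinear_H_form[OF dom_sets], rule_format, OF Vh_zero Vh_zero, of 0]
  by (simp add: H_norm_def)

text \<open>A coarse trial vector is extended so as to evaluate b exactly; the inf-sup condition
  supplies a nearly optimal test function, of which only the coarse components matter.\<close>

theorem inf_sup_b_P1:
  assumes inf_sup: "inf_sup (Vh S) (\<lambda>x. 0) (b_form S (dom S)) (H_norm S) \<ge> ereal \<gamma>"
    and \<gamma>: "2 * threshold S < \<gamma>"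
  shows "inf_sup (V\<^sub>0 S) (zero\<^sub>0 S) (b_P1 S) (coarse_norm S) \<ge> ereal (\<gamma> - 2 * threshold S)"
  unfolding inf_sup_def
proof (rule INF_greatest)
  fix u assume "u \<in> V\<^sub>0 S - {zero\<^sub>0 S}"
  then have u: "u \<in> V\<^sub>0 S" and upos: "coarse_norm S u > 0" using coarse_norm_pos by auto
  define w where "w = B_extension u"
  have w: "w \<in> Vh S" "lifts u w" unfolding w_def using lifts_extension(1)[OF u] lifts_Vh[OF u] by blast+
  have wu: "coarse_norm S u \<le> H_norm S w" by (rule coarse_norm_le[OF u w(2)])
  have wn: "w \<noteq> (\<lambda>x. 0)" using wu upos H_norm_zero by auto
  have sup: "ereal \<gamma> \<le> (SUP v\<in>Vh S - {\<lambda>x. 0}. ereal (cmod (b_form S (dom S) w v) / (H_norm S w * H_norm S v)))"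
    using inf_sup w(1) wn unfolding inf_sup_def by (intro order_trans[OF inf_sup[unfolded inf_sup_def]] INF_lower) auto
  show "ereal (\<gamma> - 2 * threshold S) \<le> (SUP v\<in>V\<^sub>0 S - {zero\<^sub>0 S}. ereal (cmod (b_P1 S u v) / (coarse_norm S u * coarse_norm S v)))"
  proof (rule ereal_le_epsilon2)
    fix e :: real assume e: "0 < e"
    \<comment> \<open>The supremum need not be attained, so a small loss is allowed. The cap at half
      the gap keeps \<gamma> - e' above 2\<eta>, hence positive, as multiplying the norm
      inequalities by it requires.\<close>
    define e' where "e' = min e ((\<gamma> - 2 * threshold S) / 2)"
    have e': "0 < e'" "e' \<le> e" "2 * threshold S < \<gamma> - e'" using e \<gamma> by (auto simp: e'_def min_def field_simps)
    have "ereal (\<gamma> - e') < ereal \<gamma>" using e' by simp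
    then have "ereal (\<gamma> - e') < (SUP v\<in>Vh S - {\<lambda>x. 0}. ereal (cmod (b_form S (dom S) w v) / (H_norm S w * H_norm S v)))"
      using sup by (rule less_le_trans)
    then obtain v where v: "v \<in> Vh S" "\<gamma> - e' < cmod (b_form S (dom S) w v) / (H_norm S w * H_norm S v)"
      unfolding less_SUP_iff by auto
    obtain v0 where v0: "v0 \<in> V\<^sub>0 S" "lifts v0 v" using lift_exists[OF v(1)] by blast
    have b: "b_form S (dom S) w v = b0 u v0" unfolding w_def by (rule extension_form(1)[OF u v0])
    have quot: "0 < cmod (b_form S (dom S) w v) / (H_norm S w * H_norm S v)"
      using v(2) e'(3) threshold_nonneg by linarith
    have "0 \<le> H_norm S v" unfolding H_norm_def using Re_H_form_nonneg by simp
    \<comment> \<open>A quotient with denominator 0 would be 0, so a positive quotient excludes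
      vanishing norms.\<close>
    then have vpos: "0 < H_norm S w" "0 < H_norm S v" using quot wu upos by (auto simp: zero_less_divide_iff less_le)
    have b0: "b0 u v0 \<noteq> 0" using quot b by auto
    have v0n: "v0 \<noteq> zero\<^sub>0 S"
    proof
      assume v0z: "v0 = zero\<^sub>0 S"
      have "coarse_restriction S i v0 = 0\<^sub>v (nG i + dim_col (Q\<^sub>S S i))" if "i < nsub S" for i
        unfolding v0z zero\<^sub>0_def coarse_restriction_def using that
        by (intro eq_vecI) (auto simp: restriction_def scalar_prod_def)
      then have "b0 u v0 = 0" unfolding b0_def using mult_mat_vec_carrier[OF local_dim(1) coarse_restriction_carrier[OF u]]
        by (intro sum.neutral) (auto intro!: scalar_prod_right_zero)
      with b0 show False ..
    qed
    have v0pos: "coarse_norm S v0 > 0" by (rule coarse_norm_pos[OF v0(1) v0n])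
    \<comment> \<open>Passing to coarse components leaves the numerator unchanged and can only
      shrink both norms in the denominator.\<close>
    have "(\<gamma> - e') * (coarse_norm S u * coarse_norm S v0) \<le> (\<gamma> - e') * (H_norm S w * H_norm S v)"
      using e'(3) threshold_nonneg upos v0pos wu coarse_norm_le[OF v0] by (intro mult_left_mono mult_mono) auto
    also have "\<dots> \<le> cmod (b0 u v0)" using v(2) vpos unfolding b by (simp add: pos_less_divide_eq)
    also have "\<dots> \<le> cmod (b_P1 S u v0) + cmod (b_P1 S u v0 - b0 u v0)"
      using norm_triangle_ineq4[of "b_P1 S u v0" "b_P1 S u v0 - b0 u v0"] by simp
    also have "\<dots> \<le> cmod (b_P1 S u v0) + 2 * threshold S * (coarse_norm S u * coarse_norm S v0)"
      using b_P1_perturbation[OF u v0(1)] by simp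
    finally have "(\<gamma> - e' - 2 * threshold S) * (coarse_norm S u * coarse_norm S v0) \<le> cmod (b_P1 S u v0)"
      by (simp add: algebra_simps)
    then have "\<gamma> - e' - 2 * threshold S \<le> cmod (b_P1 S u v0) / (coarse_norm S u * coarse_norm S v0)"
      using upos v0pos by (simp add: pos_le_divide_eq)
    then have "\<gamma> - 2 * threshold S \<le> cmod (b_P1 S u v0) / (coarse_norm S u * coarse_norm S v0) + e" using e'(2) by linarith
    then have "ereal (\<gamma> - 2 * threshold S) \<le> ereal (cmod (b_P1 S u v0) / (coarse_norm S u * coarse_norm S v0)) + ereal e" by simp
    also have "\<dots> \<le> (SUP v\<in>V\<^sub>0 S - {zero\<^sub>0 S}. ereal (cmod (b_P1 S u v) / (coarse_norm S u * coarse_norm S v))) + ereal e"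
      using v0(1) v0n by (intro add_right_mono SUP_upper) auto
    finally show "ereal (\<gamma> - 2 * threshold S) \<le> (SUP v\<in>V\<^sub>0 S - {zero\<^sub>0 S}. ereal (cmod (b_P1 S u v) / (coarse_norm S u * coarse_norm S v))) + ereal e" .
  qed
qed

end

theorem theorem4p5:
  fixes S :: "'d::finite spectral_decomposition"
    and h \<sigma> k\<^sub>0 \<beta> \<eta> \<gamma> \<gamma>\<^sub>1 :: real
  assumes "CARD('d) = 2 \<or> CARD('d) = 3"
    and "fe_setting h \<sigma> S"
    and "k\<^sub>0 > 0" and "wavenumber S \<ge> k\<^sub>0"
    and "\<gamma> > 0" and "inf_sup (Vh S) (\<lambda>x. 0) (b_form S (dom S)) (H_norm S) \<ge> ereal \<gamma>"
    and "cutoff S = \<beta>" and "\<beta> > 0" and "interior_eigenproblem S"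
    and "threshold S = \<eta>" and "0 < \<eta>" and "\<eta> < 1" and "selection_eigenproblems S"
    and "\<gamma>\<^sub>1 = \<gamma> - 2 * \<eta>" and "\<gamma>\<^sub>1 > 0"
  shows "inf_sup (V\<^sub>0 S) (zero\<^sub>0 S) (b_P1 S) (coarse_norm S) \<ge> ereal \<gamma>\<^sub>1"
proof -
  interpret coarse_space S h \<sigma>
    by unfold_locales (use assms in auto)
  show ?thesis using inf_sup_b_P1[OF assms(6)] assms(10,14,15) by simp
qed

end
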